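(* Let $\varepsilon>0$, $\Gamma>0$ and let $\mathbf{H}$ be the family of probability distributions $\kappa$ on $\mathbb{R}$ with $\mathbb{E}_{X\sim\kappa}[|X|^{1+\varepsilon}]\le\Gamma$. Let $\nu\in\mathbf{H}$ satisfy $\mathbb{E}_{X\sim\nu}[|X|^{1+\varepsilon}]<\Gamma$, with mean $m(\nu)=\mu$, let $\mathcal{C}$ be a cost distribution with mean $0<\overline c<\infty$, and let $C_\delta\to\infty$ (as $\delta\to0$) be a budget for which $\lim_{\delta\to0}C_\delta/\log(1/\delta)$ exists in $[0,\infty]$. The $KL_{\rm inf}$-based policy $\pi_1^{\rm h}$ with threshold $\beta(n,\delta)=1+\log\left(\frac{2(1+n)^2}{\delta}\right)$ has the following properties: (a) $\pi_1^{\rm h}\in\hat\Pi^s_{\rm CI}$. (b) If $\lim_{\delta\to0}\frac{C_\delta}{\log(1/\delta)}=k$ with $k\in(0,\infty)$, then its limiting endpoints are $\mu_R^{\pi_1^{\rm h}}(\nu)=\mu_R^*(\nu,k,\overline c)$ and $\mu_L^{\pi_1^{\rm h}}(\nu)=\mu_L^*(\nu,k,\overline c)$, where $\mu_L^*(\nu,k,\overline c)<\mu$ and $\mu_R^*(\nu,k,\overline c)>\mu$ uniquely solve $KL_{\rm inf}(\nu,\mathbf{H},\mu_R^*(\nu,k,\overline c))=KL_{\rm inf}(\nu,\mathbf{H},\mu_L^*(\nu,k,\overline c))=\frac{\overline c}{k}$. (c) If $\lim_{\delta\to0}\frac{C_\delta}{\log(1/\delta)}=\infty$, then $\mu_R^{\pi_1^{\rm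 h}}(\nu)-\mu_L^{\pi_1^{\rm h}}(\nu)=0$.
   Context: $m(\kappa)$ denotes the mean of $\kappa$. For any distribution $\nu$ with finite mean (not necessarily in $\mathbf{H}$), $KL_{\rm inf}(\nu,\mathbf{H},x)=\inf\{KL(\nu,\kappa):\kappa\in\mathbf{H},\,m(\kappa)\ge x\}$ if $x\ge m(\nu)$, and $=\inf\{KL(\nu,\kappa):\kappa\in\mathbf{H},\,m(\kappa)\le x\}$ if $x<m(\nu)$, where $KL$ is the Kullback–Leibler divergence (infimum over the empty set is $+\infty$). Random costs. $X_1,X_2,\dots$ are i.i.d. from $\nu$; the costs $c_1,c_2,\dots$ are i.i.d. from a distribution $\mathcal{C}$ supported on $(0,\infty)$ with mean $\overline c$, independent of the $X_i$. For a budget $C_\delta>0$, $\tau_\delta=\sup\{n\in\mathbb{Z}^+:\sum_{i=1}^nc_i\le C_\delta\}$ (with $\tau_\delta=0$ if the set is empty). $\mathbb{P}_\nu$ denotes the joint law of samples and costs. Policies and stability. A policy $\pi$ reports, for each $\delta\in(0,1)$, an interval $[\widehat\mu_L^\pi(\tau_\delta,\delta),\widehat\mu_R^\pi(\tau_\delta,\delta)]$ whose endpoints are measurable functions of $\tau_\delta$ and $X_1,\dots,X_{\tau_\delta}$. $\hat\Pi_{\rm CI}$ is the set of policies such that for every $\nu\in\mathbf{H}$ and every $\delta\in(0,1)$, $\mathbb{P}_\nu(m(\nu)\in[\widehat\mu_L^\pi(\tau_\delta,\delta),\widehat\mu_R^\pi(\tau_\delta,\delta)])\ge1-\delta$. A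 policy $\pi\in\hat\Pi_{\rm CI}$ is stable (for $\nu$, $\mathcal{C}$, $C_\delta$) if, as $\delta\to0$, under $\mathbb{P}_\nu$, $\widehat\mu_L^\pi(\tau_\delta,\delta)\overset{p}{\to}\mu_L^\pi(\nu)$ and $\widehat\mu_R^\pi(\tau_\delta,\delta)\overset{p}{\to}\mu_R^\pi(\nu)$, where $\mu_L^\pi(\nu)\le m(\nu)\le\mu_R^\pi(\nu)$ are deterministic constants ($\pm\infty$ allowed), called the limiting endpoints. $\hat\Pi^s_{\rm CI}$ is the set of policies in $\hat\Pi_{\rm CI}$ that are stable for the given $\nu$. Policy $\pi_1^{\rm h}$. Let $\hat\nu_n$ be the empirical distribution of $X_1,\dots,X_n$. For $n\ge1$, the right endpoint is $\sup\{q>m(\hat\nu_n):n\,KL_{\rm inf}(\hat\nu_n,\mathbf{H},q)\le\beta(n,\delta)\}$ and the left endpoint is $\inf\{q<m(\hat\nu_n):n\,KL_{\rm inf}(\hat\nu_n,\mathbf{H},q)\le\beta(n,\delta)\}$, each taken to be $m(\hat\nu_n)$ if the corresponding set is empty; for $n=0$ the interval is $[-\Gamma^{1/(1+\varepsilon)},\Gamma^{1/(1+\varepsilon)}]$. The reported interval is evaluated at $n=\tau_\delta$. *)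

theory Defs
  imports "HOL-Probability.Probability"
begin

definition mean :: "real measure \<Rightarrow> real" where
  "mean \<kappa> = (\<integral>x. x \<partial>\<kappa>)"

definition heavy_tailed :: "real \<Rightarrow> real \<Rightarrow> real measure set" where
  "heavy_tailed \<epsilon> \<Gamma> =
     {\<kappa>. real_distribution \<kappa> \<and> (\<integral>\<^sup>+ x. ennreal (\<bar>x\<bar> powr (1 + \<epsilon>)) \<partial>\<kappa>) \<le> ennreal \<Gamma>}"

(* The library's KL_divergence is real-valued, takes its arguments in the opposite order, and is
   meaningful only if \<nu> is absolutely continuous w.r.t. \<kappa> with integrable log-density. The negative
   part of the log-density is always \<nu>-integrable, so in all other cases the divergence is +\<infinity>. *)
definition KL :: "real measure \<Rightarrow> real measure \<Rightarrow> ereal" where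
  "KL \<nu> \<kappa> =
     (if absolutely_continuous \<kappa> \<nu> \<and> integrable \<nu> (entropy_density (exp 1) \<kappa> \<nu>)
      then ereal (KL_divergence (exp 1) \<kappa> \<nu>) else \<infinity>)"

definition KL_inf :: "real measure \<Rightarrow> real measure set \<Rightarrow> real \<Rightarrow> ereal" where
  "KL_inf \<nu> H x =
     (if mean \<nu> \<le> x then (INF \<kappa>\<in>{\<kappa>\<in>H. x \<le> mean \<kappa>}. KL \<nu> \<kappa>)
      else (INF \<kappa>\<in>{\<kappa>\<in>H. mean \<kappa> \<le> x}. KL \<nu> \<kappa>))"

definition mu_R_star :: "real measure set \<Rightarrow> real measure \<Rightarrow> real \<Rightarrow> real \<Rightarrow> real" where
  "mu_R_star H \<nu> k cbar = (THE x. mean \<nu> < x \<and> KL_inf \<nu> H x = ereal (cbar / k))"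

definition mu_L_star :: "real measure set \<Rightarrow> real measure \<Rightarrow> real \<Rightarrow> real \<Rightarrow> real" where
  "mu_L_star H \<nu> k cbar = (THE x. x < mean \<nu> \<and> KL_inf \<nu> H x = ereal (cbar / k))"

definition cost_distribution :: "real measure \<Rightarrow> bool" where
  "cost_distribution \<C> \<longleftrightarrow>
     real_distribution \<C> \<and> (AE c in \<C>. 0 < c) \<and> integrable \<C> (\<lambda>c. c)"

(* Outcomes are pairs (x, c) of a sample and a cost sequence. Sequences are indexed from 0:
   the first n samples are x 0, ..., x (n - 1), and likewise for the costs. *)
definition joint_law :: "real measure \<Rightarrow> real measure \<Rightarrow> ((nat \<Rightarrow> real) \<times> (nat \<Rightarrow> real)) measure" where
  "joint_law \<nu> \<C> = (\<Pi>\<^sub>M i\<in>(UNIV :: nat set). \<nu>) \<Otimes>\<^sub>M (\<Pi>\<^sub>M i\<in>(UNIV :: nat set). \<C>)"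

(* Sup {} = 0 on nat. The set is infinite only on a null event (positive i.i.d. costs have an
   almost surely divergent sum); there Sup is some fixed natural number. *)
definition tau :: "real \<Rightarrow> (nat \<Rightarrow> real) \<Rightarrow> nat" where
  "tau b c = Sup {n. 1 \<le> n \<and> (\<Sum>i<n. c i) \<le> b}"

(* \<pi> \<delta> n x is the pair (left endpoint, right endpoint) reported at level \<delta> after n samples. *)
type_synonym policy = "real \<Rightarrow> nat \<Rightarrow> (nat \<Rightarrow> real) \<Rightarrow> ereal \<times> ereal"

definition is_policy :: "policy \<Rightarrow> bool" where
  "is_policy \<pi> \<longleftrightarrow> (\<forall>\<delta>\<in>{0<..<1}. \<forall>n.
     (\<lambda>x. fst (\<pi> \<delta> n x)) \<in> borel_measurable (\<Pi>\<^sub>M i\<in>{..<n}. (borel :: real measure)) \<and>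
     (\<lambda>x. snd (\<pi> \<delta> n x)) \<in> borel_measurable (\<Pi>\<^sub>M i\<in>{..<n}. (borel :: real measure)) \<and>
     (\<forall>x\<in>space (\<Pi>\<^sub>M i\<in>{..<n}. (borel :: real measure)). fst (\<pi> \<delta> n x) \<le> snd (\<pi> \<delta> n x)))"

(* The restriction ensures that the policy sees nothing but the first tau samples. *)
definition reported ::
    "policy \<Rightarrow> (real \<Rightarrow> real) \<Rightarrow> real \<Rightarrow> (nat \<Rightarrow> real) \<times> (nat \<Rightarrow> real) \<Rightarrow> ereal \<times> ereal" where
  "reported \<pi> B \<delta> \<omega> =
     (let n = tau (B \<delta>) (snd \<omega>) in \<pi> \<delta> n (restrict (fst \<omega>) {..<n}))"

definition CI_policies ::
    "real measure set \<Rightarrow> real measure \<Rightarrow> (real \<Rightarrow> real) \<Rightarrow> policy set" where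
  "CI_policies H \<C> B = {\<pi>. is_policy \<pi> \<and>
     (\<forall>\<nu>\<in>H. \<forall>\<delta>\<in>{0<..<1}.
        measure (joint_law \<nu> \<C>)
          {\<omega>\<in>space (joint_law \<nu> \<C>).
             ereal (mean \<nu>) \<in> {fst (reported \<pi> B \<delta> \<omega>)..snd (reported \<pi> B \<delta> \<omega>)}} \<ge> 1 - \<delta>)}"

(* Convergence in probability, as \<delta> tends to 0 from the right, to a constant of the extended
   real line; stated with neighbourhoods so that the constants \<plusminus>\<infinity> are covered. *)
definition tendsto_in_prob :: "'a measure \<Rightarrow> (real \<Rightarrow> 'a \<Rightarrow> ereal) \<Rightarrow> ereal \<Rightarrow> bool" where
  "tendsto_in_prob P Y l \<longleftrightarrow>
     (\<forall>U. open U \<and> l \<in> U \<longrightarrow>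
        ((\<lambda>\<delta>. measure P {\<omega>\<in>space P. Y \<delta> \<omega> \<notin> U}) \<longlongrightarrow> 0) (at_right 0))"

definition limiting_endpoints ::
    "policy \<Rightarrow> real measure \<Rightarrow> real measure \<Rightarrow> (real \<Rightarrow> real) \<Rightarrow> ereal \<Rightarrow> ereal \<Rightarrow> bool" where
  "limiting_endpoints \<pi> \<nu> \<C> B l r \<longleftrightarrow>
     l \<le> ereal (mean \<nu>) \<and> ereal (mean \<nu>) \<le> r \<and>
     tendsto_in_prob (joint_law \<nu> \<C>) (\<lambda>\<delta> \<omega>. fst (reported \<pi> B \<delta> \<omega>)) l \<and>
     tendsto_in_prob (joint_law \<nu> \<C>) (\<lambda>\<delta> \<omega>. snd (reported \<pi> B \<delta> \<omega>)) r"

definition stable_CI_policies ::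
    "real measure set \<Rightarrow> real measure \<Rightarrow> real measure \<Rightarrow> (real \<Rightarrow> real) \<Rightarrow> policy set" where
  "stable_CI_policies H \<nu> \<C> B =
     {\<pi> \<in> CI_policies H \<C> B. \<exists>l r. limiting_endpoints \<pi> \<nu> \<C> B l r}"

definition empirical :: "nat \<Rightarrow> (nat \<Rightarrow> real) \<Rightarrow> real measure" where
  "empirical n x = distr (uniform_count_measure {..<n}) borel x"

definition beta :: "nat \<Rightarrow> real \<Rightarrow> real" where
  "beta n \<delta> = 1 + ln (2 * (1 + real n)^2 / \<delta>)"

definition pi1h :: "real \<Rightarrow> real \<Rightarrow> policy" where
  "pi1h \<epsilon> \<Gamma> \<delta> n x =
     (if n = 0 then (ereal (- (\<Gamma> powr (1 / (1 + \<epsilon>)))), ereal (\<Gamma> powr (1 / (1 + \<epsilon>))))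
      else
        let \<nu> = empirical n x;
            ok = (\<lambda>q. ereal (real n) * KL_inf \<nu> (heavy_tailed \<epsilon> \<Gamma>) q \<le> ereal (beta n \<delta>));
            SL = {q. q < mean \<nu> \<and> ok q};
            SR = {q. mean \<nu> < q \<and> ok q}
        in (if SL = {} then ereal (mean \<nu>) else Inf (ereal ` SL),
            if SR = {} then ereal (mean \<nu>) else Sup (ereal ` SR)))"

end

theory Submission
  imports Defs "HOL-Real_Asymp.Real_Asymp"
begin

text \<open>
Write $p = 1 + \epsilon$ and $M = \Gamma^{1/p}$, the largest mean that occurs in the class $H$. Reflecting
the line exchanges the two endpoints and preserves $H$, so everything is done for one side, with a
sign $\sigma$: the constraint on $\kappa \in H$ is $t \le \sigma m(\kappa)$.

The engine is a duality for the constrained divergence. For $a, b \ge 0$ put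
$h(x) = 1 + a (t - \sigma x) + b (|x|^p - \Gamma)$. Under every admissible $\kappa$ this has expectation at
most 1; if it is nonnegative everywhere it is the payoff of a bet against admissibility, and Gibbs'
inequality bounds $E_\eta \ln h$ by the divergence (lemma weak_duality). Conversely
(strong_duality), take the bet $h^*$ of largest expected logarithm, after mixing all bets with a
small sure payoff that keeps the logarithms bounded below. Its optimality says that
$E_\eta [h / h^*] \le 1$ for every other bet, and testing this against the bets that vanish at a single
point $y$ shows that $\eta / h^*$, completed by an atom at a suitable $y$, is an admissible measure whose
divergence is $E_\eta \ln h^*$.

Coverage. If the true mean is rejected after $n$ samples, duality yields a bet whose capital
$\prod_i h(X_i)$ exceeds $e^{\beta(n,\delta)}$. The average capital over the uniform distribution on the
two-dimensional convex set of bets is at least $1 / (e (1+n)^2)$ times the largest one, while its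
expectation is at most 1; Markov's inequality leaves probability $\delta / 2$ for each side
(deviation_bound). As the sample size is independent of the samples, a bound for each fixed $n$ is
enough.

Limits. As $t$ runs from $\sigma m(\nu)$ to $M$, the constrained divergence of $\nu$ is finite, convex, zero
only at the mean and unbounded near $M$; so it takes each value in $(0, \infty)$ exactly once. The
weak law of large numbers transfers its values to the empirical measures: from below because a
fixed bet that is good for $\nu$ remains good, from above because a near-optimal reweighting of $\nu$
with some slack remains admissible (KLs_empirical_lower, KLs_empirical_upper). Since
$\tau_\delta \approx C_\delta / \overline c$, the threshold $\beta(\tau_\delta,\delta) / \tau_\delta$ converges to $\overline c / k$,
and the endpoints converge to the point where the rate crosses that level: to the root if
$0 < k < \infty$, to the mean if $k = \infty$, and to $\pm M$ if $k = 0$.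
\<close>

section \<open>Tangents of the power function\<close>

text \<open>
Convexity of the power in tangent form; for $z > 0$ it is Young's inequality for $(z/y)^p$ and 1. The
point of tangency $y = 0$ is included: there value and slope are 0.
\<close>
lemma powr_tangent:
  fixes p y z :: real
  assumes p: "1 < p" and y: "0 \<le> y"
  shows "y powr p + p * y powr (p - 1) * (z - y) \<le> \<bar>z\<bar> powr p"
proof (cases "y = 0")
  case True
  then show ?thesis using p by simp
next
  case False
  with y have y: "0 < y" by simp
  have yp: "y powr p = y * y powr (p - 1)" using y by (simp add: powr_diff)
  show ?thesis
  proof (cases "z \<le> 0")
    case True
    have "y powr p + p * y powr (p - 1) * (z - y) = y powr (p - 1) * (y * (1 - p) + p * z)"
      by (simp add: yp algebra_simps)
    also have "\<dots> \<le> 0"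
      using True p y by (intro mult_nonneg_nonpos add_nonpos_nonpos) (auto intro: mult_nonneg_nonpos)
    finally show ?thesis by (smt (verit) powr_ge_zero)
  next
    case False
    then have z: "0 < z" by simp
    define u where "u = z / y"
    have u: "0 < u" and zu: "z = u * y" using y z by (auto simp: u_def)
    have "(u powr p) powr (1/p) * 1 powr (1 - 1/p) \<le> (1/p) * (u powr p) + (1 - 1/p) * 1"
      using p u by (intro Youngs_inequality_0) auto
    then have "u \<le> (1/p) * (u powr p) + (1 - 1/p)" using p u by (simp add: powr_powr)
    then have "p * u \<le> p * ((1/p) * (u powr p) + (1 - 1/p))" using p by simp
    also have "\<dots> = u powr p + (p - 1)" using p by (simp add: field_simps)
    finally have "1 + p * (u - 1) \<le> u powr p" by (simp add: algebra_simps)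
    then have "y powr p * (1 + p * (u - 1)) \<le> y powr p * u powr p"
      by (rule mult_left_mono) simp
    also have "\<dots> = \<bar>z\<bar> powr p" using u y zu by (simp add: powr_mult mult.commute)
    finally show ?thesis by (simp add: yp zu algebra_simps)
  qed
qed

text \<open>
Strictness comes from a second tangent, at the midpoint of $y$ and $z$: its slope differs from the
one at $y$.
\<close>
lemma powr_tangent_strict:
  fixes p y z :: real
  assumes p: "1 < p" and y: "0 < y" and zy: "z \<noteq> y"
  shows "y powr p + p * y powr (p - 1) * (z - y) < \<bar>z\<bar> powr p"
proof (cases "z \<le> 0")
  case True
  have yp: "y powr p = y * y powr (p - 1)" using y by (simp add: powr_diff)
  have "y powr p + p * y powr (p - 1) * (z - y) = y powr (p - 1) * (y * (1 - p) + p * z)"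
    by (simp add: yp algebra_simps)
  also have "\<dots> < 0"
  proof (rule mult_pos_neg)
    have "y * (1 - p) < 0" "p * z \<le> 0" using True p y by (auto simp: mult_pos_neg mult_nonneg_nonpos)
    then show "y * (1 - p) + p * z < 0" by linarith
  qed (use y in auto)
  finally show ?thesis by (smt (verit) powr_ge_zero)
next
  case False
  define m where "m = (z + y) / 2"
  have m: "0 < m" "m \<noteq> y" and zm: "z - m = m - y" and zy2: "z - y = 2 * (m - y)"
    using False y zy by (auto simp: m_def field_simps)
  have 1: "m powr p + p * m powr (p - 1) * (z - m) \<le> \<bar>z\<bar> powr p"
    using p m by (intro powr_tangent) auto
  have 2: "y powr p + p * y powr (p - 1) * (m - y) \<le> \<bar>m\<bar> powr p"
    using p y by (intro powr_tangent) auto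
  have "0 < (m powr (p - 1) - y powr (p - 1)) * (m - y)"
  proof (cases "m < y")
    case True
    then have "m powr (p - 1) < y powr (p - 1)" using m p by (intro powr_less_mono2) auto
    then show ?thesis using True by (simp add: mult_neg_neg)
  next
    case False
    then have "y powr (p - 1) < m powr (p - 1)" using m p y by (intro powr_less_mono2) auto
    then show ?thesis using False m by simp
  qed
  then have "0 < p * ((m powr (p - 1) - y powr (p - 1)) * (m - y))" using p by simp
  moreover have "\<bar>m\<bar> powr p = m powr p" using m by simp
  ultimately show ?thesis using 1 2 unfolding zm zy2 by (simp add: algebra_simps)
qed

section \<open>Divergence bounds from densities\<close>

text \<open>
The density of $\eta$ with respect to $\kappa$ is finite and positive $\eta$-almost everywhere, so that
logarithms and quotients of it can be taken among the reals.
\<close>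
lemma obtain_real_density:
  assumes "real_distribution \<kappa>" "real_distribution \<eta>" "absolutely_continuous \<kappa> \<eta>"
  obtains g :: "real \<Rightarrow> real" where "g \<in> borel_measurable borel" "\<And>x. 0 \<le> g x"
    "AE x in \<eta>. 0 < g x"
    "\<And>f. f \<in> borel_measurable borel \<Longrightarrow> (\<integral>\<^sup>+x. f x \<partial>\<eta>) = (\<integral>\<^sup>+x. ennreal (g x) * f x \<partial>\<kappa>)"
    "entropy_density (exp 1) \<kappa> \<eta> = (\<lambda>x. ln (g x))"
proof -
  interpret K: real_distribution \<kappa> by fact
  interpret E: real_distribution \<eta> by fact
  define g where "g x = enn2real (RN_deriv \<kappa> \<eta> x)" for x
  have [measurable]: "RN_deriv \<kappa> \<eta> \<in> borel_measurable borel"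
    using borel_measurable_RN_deriv[of \<kappa> \<eta>] by simp
  have g[measurable]: "g \<in> borel_measurable borel" unfolding g_def by measurable
  have "AE x in \<kappa>. RN_deriv \<kappa> \<eta> x \<noteq> \<infinity>"
    using assms by (intro K.RN_deriv_finite) (auto simp: E.sigma_finite_measure_axioms)
  have nn: "0 \<le> g x" for x by (simp add: g_def)
  have eq: "AE x in \<kappa>. RN_deriv \<kappa> \<eta> x = ennreal (g x)"
    using \<open>AE x in \<kappa>. RN_deriv \<kappa> \<eta> x \<noteq> \<infinity>\<close> by (auto simp: g_def less_top)
  have int: "(\<integral>\<^sup>+x. f x \<partial>\<eta>) = (\<integral>\<^sup>+x. ennreal (g x) * f x \<partial>\<kappa>)"
    if [measurable]: "f \<in> borel_measurable borel" for f
  proof -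
    have "(\<integral>\<^sup>+x. f x \<partial>\<eta>) = (\<integral>\<^sup>+x. RN_deriv \<kappa> \<eta> x * f x \<partial>\<kappa>)"
      using assms by (intro K.RN_deriv_nn_integral) auto
    also have "\<dots> = (\<integral>\<^sup>+x. ennreal (g x) * f x \<partial>\<kappa>)"
      using eq by (intro nn_integral_cong_AE) auto
    finally show ?thesis .
  qed
  have "(\<integral>\<^sup>+x. indicator {x. g x = 0} x \<partial>\<eta>) = (\<integral>\<^sup>+x. ennreal (g x) * indicator {x. g x = 0} x \<partial>\<kappa>)"
    by (intro int) auto
  also have "\<dots> = (\<integral>\<^sup>+x. 0 \<partial>\<kappa>)" by (intro nn_integral_cong) (auto simp: indicator_def)
  finally have "emeasure \<eta> {x. g x = 0} = 0" by simp
  then have "AE x in \<eta>. \<not> g x = 0"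
    by (intro AE_I[where N="{x. g x = 0}"]) auto
  then have pos: "AE x in \<eta>. 0 < g x"
    by eventually_elim (use nn in \<open>auto simp: less_le\<close>)
  show ?thesis
  proof (rule that[of g])
    show "entropy_density (exp 1) \<kappa> \<eta> = (\<lambda>x. ln (g x))"
      by (auto simp: entropy_density_def g_def log_def)
  qed (use g nn pos int in auto)
qed

text \<open>
$1/g$ is the density with respect to $\eta$ of the part of $\kappa$ that is absolutely continuous; the singular
part is lost, which accounts for the inequality.
\<close>
lemma integral_over_density:
  assumes "real_distribution \<kappa>" "real_distribution \<eta>" 
    and g[measurable]: "g \<in> borel_measurable borel" and nn: "\<And>x. 0 \<le> g x"
    and int: "\<And>f. f \<in> borel_measurable borel \<Longrightarrow> (\<integral>\<^sup>+x. f x \<partial>\<eta>) = (\<integral>\<^sup>+x. ennreal (g x) * f x \<partial>\<kappa>)"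
    and h[measurable]: "h \<in> borel_measurable borel" and hnn: "\<And>x. 0 \<le> h x"
    and h1: "(\<integral>\<^sup>+x. ennreal (h x) \<partial>\<kappa>) \<le> 1"
  shows "integrable \<eta> (\<lambda>x. h x / g x)" "(\<integral>x. h x / g x \<partial>\<eta>) \<le> 1"
proof -
  interpret K: real_distribution \<kappa> by fact
  interpret E: real_distribution \<eta> by fact
  have "(\<integral>\<^sup>+x. ennreal (h x / g x) \<partial>\<eta>) = (\<integral>\<^sup>+x. ennreal (g x) * ennreal (h x / g x) \<partial>\<kappa>)"
    by (intro int) auto
  also have "\<dots> \<le> (\<integral>\<^sup>+x. ennreal (h x) \<partial>\<kappa>)"
    by (intro nn_integral_mono) (auto simp: ennreal_mult[symmetric] nn hnn)
  finally have le: "(\<integral>\<^sup>+x. ennreal (h x / g x) \<partial>\<eta>) \<le> 1" using h1 by (rule order_trans)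
  show i: "integrable \<eta> (\<lambda>x. h x / g x)"
    by (rule integrableI_nonneg) (use le nn hnn in \<open>auto intro: order_le_less_trans\<close>)
  have "ennreal (\<integral>x. h x / g x \<partial>\<eta>) \<le> 1"
    using nn_integral_eq_integral[OF i] le nn hnn by auto
  then show "(\<integral>x. h x / g x \<partial>\<eta>) \<le> 1" by simp
qed

text \<open>
If $\kappa$ dominates $\phi \eta$, then $E_\eta [g \phi] \le 1$ for the density $g = d\eta / d\kappa$, and the claim follows by
integrating $\ln (g \phi) \le g \phi - 1$; integrability of $\ln g$ comes with
the lower bound $1 - 1/g \le \ln g$.
\<close>
lemma KL_le_of_subdensity:
  assumes K: "real_distribution \<kappa>" and E: "real_distribution \<eta>"
    and \<phi>[measurable]: "\<phi> \<in> borel_measurable borel" and pos: "\<And>x. 0 < \<phi> x"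
    and ln: "integrable \<eta> (\<lambda>x. ln (\<phi> x))"
    and sub: "\<And>f. f \<in> borel_measurable borel \<Longrightarrow> (\<integral>\<^sup>+x. ennreal (\<phi> x) * f x \<partial>\<eta>) \<le> (\<integral>\<^sup>+x. f x \<partial>\<kappa>)"
  shows "KL \<eta> \<kappa> \<le> ereal (- (\<integral>x. ln (\<phi> x) \<partial>\<eta>))"
proof -
  interpret K: real_distribution \<kappa> by fact
  interpret E: real_distribution \<eta> by fact
  have ac: "absolutely_continuous \<kappa> \<eta>"
    unfolding absolutely_continuous_def
  proof
    fix A assume A: "A \<in> null_sets \<kappa>"
    then have [measurable]: "A \<in> sets borel" by (auto simp: null_sets_def)
    have "(\<integral>\<^sup>+x. ennreal (\<phi> x) * indicator A x \<partial>\<eta>) \<le> (\<integral>\<^sup>+x. indicator A x \<partial>\<kappa>)"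
      by (intro sub) auto
    also have "\<dots> = 0" using A by (auto simp: null_sets_def)
    finally have "(\<integral>\<^sup>+x. ennreal (\<phi> x) * indicator A x \<partial>\<eta>) = 0" by simp
    then have "AE x in \<eta>. ennreal (\<phi> x) * indicator A x = 0"
      by (subst (asm) nn_integral_0_iff_AE) auto
    then have "AE x in \<eta>. x \<notin> A"
      by eventually_elim (use pos in \<open>auto simp: indicator_def ennreal_eq_0_iff not_less[symmetric] split: if_splits\<close>)
    then show "A \<in> null_sets \<eta>"
      by (subst (asm) AE_iff_null_sets[symmetric]) auto
  qed
  obtain g where g[measurable]: "g \<in> borel_measurable borel" and nn: "\<And>x. 0 \<le> g x"
    and gpos: "AE x in \<eta>. 0 < g x"
    and int: "\<And>f. f \<in> borel_measurable borel \<Longrightarrow> (\<integral>\<^sup>+x. f x \<partial>\<eta>) = (\<integral>\<^sup>+x. ennreal (g x) * f x \<partial>\<kappa>)"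
    and ed: "entropy_density (exp 1) \<kappa> \<eta> = (\<lambda>x. ln (g x))"
    using ac by (auto intro: obtain_real_density[OF K E])
  have inv: "integrable \<eta> (\<lambda>x. 1 / g x)"
    by (rule integral_over_density(1)[OF K E g nn int]) (auto simp: K.emeasure_space_1[simplified])
  have "(\<integral>\<^sup>+x. ennreal (\<phi> x * g x) \<partial>\<eta>) = (\<integral>\<^sup>+x. ennreal (\<phi> x) * ennreal (g x) \<partial>\<eta>)"
    by (intro nn_integral_cong) (simp add: ennreal_mult[symmetric] nn pos less_imp_le)
  also have "\<dots> \<le> (\<integral>\<^sup>+x. ennreal (g x) \<partial>\<kappa>)" by (intro sub) auto
  also have "\<dots> = (\<integral>\<^sup>+x. 1 \<partial>\<eta>)" by (subst int) auto
  also have "\<dots> = 1" using E.emeasure_space_1 by simp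
  finally have le1: "(\<integral>\<^sup>+x. ennreal (\<phi> x * g x) \<partial>\<eta>) \<le> 1" .
  have fg0: "0 \<le> \<phi> x * g x" for x using nn pos by (simp add: less_imp_le)
  have ifg: "integrable \<eta> (\<lambda>x. \<phi> x * g x)"
    by (rule integrableI_nonneg) (use le1 fg0 in \<open>auto intro: order_le_less_trans\<close>)
  have "ennreal (\<integral>x. \<phi> x * g x \<partial>\<eta>) \<le> 1"
    using nn_integral_eq_integral[OF ifg] le1 fg0 by auto
  then have fg1: "(\<integral>x. \<phi> x * g x \<partial>\<eta>) \<le> 1" by simp
  have up: "AE x in \<eta>. ln (g x) \<le> \<phi> x * g x - 1 - ln (\<phi> x)"
    using gpos
  proof eventually_elim
    case (elim x)
    have "ln (\<phi> x * g x) \<le> \<phi> x * g x - 1" using elim pos by (intro ln_le_minus_one) auto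
    then show ?case using elim pos[of x] by (simp add: ln_mult)
  qed
  have lo: "AE x in \<eta>. 1 - 1 / g x \<le> ln (g x)"
    using gpos
  proof eventually_elim
    case (elim x)
    have "ln (1 / g x) \<le> 1 / g x - 1" using elim by (intro ln_le_minus_one) auto
    then show ?case using elim by (simp add: ln_div)
  qed
  have ig: "integrable \<eta> (\<lambda>x. ln (g x))"
  proof (rule Bochner_Integration.integrable_bound)
    show "integrable \<eta> (\<lambda>x. \<bar>\<phi> x * g x - 1 - ln (\<phi> x)\<bar> + \<bar>1 - 1 / g x\<bar>)"
      using ifg inv ln by auto
    show "AE x in \<eta>. norm (ln (g x)) \<le> norm (\<bar>\<phi> x * g x - 1 - ln (\<phi> x)\<bar> + \<bar>1 - 1 / g x\<bar>)"
      using up lo by eventually_elim auto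
  qed auto
  have "(\<integral>x. ln (g x) \<partial>\<eta>) \<le> (\<integral>x. \<phi> x * g x - 1 - ln (\<phi> x) \<partial>\<eta>)"
    using up ig ifg ln by (intro integral_mono_AE) auto
  also have "\<dots> = (\<integral>x. \<phi> x * g x \<partial>\<eta>) - 1 - (\<integral>x. ln (\<phi> x) \<partial>\<eta>)"
    using ifg ln E.prob_space by simp
  finally have "(\<integral>x. ln (g x) \<partial>\<eta>) \<le> - (\<integral>x. ln (\<phi> x) \<partial>\<eta>)" using fg1 by simp
  then show ?thesis using ac ig by (simp add: KL_def KL_divergence_def ed)
qed

text \<open>
Gibbs' variational inequality for the test function $\ln h$: integrate
$\ln (h/g) \le h/g - 1$, whose right-hand side has nonpositive expectation.
\<close>
lemma integral_ln_le_KL: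
  assumes K: "real_distribution \<kappa>" and E: "real_distribution \<eta>"
    and h[measurable]: "h \<in> borel_measurable borel" and hnn: "\<And>x. 0 \<le> h x"
    and h1: "(\<integral>\<^sup>+x. ennreal (h x) \<partial>\<kappa>) \<le> 1"
    and hpos: "AE x in \<eta>. 0 < h x" and ln: "integrable \<eta> (\<lambda>x. ln (h x))"
  shows "ereal (\<integral>x. ln (h x) \<partial>\<eta>) \<le> KL \<eta> \<kappa>"
proof (cases "absolutely_continuous \<kappa> \<eta> \<and> integrable \<eta> (entropy_density (exp 1) \<kappa> \<eta>)")
  case False
  then show ?thesis unfolding KL_def by (subst if_not_P) auto
next
  case True
  interpret K: real_distribution \<kappa> by fact
  interpret E: real_distribution \<eta> by fact
  obtain g where g[measurable]: "g \<in> borel_measurable borel" and nn: "\<And>x. 0 \<le> g x"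
    and gpos: "AE x in \<eta>. 0 < g x"
    and int: "\<And>f. f \<in> borel_measurable borel \<Longrightarrow> (\<integral>\<^sup>+x. f x \<partial>\<eta>) = (\<integral>\<^sup>+x. ennreal (g x) * f x \<partial>\<kappa>)"
    and ed: "entropy_density (exp 1) \<kappa> \<eta> = (\<lambda>x. ln (g x))"
    using True by (auto intro: obtain_real_density[OF K E])
  have ig: "integrable \<eta> (\<lambda>x. ln (g x))" using True ed by simp
  note q = integral_over_density[OF K E g nn int h hnn h1]
  have "AE x in \<eta>. ln (h x) - ln (g x) \<le> h x / g x - 1"
    using gpos hpos
  proof eventually_elim
    case (elim x)
    have "ln (h x / g x) \<le> h x / g x - 1" using elim by (intro ln_le_minus_one) auto
    then show ?case using elim by (simp add: ln_div)
  qed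
  then have "(\<integral>x. ln (h x) - ln (g x) \<partial>\<eta>) \<le> (\<integral>x. h x / g x - 1 \<partial>\<eta>)"
    using ln ig q by (intro integral_mono_AE) auto
  then have "(\<integral>x. ln (h x) \<partial>\<eta>) \<le> (\<integral>x. ln (g x) \<partial>\<eta>)"
    using ln ig q E.prob_space by simp
  then show ?thesis using True by (simp add: KL_def KL_divergence_def ed)
qed

text \<open>
The measure $\phi \eta + w \delta_y$. It is built on two copies of the line, one of which is collapsed to
$y$, so that countable additivity is inherited.
\<close>
definition reweight_atom :: "real measure \<Rightarrow> (real \<Rightarrow> real) \<Rightarrow> real \<Rightarrow> real \<Rightarrow> real measure" where
  "reweight_atom \<eta> \<phi> w y =
     distr (density (\<eta> \<Otimes>\<^sub>M count_space UNIV) (\<lambda>(x, b). ennreal (if b then \<phi> x else w)))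
       borel (\<lambda>(x, b). if b then x else y)"

lemma nn_integral_reweight_atom:
  assumes "real_distribution \<eta>" and [measurable]: "\<phi> \<in> borel_measurable borel" "f \<in> borel_measurable borel"
  shows "(\<integral>\<^sup>+x. f x \<partial>reweight_atom \<eta> \<phi> w y) = (\<integral>\<^sup>+x. ennreal (\<phi> x) * f x \<partial>\<eta>) + ennreal w * f y"
proof -
  interpret E: real_distribution \<eta> by fact
  interpret C: sigma_finite_measure "count_space (UNIV :: bool set)"
    by (rule sigma_finite_measure_count_space)
  interpret P: pair_sigma_finite \<eta> "count_space (UNIV :: bool set)" by standard
  have [measurable]: "(\<lambda>(x, b). ennreal (if b then \<phi> x else w)) \<in> borel_measurable (\<eta> \<Otimes>\<^sub>M count_space UNIV)"
    "(\<lambda>(x, b). if b then x else y) \<in> borel_measurable (\<eta> \<Otimes>\<^sub>M count_space UNIV)"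
    by measurable
  have "(\<integral>\<^sup>+x. f x \<partial>reweight_atom \<eta> \<phi> w y) =
     (\<integral>\<^sup>+z. (case z of (x, b) \<Rightarrow> ennreal (if b then \<phi> x else w)) * f (case z of (x, b) \<Rightarrow> if b then x else y)
        \<partial>(\<eta> \<Otimes>\<^sub>M count_space UNIV))"
    unfolding reweight_atom_def by (subst nn_integral_distr) (auto simp: nn_integral_density)
  also have "\<dots> = (\<integral>\<^sup>+x. (\<integral>\<^sup>+b. ennreal (if b then \<phi> x else w) * f (if b then x else y) \<partial>count_space UNIV) \<partial>\<eta>)"
    by (subst C.nn_integral_fst[symmetric]) auto
  also have "\<dots> = (\<integral>\<^sup>+x. ennreal (\<phi> x) * f x + ennreal w * f y \<partial>\<eta>)"
    by (intro nn_integral_cong) (simp add: nn_integral_count_space_finite UNIV_bool add.commute)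
  also have "\<dots> = (\<integral>\<^sup>+x. ennreal (\<phi> x) * f x \<partial>\<eta>) + ennreal w * f y"
    using E.emeasure_space_1 by (subst nn_integral_add) auto
  finally show ?thesis .
qed

lemma reweight_atom_integral:
  assumes E: "real_distribution \<eta>" and [measurable]: "\<phi> \<in> borel_measurable borel" "f \<in> borel_measurable borel"
    and \<phi>: "\<And>x. 0 \<le> \<phi> x" and w: "0 \<le> w" and i: "integrable \<eta> (\<lambda>x. \<phi> x * f x)"
  shows "has_bochner_integral (reweight_atom \<eta> \<phi> w y) f ((\<integral>x. \<phi> x * f x \<partial>\<eta>) + w * f y)"
proof -
  interpret E: real_distribution \<eta> by fact
  let ?K = "reweight_atom \<eta> \<phi> w y"
  have s[simp, measurable_cong]: "sets ?K = sets borel" by (simp add: reweight_atom_def)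
  have pos: "(\<integral>\<^sup>+x. ennreal (f' x) \<partial>?K) = ennreal ((\<integral>x. \<phi> x * f' x \<partial>\<eta>) + w * f' y)"
    if [measurable]: "f' \<in> borel_measurable borel" and "\<And>x. 0 \<le> f' x" and i: "integrable \<eta> (\<lambda>x. \<phi> x * f' x)" for f'
  proof -
    have "(\<integral>\<^sup>+x. ennreal (\<phi> x) * ennreal (f' x) \<partial>\<eta>) = (\<integral>\<^sup>+x. ennreal (\<phi> x * f' x) \<partial>\<eta>)"
      using that \<phi> by (simp add: ennreal_mult)
    also have "\<dots> = ennreal (\<integral>x. \<phi> x * f' x \<partial>\<eta>)"
      using i that \<phi> by (intro nn_integral_eq_integral) auto
    finally show ?thesis using that \<phi> w E
      by (subst nn_integral_reweight_atom) (auto simp: ennreal_mult ennreal_plus integral_nonneg)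
  qed
  define fp fn where "fp x = max 0 (f x)" and "fn x = max 0 (- f x)" for x
  have [measurable]: "fp \<in> borel_measurable borel" "fn \<in> borel_measurable borel"
    unfolding fp_def[abs_def] fn_def[abs_def] by measurable
  have ip: "integrable \<eta> (\<lambda>x. \<phi> x * fp x)" "integrable \<eta> (\<lambda>x. \<phi> x * fn x)"
    using i \<phi> by (auto intro!: Bochner_Integration.integrable_bound[OF i] AE_I2 mult_left_mono simp: fp_def fn_def abs_mult)
  have nn: "0 \<le> fp x" "0 \<le> fn x" for x by (auto simp: fp_def fn_def)
  have "has_bochner_integral ?K fp ((\<integral>x. \<phi> x * fp x \<partial>\<eta>) + w * fp y)"
    using nn \<phi> w by (intro has_bochner_integral_nn_integral pos ip) (auto intro!: add_nonneg_nonneg integral_nonneg)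
  moreover have "has_bochner_integral ?K fn ((\<integral>x. \<phi> x * fn x \<partial>\<eta>) + w * fn y)"
    using nn \<phi> w by (intro has_bochner_integral_nn_integral pos ip) (auto intro!: add_nonneg_nonneg integral_nonneg)
  ultimately have hb: "has_bochner_integral ?K (\<lambda>x. fp x - fn x)
      (((\<integral>x. \<phi> x * fp x \<partial>\<eta>) + w * fp y) - ((\<integral>x. \<phi> x * fn x \<partial>\<eta>) + w * fn y))"
    by (rule has_bochner_integral_diff)
  have fpn: "f = (\<lambda>x. fp x - fn x)" by (auto simp: fp_def fn_def)
  have eq: "((\<integral>x. \<phi> x * fp x \<partial>\<eta>) + w * fp y) - ((\<integral>x. \<phi> x * fn x \<partial>\<eta>) + w * fn y)
      = (\<integral>x. \<phi> x * f x \<partial>\<eta>) + w * f y" (is "?l = ?r")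
  proof -
    have "(\<integral>x. \<phi> x * f x \<partial>\<eta>) = (\<integral>x. \<phi> x * fp x \<partial>\<eta>) - (\<integral>x. \<phi> x * fn x \<partial>\<eta>)"
      using ip by (simp add: fpn right_diff_distrib)
    moreover have "f y = fp y - fn y" by (simp add: fpn)
    ultimately show ?thesis by (simp only: right_diff_distrib)
  qed
  show ?thesis using hb unfolding eq fpn[symmetric] .
qed

section \<open>Optimality conditions for expected logarithms\<close>

lemma mult_le_of_abs_le:
  fixes a b :: real
  assumes "\<bar>a\<bar> \<le> A" "\<bar>b\<bar> \<le> B"
  shows "a * b \<le> A * B"
proof -
  have "a * b \<le> \<bar>a\<bar> * \<bar>b\<bar>" by (metis abs_ge_self abs_mult)
  also have "\<dots> \<le> A * B" using assms by (intro mult_mono) auto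
  finally show ?thesis .
qed

lemma ln_bound: "0 < s \<Longrightarrow> s \<le> z \<Longrightarrow> \<bar>ln z\<bar> \<le> \<bar>ln s\<bar> + \<bar>z\<bar>" for s z :: real
proof -
  assume a: "0 < s" "s \<le> z"
  have "ln s \<le> ln z" using a by simp
  moreover have "ln z \<le> z" using a ln_le_minus_one[of z] by linarith
  ultimately show "\<bar>ln z\<bar> \<le> \<bar>ln s\<bar> + \<bar>z\<bar>" using a by linarith
qed

lemma integrable_ln_bdd_below:
  assumes "integrable \<eta> h" "0 < s" "\<And>x. s \<le> h x" "prob_space \<eta>"
  shows "integrable \<eta> (\<lambda>x. ln (h x :: real))"
proof (rule Bochner_Integration.integrable_bound)
  interpret prob_space \<eta> by fact
  show "integrable \<eta> (\<lambda>x. \<bar>ln s\<bar> + \<bar>h x\<bar>)" using assms by auto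
  show "AE x in \<eta>. norm (ln (h x)) \<le> norm (\<bar>ln s\<bar> + \<bar>h x\<bar>)"
    using ln_bound[OF assms(2,3)] by auto
  show "(\<lambda>x. ln (h x)) \<in> borel_measurable \<eta>" using assms(1) by measurable
qed

text \<open>
The derivative of $E \ln ((1-\theta) h_0 + \theta h)$ at $\theta = 0$ is $E [h/h_0] - 1$, and it cannot be positive if
$h_0$ is optimal. Writing $u = h/h_0 - 1 \ge -1$, the difference quotients $\ln (1 + \theta u) / \theta$ are dominated by
$2 |u|$ for $\theta \le 1/2$, which justifies differentiating under the integral.
\<close>
lemma first_order_optimality:
  fixes h h0 :: "'a \<Rightarrow> real"
  assumes "prob_space \<eta>" and s: "0 < s"
    and h0: "integrable \<eta> h0" "\<And>x. s \<le> h0 x" and h: "integrable \<eta> h" "\<And>x. 0 \<le> h x"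
    and opt: "\<And>\<theta>. 0 < \<theta> \<Longrightarrow> \<theta> < 1 \<Longrightarrow> (\<integral>x. ln ((1 - \<theta>) * h0 x + \<theta> * h x) \<partial>\<eta>) \<le> (\<integral>x. ln (h0 x) \<partial>\<eta>)"
  shows "integrable \<eta> (\<lambda>x. h x / h0 x)" "(\<integral>x. h x / h0 x \<partial>\<eta>) \<le> 1"
proof -
  interpret prob_space \<eta> by fact
  have [measurable]: "h0 \<in> borel_measurable \<eta>" "h \<in> borel_measurable \<eta>" using h0 h by auto
  have h0p: "0 < h0 x" for x using s h0(2)[of x] by linarith
  show i: "integrable \<eta> (\<lambda>x. h x / h0 x)"
  proof (rule Bochner_Integration.integrable_bound)
    show "integrable \<eta> (\<lambda>x. h x / s)" using h by auto
    show "AE x in \<eta>. norm (h x / h0 x) \<le> norm (h x / s)"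
    proof (intro AE_I2)
      fix x
      have "h x / h0 x \<le> h x / s" using h(2)[of x] h0(2)[of x] s by (intro divide_left_mono) auto
      then show "norm (h x / h0 x) \<le> norm (h x / s)" using h(2)[of x] h0p[of x] s by simp
    qed
  qed auto
  define u where "u x = h x / h0 x - 1" for x
  have [measurable]: "u \<in> borel_measurable \<eta>" unfolding u_def[abs_def] by measurable
  have iu: "integrable \<eta> u" unfolding u_def using i by auto
  have u1: "-1 \<le> u x" for x using h(2)[of x] h0p[of x] by (simp add: u_def)
  have il: "integrable \<eta> (\<lambda>x. ln (h0 x))"
    by (rule integrable_ln_bdd_below[OF h0(1) s h0(2) assms(1)])
  have bnd: "\<bar>ln (1 + \<theta> * u x) / \<theta>\<bar> \<le> 2 * \<bar>u x\<bar>" if t: "0 < \<theta>" "\<theta> \<le> 1/2" for \<theta> x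
  proof -
    have tu: "-1/2 \<le> \<theta> * u x"
    proof -
      have "\<theta> * (-1) \<le> \<theta> * u x" using u1 t by (intro mult_left_mono) auto
      then show ?thesis using t by linarith
    qed
    have up: "ln (1 + \<theta> * u x) \<le> \<theta> * u x"
      using tu by (intro ln_add_one_self_le_self2) auto
    have "ln (1 / (1 + \<theta> * u x)) \<le> 1 / (1 + \<theta> * u x) - 1"
      using tu by (intro ln_le_minus_one) auto
    then have lo: "(\<theta> * u x) / (1 + \<theta> * u x) \<le> ln (1 + \<theta> * u x)"
      using tu by (simp add: ln_div field_simps)
    have "- 2 * \<bar>\<theta> * u x\<bar> \<le> (\<theta> * u x) / (1 + \<theta> * u x)"
    proof (cases "0 \<le> \<theta> * u x")
      case True then show ?thesis by (smt (verit) divide_nonneg_nonneg)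
    next
      case False
      then have "(\<theta> * u x) * 2 \<le> (\<theta> * u x) * (1 / (1 + \<theta> * u x))"
        using tu by (intro mult_left_mono_neg) (auto simp: field_simps)
      then show ?thesis using False by simp
    qed
    with lo up have "\<bar>ln (1 + \<theta> * u x)\<bar> \<le> 2 * \<bar>\<theta> * u x\<bar>" by linarith
    then show ?thesis using t by (simp add: abs_mult field_simps)
  qed
  have le0: "(\<integral>x. ln (1 + \<theta> * u x) / \<theta> \<partial>\<eta>) \<le> 0" if t: "0 < \<theta>" "\<theta> \<le> 1/2" for \<theta>
  proof -
    have ib: "integrable \<eta> (\<lambda>x. ln (1 + \<theta> * u x) / \<theta>)"
      by (rule Bochner_Integration.integrable_bound[where f="\<lambda>x. 2 * \<bar>u x\<bar>"]) (use iu bnd[OF t] in auto)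
    have "ln ((1 - \<theta>) * h0 x + \<theta> * h x) = ln (h0 x) + \<theta> * (ln (1 + \<theta> * u x) / \<theta>)" for x
    proof -
      have "\<theta> * (-1) \<le> \<theta> * u x" using u1 t by (intro mult_left_mono) auto
      then have "0 < 1 + \<theta> * u x" using t by linarith
      moreover have "(1 - \<theta>) * h0 x + \<theta> * h x = h0 x * (1 + \<theta> * u x)"
        using h0p[of x] by (simp add: u_def field_simps)
      ultimately show ?thesis using h0p[of x] t by (simp add: ln_mult)
    qed
    then have "(\<integral>x. ln ((1 - \<theta>) * h0 x + \<theta> * h x) \<partial>\<eta>) = (\<integral>x. ln (h0 x) \<partial>\<eta>) + \<theta> * (\<integral>x. ln (1 + \<theta> * u x) / \<theta> \<partial>\<eta>)"
      using il ib by (simp del: times_divide_eq_right)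
    with opt[of \<theta>] t have "\<theta> * (\<integral>x. ln (1 + \<theta> * u x) / \<theta> \<partial>\<eta>) \<le> 0" by simp
    then have "(\<integral>x. ln (1 + \<theta> * u x) / \<theta> \<partial>\<eta>) \<le> 0 / \<theta>"
      using t by (subst pos_le_divide_eq) (auto simp: mult.commute)
    then show ?thesis by simp
  qed
  define \<theta> where "\<theta> n = 1 / (real n + 2)" for n
  have \<theta>: "0 < \<theta> n" "\<theta> n \<le> 1/2" for n by (auto simp: \<theta>_def field_simps)
  have \<theta>0: "\<theta> \<longlonglongrightarrow> 0" unfolding \<theta>_def by real_asymp
  have "(\<lambda>n. \<integral>x. ln (1 + \<theta> n * u x) / \<theta> n \<partial>\<eta>) \<longlonglongrightarrow> (\<integral>x. u x \<partial>\<eta>)"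
  proof (rule integral_dominated_convergence[where w="\<lambda>x. 2 * \<bar>u x\<bar>"])
    show "AE x in \<eta>. (\<lambda>n. ln (1 + \<theta> n * u x) / \<theta> n) \<longlonglongrightarrow> u x"
    proof (intro AE_I2)
      fix x
      have "((\<lambda>t. ln (1 + t * u x) / t) \<longlongrightarrow> u x) (at_right 0)" by real_asymp
      moreover have "filterlim \<theta> (at_right 0) sequentially"
        using \<theta>0 \<theta> by (intro tendsto_imp_filterlim_at_right) auto
      ultimately show "(\<lambda>n. ln (1 + \<theta> n * u x) / \<theta> n) \<longlonglongrightarrow> u x"
        by (rule filterlim_compose)
    qed
    show "AE x in \<eta>. norm (ln (1 + \<theta> n * u x) / \<theta> n) \<le> 2 * \<bar>u x\<bar>" for n
      using bnd[OF \<theta>] by (intro AE_I2) simp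
  qed (use iu in auto)
  then have "(\<integral>x. u x \<partial>\<eta>) \<le> 0" using le0[OF \<theta>] by (intro LIMSEQ_le_const2) auto
  then show "(\<integral>x. h x / h0 x \<partial>\<eta>) \<le> 1" using i prob_space by (simp add: u_def)
qed

section \<open>Bets against a one-sided mean constraint\<close>

text \<open>
$\sigma = 1$ describes the right endpoint and $\sigma = -1$ the left one; thresholds $t$ always refer to
$\sigma$ times the mean.
\<close>
locale moment_class =
  fixes \<epsilon> \<Gamma> \<sigma> :: real
  assumes eps: "0 < \<epsilon>" and Gam: "0 < \<Gamma>" and sig: "\<sigma> = 1 \<or> \<sigma> = -1"
begin

abbreviation pm :: "real \<Rightarrow> real" where "pm x \<equiv> \<bar>x\<bar> powr (1 + \<epsilon>)"
abbreviation "H \<equiv> heavy_tailed \<epsilon> \<Gamma>"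

text \<open>
The largest mean in the class: by Jensen, $|m(\kappa)|^{1+\epsilon} \le \Gamma$ for $\kappa \in H$.
\<close>
definition M :: real where "M = \<Gamma> powr (1 / (1 + \<epsilon>))"

text \<open>
One-sided version of the constrained divergence. Unlike KL_inf it does not switch sides at the
mean of its argument, which makes it monotone in $t$.
\<close>
definition KLs :: "real measure \<Rightarrow> real \<Rightarrow> ereal" where
  "KLs \<eta> t = (INF \<kappa>\<in>{\<kappa>\<in>H. t \<le> \<sigma> * mean \<kappa>}. KL \<eta> \<kappa>)"

text \<open>
Payoff of a bet with stakes $l = (a, b)$ against the hypothesis that $\sigma m \ge t$ and the moment is at most
$\Gamma$: if the hypothesis holds, one unit of capital has expected payoff at most one.
\<close>
definition bet :: "real \<Rightarrow> real \<times> real \<Rightarrow> real \<Rightarrow> real" where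
  "bet t l x = 1 + fst l * (t - \<sigma> * x) + snd l * (pm x - \<Gamma>)"

definition bets :: "real \<Rightarrow> (real \<times> real) set" where
  "bets t = {l. 0 \<le> fst l \<and> 0 \<le> snd l \<and> (\<forall>x. 0 \<le> bet t l x)}"

definition fin_mom :: "real measure \<Rightarrow> bool" where
  "fin_mom \<eta> \<longleftrightarrow> real_distribution \<eta> \<and> integrable \<eta> pm"

text \<open>
The primal problem restricted to measures $\phi \eta + w \delta$ with a single atom at $\sigma y$, where $w$ is the
missing mass. One atom is no restriction, since replacing additional mass by its barycentre keeps
the mean and lowers the convex moment.
\<close>
definition reach :: "real measure \<Rightarrow> real \<Rightarrow> real \<Rightarrow> bool" where
  "reach \<eta> t c \<longleftrightarrow> (\<exists>\<phi> y. \<phi> \<in> borel_measurable borel \<and> (\<forall>x. 0 < \<phi> x) \<and>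
     integrable \<eta> \<phi> \<and> integrable \<eta> (\<lambda>x. \<phi> x * x) \<and> integrable \<eta> (\<lambda>x. \<phi> x * pm x) \<and>
     integrable \<eta> (\<lambda>x. ln (\<phi> x)) \<and> (\<integral>x. \<phi> x \<partial>\<eta>) \<le> 1 \<and>
     t \<le> \<sigma> * (\<integral>x. \<phi> x * x \<partial>\<eta>) + (1 - (\<integral>x. \<phi> x \<partial>\<eta>)) * y \<and>
     (\<integral>x. \<phi> x * pm x \<partial>\<eta>) + (1 - (\<integral>x. \<phi> x \<partial>\<eta>)) * pm y \<le> \<Gamma> \<and>
     - (\<integral>x. ln (\<phi> x) \<partial>\<eta>) \<le> c)"

lemma sig_sq[simp]: "\<sigma> * \<sigma> = 1" "\<sigma> * (\<sigma> * x) = x" "\<bar>\<sigma>\<bar> = 1" "\<bar>\<sigma> * x\<bar> = \<bar>x\<bar>"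
  using sig by (auto simp: abs_mult)

lemma M_pos: "0 < M" using Gam by (simp add: M_def)

lemma M_powr: "M powr (1 + \<epsilon>) = \<Gamma>"
  using Gam eps by (simp add: M_def powr_powr)

lemma powr_less_Gamma: "0 \<le> y \<Longrightarrow> y < M \<Longrightarrow> y powr (1 + \<epsilon>) < \<Gamma>"
  using powr_less_mono2[of "1 + \<epsilon>" y M] eps M_powr by simp

lemma abs_le_pm: "\<bar>x\<bar> \<le> 1 + pm x"
proof (cases "\<bar>x\<bar> \<le> 1")
  case True then show ?thesis by (smt (verit) powr_ge_zero)
next
  case False
  then have "\<bar>x\<bar> powr 1 \<le> \<bar>x\<bar> powr (1 + \<epsilon>)" using eps by (intro powr_mono) auto
  then show ?thesis using False by simp
qed

lemma fin_momD:
  assumes "fin_mom \<eta>"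
  shows "real_distribution \<eta>" "prob_space \<eta>" "integrable \<eta> pm" "integrable \<eta> (\<lambda>x. x)"
    "integrable \<eta> (bet t l)"
proof -
  show 1: "real_distribution \<eta>" and 2: "integrable \<eta> pm" using assms by (auto simp: fin_mom_def)
  interpret real_distribution \<eta> by fact
  show "prob_space \<eta>" by (rule prob_space_axioms)
  show 3: "integrable \<eta> (\<lambda>x. x)"
    by (rule Bochner_Integration.integrable_bound[where f="\<lambda>x. 1 + pm x"]) (use 2 abs_le_pm in auto)
  show "integrable \<eta> (bet t l)" unfolding bet_def using 2 3 by auto
qed

lemma heavy_fin_mom:
  assumes "\<kappa> \<in> H"
  shows "fin_mom \<kappa>" "(\<integral>x. pm x \<partial>\<kappa>) \<le> \<Gamma>"
proof -
  have 1: "real_distribution \<kappa>" and 2: "(\<integral>\<^sup>+ x. ennreal (pm x) \<partial>\<kappa>) \<le> ennreal \<Gamma>"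
    using assms by (auto simp: heavy_tailed_def)
  interpret real_distribution \<kappa> by fact
  have i: "integrable \<kappa> pm"
    by (rule integrableI_nonneg) (use 2 in \<open>auto intro: order_le_less_trans\<close>)
  with 1 show "fin_mom \<kappa>" by (simp add: fin_mom_def)
  have "ennreal (\<integral>x. pm x \<partial>\<kappa>) \<le> ennreal \<Gamma>" using nn_integral_eq_integral[OF i] 2 by simp
  then show "(\<integral>x. pm x \<partial>\<kappa>) \<le> \<Gamma>" using Gam by simp
qed

lemma bet_measurable[measurable]: "bet t l \<in> borel_measurable borel"
  unfolding bet_def[abs_def] by measurable

lemma KLs_le_of_reach:
  assumes \<eta>: "fin_mom \<eta>" and r: "reach \<eta> t c"
  shows "KLs \<eta> t \<le> ereal c"
proof -
  note f = fin_momD[OF \<eta>]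
  interpret real_distribution \<eta> by fact
  obtain \<phi> y where \<phi>[measurable]: "\<phi> \<in> borel_measurable borel" and pos: "\<And>x. 0 < \<phi> x"
    and i: "integrable \<eta> \<phi>" "integrable \<eta> (\<lambda>x. \<phi> x * x)" "integrable \<eta> (\<lambda>x. \<phi> x * pm x)"
      "integrable \<eta> (\<lambda>x. ln (\<phi> x))" and w1: "(\<integral>x. \<phi> x \<partial>\<eta>) \<le> 1"
    and m: "t \<le> \<sigma> * (\<integral>x. \<phi> x * x \<partial>\<eta>) + (1 - (\<integral>x. \<phi> x \<partial>\<eta>)) * y"
    and p: "(\<integral>x. \<phi> x * pm x \<partial>\<eta>) + (1 - (\<integral>x. \<phi> x \<partial>\<eta>)) * pm y \<le> \<Gamma>"
    and c: "- (\<integral>x. ln (\<phi> x) \<partial>\<eta>) \<le> c"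
    using r unfolding reach_def by blast
  define w where "w = 1 - (\<integral>x. \<phi> x \<partial>\<eta>)"
  have w0: "0 \<le> w" using w1 by (simp add: w_def)
  let ?K = "reweight_atom \<eta> \<phi> w (\<sigma> * y)"
  note hb = reweight_atom_integral[OF f(1) \<phi> _ less_imp_le[OF pos] w0, where y="\<sigma> * y"]
  note nn = nn_integral_reweight_atom[OF f(1) \<phi>, of _ w "\<sigma> * y"]
  have s[simp, measurable_cong]: "sets ?K = sets borel" by (simp add: reweight_atom_def)
  have "(\<integral>\<^sup>+x. ennreal (\<phi> x) \<partial>\<eta>) = ennreal (\<integral>x. \<phi> x \<partial>\<eta>)"
    using i pos by (intro nn_integral_eq_integral) (auto simp: less_imp_le)
  then have "emeasure ?K (space ?K) = 1"
    using nn[of "\<lambda>_. 1"] w0 i pos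
    by (simp add: w_def ennreal_plus[symmetric] integral_nonneg less_imp_le del: ennreal_plus)
  then have K: "real_distribution ?K"
    by (intro real_distribution.intro prob_spaceI real_distribution_axioms.intro s)
  have mean: "mean ?K = (\<integral>x. \<phi> x * x \<partial>\<eta>) + w * (\<sigma> * y)"
    unfolding mean_def using hb[of "\<lambda>x. x"] i by (auto simp: has_bochner_integral_iff)
  have "\<sigma> * mean ?K = \<sigma> * (\<integral>x. \<phi> x * x \<partial>\<eta>) + w * (\<sigma> * \<sigma>) * y" unfolding mean by (simp add: algebra_simps)
  with m have mt: "t \<le> \<sigma> * mean ?K" by (simp add: w_def)
  have "has_bochner_integral ?K pm ((\<integral>x. \<phi> x * pm x \<partial>\<eta>) + w * pm (\<sigma> * y))"
    using i by (intro hb) auto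
  then have "(\<integral>\<^sup>+x. ennreal (pm x) \<partial>?K) = ennreal ((\<integral>x. \<phi> x * pm x \<partial>\<eta>) + w * pm (\<sigma> * y))"
    by (subst nn_integral_eq_integral) (auto simp: has_bochner_integral_iff)
  also have "\<dots> \<le> ennreal \<Gamma>" using p by (intro ennreal_leI) (simp add: w_def)
  finally have KH: "?K \<in> H" using K by (simp add: heavy_tailed_def)
  have "KL \<eta> ?K \<le> ereal (- (\<integral>x. ln (\<phi> x) \<partial>\<eta>))"
    by (rule KL_le_of_subdensity[OF K f(1) \<phi> pos i(4)]) (simp add: nn)
  also have "\<dots> \<le> ereal c" using c by simp
  finally show ?thesis unfolding KLs_def using KH mt by (intro INF_lower2[of ?K]) auto
qed

lemma bet_mean_le_1:
  assumes \<kappa>: "\<kappa> \<in> H" and m: "t \<le> \<sigma> * mean \<kappa>" and l: "l \<in> bets t"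
  shows "(\<integral>\<^sup>+x. ennreal (bet t l x) \<partial>\<kappa>) \<le> 1"
proof -
  note f = fin_momD[OF heavy_fin_mom(1)[OF \<kappa>]]
  interpret real_distribution \<kappa> by (rule f)
  have "(\<integral>x. bet t l x \<partial>\<kappa>) = 1 + fst l * (t - \<sigma> * mean \<kappa>) + snd l * ((\<integral>x. pm x \<partial>\<kappa>) - \<Gamma>)"
    unfolding bet_def mean_def using f(3,4) prob_space by simp
  also have "\<dots> \<le> 1"
    using m heavy_fin_mom(2)[OF \<kappa>] l by (auto simp: bets_def intro!: add_nonpos_nonpos mult_nonneg_nonpos)
  finally show ?thesis
    using l f(5) by (subst nn_integral_eq_integral) (auto simp: bets_def)
qed

lemma weak_duality:
  assumes \<eta>: "fin_mom \<eta>" and l: "l \<in> bets t" and pos: "AE x in \<eta>. 0 < bet t l x"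
    and ln: "integrable \<eta> (\<lambda>x. ln (bet t l x))"
  shows "ereal (\<integral>x. ln (bet t l x) \<partial>\<eta>) \<le> KLs \<eta> t"
  unfolding KLs_def
proof (rule INF_greatest)
  fix \<kappa> assume "\<kappa> \<in> {\<kappa> \<in> H. t \<le> \<sigma> * mean \<kappa>}"
  then have \<kappa>: "\<kappa> \<in> H" and m: "t \<le> \<sigma> * mean \<kappa>" by auto
  note f = fin_momD[OF heavy_fin_mom(1)[OF \<kappa>]]
  interpret real_distribution \<kappa> by (rule f)
  have nn: "0 \<le> bet t l x" for x using l by (simp add: bets_def)
  have "(\<integral>\<^sup>+x. ennreal (bet t l x) \<partial>\<kappa>) \<le> 1" by (rule bet_mean_le_1[OF \<kappa> m l])
  then show "ereal (\<integral>x. ln (bet t l x) \<partial>\<eta>) \<le> KL \<eta> \<kappa>"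
    by (intro integral_ln_le_KL[OF f(1) fin_momD(1)[OF \<eta>] _ nn _ pos ln]) auto
qed

lemma bet_convex: "bet t ((1 - s) *\<^sub>R l + s *\<^sub>R l') x = (1 - s) * bet t l x + s * bet t l' x"
  by (simp add: bet_def algebra_simps)

lemma bet_0[simp]: "bet t 0 x = 1" by (simp add: bet_def)

lemma bets_0[simp]: "0 \<in> bets t" by (simp add: bets_def)

lemma bets_convex: "l \<in> bets t \<Longrightarrow> l' \<in> bets t \<Longrightarrow> 0 \<le> s \<Longrightarrow> s \<le> 1 \<Longrightarrow> (1 - s) *\<^sub>R l + s *\<^sub>R l' \<in> bets t"
  unfolding bets_def by (auto simp: bet_convex)

lemma bet_continuous: "continuous_on UNIV (\<lambda>l. bet t l x)"
  unfolding bet_def by (intro continuous_intros)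

text \<open>
For $t < M$ there is a point $z$ with $t < z < M$. There both terms of the payoff are losses, so that
nonnegativity of the payoff bounds both stakes.
\<close>
lemma bets_compact:
  assumes t: "t < M" shows "compact (bets t)"
proof -
  have "bets t = ({l. 0 \<le> fst l} \<inter> {l. 0 \<le> snd l}) \<inter> (\<Inter>x. {l. 0 \<le> bet t l x})"
    by (auto simp: bets_def)
  moreover have "closed {l. 0 \<le> bet t l x}" for x
    using bet_continuous by (intro closed_Collect_le continuous_on_const)
  moreover have "closed {l :: real \<times> real. 0 \<le> fst l}" "closed {l :: real \<times> real. 0 \<le> snd l}"
    by (auto intro!: closed_Collect_le continuous_intros)
  ultimately have cl: "closed (bets t)" by (metis closed_INT closed_Int)
  define z where "z = (max t 0 + M) / 2"
  have z: "t < z" "0 < z" "z < M" using t M_pos by (auto simp: z_def max_def)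
  define D where "D = \<Gamma> - z powr (1 + \<epsilon>)"
  have D: "0 < D" using powr_less_Gamma[of z] z by (simp add: D_def)
  have b: "fst l \<le> 1 / (z - t)" "snd l \<le> 1 / D" "0 \<le> fst l" "0 \<le> snd l" if "l \<in> bets t" for l
  proof -
    show nn: "0 \<le> fst l" "0 \<le> snd l" using that by (auto simp: bets_def)
    have "0 \<le> bet t l (\<sigma> * z)" using that by (auto simp: bets_def)
    then have *: "fst l * (z - t) + snd l * D \<le> 1"
      using z by (simp add: bet_def D_def algebra_simps)
    have "0 \<le> fst l * (z - t)" "0 \<le> snd l * D" using nn z D by auto
    with * have "fst l * (z - t) \<le> 1" "snd l * D \<le> 1" by auto
    then show "fst l \<le> 1 / (z - t)" "snd l \<le> 1 / D" using z D by (auto simp: field_simps)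
  qed
  have "bets t \<subseteq> {0..1 / (z - t)} \<times> {0..1 / D}" using b by (auto simp: mem_Times_iff)
  then have "bounded (bets t)" by (rule bounded_subset[rotated]) (intro bounded_Times bounded_closed_interval)
  with cl show ?thesis by (simp add: compact_eq_bounded_closed)
qed

text \<open>
The bet is $1/D$ times the gap between the power and its tangent at $y$, where $D$ is $\Gamma$ minus the value of
the tangent at $t$. The tangent increases and lies below the power, so $D > 0$ for $t < M$.
\<close>
lemma tangent_in_bets:
  assumes t: "t < M" and y: "0 \<le> y"
  obtains b where "0 < b" "(b * ((1 + \<epsilon>) * y powr \<epsilon>), b) \<in> bets t"
    "bet t (b * ((1 + \<epsilon>) * y powr \<epsilon>), b) (\<sigma> * y) = 0"
proof -
  define A where "A = (1 + \<epsilon>) * y powr \<epsilon>"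
  define D where "D = \<Gamma> - y powr (1 + \<epsilon>) - A * (t - y)"
  have A0: "0 \<le> A" using eps by (simp add: A_def)
  have tan: "y powr (1 + \<epsilon>) + A * (z - y) \<le> pm z" for z
    using powr_tangent[of "1 + \<epsilon>" y z] eps y by (simp add: A_def)
  have D: "0 < D"
  proof (cases "0 \<le> t")
    case True
    have "y powr (1 + \<epsilon>) + A * (t - y) \<le> t powr (1 + \<epsilon>)" using tan[of t] True by simp
    also have "\<dots> < \<Gamma>" using True t by (rule powr_less_Gamma)
    finally show ?thesis by (simp add: D_def)
  next
    case False
    have "y powr (1 + \<epsilon>) + A * (0 - y) \<le> 0" using tan[of 0] eps by simp
    moreover have "A * t \<le> 0" using False A0 by (auto intro: mult_nonneg_nonpos)
    ultimately show ?thesis using Gam by (simp add: D_def algebra_simps)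
  qed
  define b where "b = 1 / D"
  have b: "0 < b" "b * D = 1" using D by (auto simp: b_def)
  have eq: "bet t (b * A, b) x = b * (pm x - y powr (1 + \<epsilon>) - A * (\<sigma> * x - y))" for x
  proof -
    have "bet t (b * A, b) x = b * D + b * A * (t - \<sigma> * x) + b * (pm x - \<Gamma>)"
      by (simp add: bet_def b(2))
    then show ?thesis by (simp add: D_def algebra_simps)
  qed
  have "(b * A, b) \<in> bets t"
    unfolding bets_def
  proof (intro CollectI conjI allI)
    fix x
    have "0 \<le> pm x - y powr (1 + \<epsilon>) - A * (\<sigma> * x - y)" using tan[of "\<sigma> * x"] by simp
    then show "0 \<le> bet t (b * A, b) x" unfolding eq using b by (intro mult_nonneg_nonneg) auto
  qed (use b A0 in auto)
  moreover have "bet t (b * A, b) (\<sigma> * y) = 0" unfolding eq using y by simp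
  ultimately show ?thesis using that b unfolding A_def by blast
qed

text \<open>
The primal solution is read off from the optimal bet. To stay away from payoff 0 all bets are
mixed with the sure payoff 1 in proportion $s$; this costs at most $- \ln (1-s)$, which is chosen to be
$c' - c$. The optimal mixed payoff $K$ gives the reweighting $\phi = (1-s)/K$, which has mass less than 1,
and the mean constraint dictates the place $y$ of the missing mass. That the moment
constraint holds as well is exactly the optimality condition for the bet tangent at $y$.
\<close>
lemma strong_duality:
  assumes \<eta>: "fin_mom \<eta>" and t: "t < M" and cc: "c < c'"
    and dual: "\<And>l s. l \<in> bets t \<Longrightarrow> 0 < s \<Longrightarrow> (\<And>x. s \<le> bet t l x) \<Longrightarrow> (\<integral>x. ln (bet t l x) \<partial>\<eta>) \<le> c"
  shows "reach \<eta> t c'"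
proof -
  note f = fin_momD[OF \<eta>]
  interpret real_distribution \<eta> by (rule f)
  \<comment> \<open>The proportion of sure payoff that costs exactly $c' - c$.\<close>
  define s where "s = 1 - exp (c - c')"
  have s: "0 < s" "s < 1" and lns: "- ln (1 - s) = c' - c" using cc by (auto simp: s_def)
  define K where "K l x = s + (1 - s) * bet t l x" for l x
  have Kge: "s \<le> K l x" if "l \<in> bets t" for l x
    using that s by (auto simp: K_def bets_def)
  have Kpos: "0 < K l x" if "l \<in> bets t" for l x using Kge[OF that, of x] s by linarith
  have Kint: "integrable \<eta> (K l)" for l unfolding K_def using f by auto
  have [measurable]: "K l \<in> borel_measurable borel" for l unfolding K_def[abs_def] by measurable
  have Kln: "integrable \<eta> (\<lambda>x. ln (K l x))" if "l \<in> bets t" for l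
    using Kint s(1) Kge[OF that] f(2) by (rule integrable_ln_bdd_below)
  have Khh: "K l x = bet t ((1 - s) *\<^sub>R l) x" for l x
    using bet_convex[of t s l 0 x] by (simp add: K_def)
  define J where "J l = (\<integral>x. ln (K l x) \<partial>\<eta>)" for l
  have comp: "compact (bets t)" using t by (rule bets_compact)
  then obtain C where C: "\<And>l. l \<in> bets t \<Longrightarrow> norm l \<le> C" by (meson compact_imp_bounded bounded_iff)
  have "continuous_on (bets t) J"
    unfolding continuous_on_sequentially
  proof (intro allI ballI impI)
    fix X l assume l: "l \<in> bets t" and X: "(\<forall>n. X n \<in> bets t) \<and> X \<longlonglongrightarrow> l"
    show "(J \<circ> X) \<longlonglongrightarrow> J l"
      unfolding comp_def J_def
    proof (rule integral_dominated_convergence[where w="\<lambda>x. \<bar>ln s\<bar> + (s + (1 - s) * (1 + C * (\<bar>t\<bar> + \<bar>x\<bar>) + C * (pm x + \<Gamma>)))"])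
      show "integrable \<eta> (\<lambda>x. \<bar>ln s\<bar> + (s + (1 - s) * (1 + C * (\<bar>t\<bar> + \<bar>x\<bar>) + C * (pm x + \<Gamma>))))"
        using f by auto
      show "AE x in \<eta>. (\<lambda>i. ln (K (X i) x)) \<longlonglongrightarrow> ln (K l x)"
      proof (intro AE_I2 tendsto_ln)
        fix x
        show "(\<lambda>i. K (X i) x) \<longlonglongrightarrow> K l x"
          unfolding K_def bet_def using X by (intro tendsto_intros) auto
        show "K l x \<noteq> 0" using Kpos[OF l, of x] by simp
      qed
      show "AE x in \<eta>. norm (ln (K (X i) x)) \<le> \<bar>ln s\<bar> + (s + (1 - s) * (1 + C * (\<bar>t\<bar> + \<bar>x\<bar>) + C * (pm x + \<Gamma>)))" for i
      proof (intro AE_I2)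
        fix x
        let ?l = "X i"
        have Xi: "?l \<in> bets t" using X by auto
        have n: "\<bar>fst ?l\<bar> \<le> C" "\<bar>snd ?l\<bar> \<le> C"
          using C[OF Xi] norm_fst_le[of "fst ?l" "snd ?l"] norm_snd_le[of "snd ?l" "fst ?l"] by auto
        have "\<bar>t - \<sigma> * x\<bar> \<le> \<bar>t\<bar> + \<bar>x\<bar>" using sig by auto
        then have 1: "fst ?l * (t - \<sigma> * x) \<le> C * (\<bar>t\<bar> + \<bar>x\<bar>)"
          by (intro mult_le_of_abs_le n)
        have "\<bar>pm x - \<Gamma>\<bar> \<le> pm x + \<Gamma>"
          using Gam powr_ge_zero[of "\<bar>x\<bar>" "1 + \<epsilon>"] by linarith
        then have 2: "snd ?l * (pm x - \<Gamma>) \<le> C * (pm x + \<Gamma>)"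
          by (intro mult_le_of_abs_le n)
        have "bet t ?l x \<le> 1 + C * (\<bar>t\<bar> + \<bar>x\<bar>) + C * (pm x + \<Gamma>)"
          unfolding bet_def using 1 2 by linarith
        then have "K ?l x \<le> s + (1 - s) * (1 + C * (\<bar>t\<bar> + \<bar>x\<bar>) + C * (pm x + \<Gamma>))"
          unfolding K_def using s by (intro add_left_mono mult_left_mono) auto
        then show "norm (ln (K ?l x)) \<le> \<bar>ln s\<bar> + (s + (1 - s) * (1 + C * (\<bar>t\<bar> + \<bar>x\<bar>) + C * (pm x + \<Gamma>)))"
          using ln_bound[OF s(1) Kge[OF Xi], of x] Kpos[OF Xi, of x] by simp
      qed
    qed auto
  qed
  then obtain m where m: "m \<in> bets t" and max: "\<And>l. l \<in> bets t \<Longrightarrow> J l \<le> J m"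
    using continuous_attains_sup[OF comp, of J] bets_0 by blast
  have foc: "integrable \<eta> (\<lambda>x. K l x / K m x)" "(\<integral>x. K l x / K m x \<partial>\<eta>) \<le> 1" if l: "l \<in> bets t" for l
  proof -
    have opt: "(\<integral>x. ln ((1 - \<theta>) * K m x + \<theta> * K l x) \<partial>\<eta>) \<le> (\<integral>x. ln (K m x) \<partial>\<eta>)"
      if "0 < \<theta>" "\<theta> < 1" for \<theta>
    proof -
      have "(1 - \<theta>) * K m x + \<theta> * K l x = K ((1 - \<theta>) *\<^sub>R m + \<theta> *\<^sub>R l) x" for x
        by (simp only: K_def bet_convex) (simp add: algebra_simps)
      then show ?thesis using max[OF bets_convex[OF m l, of \<theta>]] that by (simp add: J_def)
    qed
    have nn: "0 \<le> K l x" for x using Kpos[OF l, of x] by simp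
    show "integrable \<eta> (\<lambda>x. K l x / K m x)" "(\<integral>x. K l x / K m x \<partial>\<eta>) \<le> 1"
      using first_order_optimality[OF f(2) s(1) Kint Kge[OF m] Kint nn opt] by auto
  qed
  define \<phi> where "\<phi> x = (1 - s) / K m x" for x
  have \<phi>[measurable]: "\<phi> \<in> borel_measurable borel" unfolding \<phi>_def[abs_def] by measurable
  have pos: "0 < \<phi> x" for x using s Kpos[OF m, of x] by (simp add: \<phi>_def)
  have bnd: "\<phi> x \<le> 1 / s" for x
    using Kge[OF m, of x] s Kpos[OF m, of x] unfolding \<phi>_def by (intro frac_le) auto
  have ib: "integrable \<eta> (\<lambda>x. \<phi> x * g x)" if g: "integrable \<eta> g" for g
  proof (rule Bochner_Integration.integrable_bound[where f="\<lambda>x. (1 / s) * g x"])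
    show "AE x in \<eta>. norm (\<phi> x * g x) \<le> norm (1 / s * g x)"
    proof (intro AE_I2)
      fix x
      have "\<bar>\<phi> x\<bar> * \<bar>g x\<bar> \<le> \<bar>1 / s\<bar> * \<bar>g x\<bar>"
        using bnd[of x] pos[of x] s by (intro mult_right_mono) auto
      then show "norm (\<phi> x * g x) \<le> norm (1 / s * g x)" by (simp only: real_norm_def abs_mult)
    qed
    show "(\<lambda>x. \<phi> x * g x) \<in> borel_measurable \<eta>" using g by measurable
  qed (use g in auto)
  have i\<phi>: "integrable \<eta> \<phi>" using ib[of "\<lambda>_. 1"] by simp
  note i = i\<phi> ib[OF f(4)] ib[OF f(3)]
  have intpos: "0 < (\<integral>x. \<phi> x \<partial>\<eta>)"
  proof -
    have "0 \<le> (\<integral>x. \<phi> x \<partial>\<eta>)" using pos by (auto intro!: integral_nonneg simp: less_imp_le)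
    moreover have "(\<integral>x. \<phi> x \<partial>\<eta>) \<noteq> 0"
    proof
      assume "(\<integral>x. \<phi> x \<partial>\<eta>) = 0"
      then have "AE x in \<eta>. \<phi> x = 0"
        using i\<phi> pos by (subst (asm) integral_nonneg_eq_0_iff_AE) (auto simp: less_imp_le)
      then have "AE x in \<eta>. False" by eventually_elim (use pos in \<open>auto simp: less_le\<close>)
      then show False by simp
    qed
    ultimately show ?thesis by simp
  qed
  have foc': "(\<integral>x. \<phi> x * bet t l x \<partial>\<eta>) + s / (1 - s) * (\<integral>x. \<phi> x \<partial>\<eta>) \<le> 1" if l: "l \<in> bets t" for l
  proof -
    have "K l x / K m x = \<phi> x * bet t l x + s / (1 - s) * \<phi> x" for x
      using s Kpos[OF m, of x] by (simp add: K_def[of l] \<phi>_def field_simps)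
    then show ?thesis using foc(2)[OF l] i\<phi> ib[OF f(5)] by simp
  qed
  define v1 where "v1 = \<sigma> * (\<integral>x. \<phi> x * x \<partial>\<eta>)"
  define v2 where "v2 = (\<integral>x. \<phi> x * pm x \<partial>\<eta>)"
  define w where "w = 1 - (\<integral>x. \<phi> x \<partial>\<eta>)"
  have "(\<integral>x. \<phi> x \<partial>\<eta>) + s / (1 - s) * (\<integral>x. \<phi> x \<partial>\<eta>) \<le> 1" using foc'[OF bets_0] by simp
  moreover have "0 < s / (1 - s) * (\<integral>x. \<phi> x \<partial>\<eta>)" using s intpos by simp
  ultimately have w: "0 < w" by (simp add: w_def)
  have hint: "(\<integral>x. \<phi> x * bet t l x \<partial>\<eta>) = (1 - w) + fst l * (t * (1 - w) - v1) + snd l * (v2 - \<Gamma> * (1 - w))" for l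
  proof -
    have "(\<integral>x. \<phi> x * bet t l x \<partial>\<eta>) = (\<integral>x. \<phi> x + fst l * (t * \<phi> x - \<sigma> * (\<phi> x * x)) + snd l * (\<phi> x * pm x - \<Gamma> * \<phi> x) \<partial>\<eta>)"
      by (intro Bochner_Integration.integral_cong) (auto simp: bet_def algebra_simps)
    also have "\<dots> = (\<integral>x. \<phi> x \<partial>\<eta>) + fst l * (t * (\<integral>x. \<phi> x \<partial>\<eta>) - v1) + snd l * (v2 - \<Gamma> * (\<integral>x. \<phi> x \<partial>\<eta>))"
      unfolding v1_def v2_def using i by simp
    finally show ?thesis by (simp add: w_def)
  qed
  \<comment> \<open>The smallest nonnegative place of the missing mass that satisfies the mean constraint.\<close>
  define y where "y = max 0 ((t - v1) / w)"
  have y: "0 \<le> y" by (simp add: y_def)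
  have mean: "t \<le> v1 + w * y"
  proof -
    have "(t - v1) / w \<le> y" by (simp add: y_def)
    then show ?thesis using w by (simp add: field_simps)
  qed
  obtain b where b: "0 < b" "(b * ((1 + \<epsilon>) * y powr \<epsilon>), b) \<in> bets t"
    "bet t (b * ((1 + \<epsilon>) * y powr \<epsilon>), b) (\<sigma> * y) = 0" using tangent_in_bets[OF t y] by blast
  define a where "a = b * ((1 + \<epsilon>) * y powr \<epsilon>)"
  note b = b[folded a_def]
  \<comment> \<open>Complementary slackness: either the mean constraint is tight, or $y = 0$ and the tangent has slope 0.\<close>
  have slack: "a * (t - v1 - w * y) = 0"
  proof (cases "y = 0")
    case True then show ?thesis using eps by (simp add: a_def)
  next
    case False
    then have "y = (t - v1) / w" by (auto simp: y_def max_def split: if_splits)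
    then show ?thesis using w by simp
  qed
  have "(\<integral>x. \<phi> x * bet t (a, b) x \<partial>\<eta>) \<le> 1"
    using foc'[OF b(2)] s intpos by (smt (verit) divide_pos_pos mult_pos_pos)
  then have "(1 - w) + a * (t * (1 - w) - v1) + b * (v2 - \<Gamma> * (1 - w)) \<le> 1"
    using hint[of "(a, b)"] by simp
  moreover have "w * (1 + a * (t - y) + b * (y powr (1 + \<epsilon>) - \<Gamma>)) = 0" using b(3) y by (simp add: bet_def)
  ultimately have "a * (t - v1 - w * y) + b * (v2 + w * y powr (1 + \<epsilon>) - \<Gamma>) \<le> 0"
    by (simp add: algebra_simps)
  then have "b * (v2 + w * y powr (1 + \<epsilon>) - \<Gamma>) \<le> 0" using slack by simp
  \<comment> \<open>The payoff at the atom is 0, so the optimality condition is left with the moment constraint alone.\<close>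
  then have mom: "v2 + w * pm y \<le> \<Gamma>" using b(1) y by (simp add: mult_le_0_iff)
  have lnphi: "ln (\<phi> x) = ln (1 - s) - ln (K m x)" for x
    using s Kpos[OF m, of x] by (simp add: \<phi>_def ln_div)
  have J: "J m \<le> c"
  proof -
    have "(1 - s) *\<^sub>R m \<in> bets t" using bets_convex[OF m bets_0, of s] s by simp
    then show ?thesis unfolding J_def Khh
      using s(1) Kge[OF m] by (intro dual) (auto simp: Khh[symmetric])
  qed
  have iln: "integrable \<eta> (\<lambda>x. ln (\<phi> x))" unfolding lnphi using Kln[OF m] by auto
  have "- (\<integral>x. ln (\<phi> x) \<partial>\<eta>) = J m - ln (1 - s)"
    unfolding lnphi J_def using Kln[OF m] prob_space by simp
  then have val: "- (\<integral>x. ln (\<phi> x) \<partial>\<eta>) \<le> c'" using J lns by simp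
  show ?thesis
    unfolding reach_def using \<phi> pos i iln w mean mom val
    by (intro exI[of _ \<phi>] exI[of _ y]) (auto simp: w_def v1_def v2_def)
qed

section \<open>The primal problem and its value\<close>

lemma pm_subgradient: "\<exists>A. \<forall>z. pm y + A * (z - y) \<le> pm z"
proof (cases "0 \<le> y")
  case True
  then show ?thesis using powr_tangent[of "1 + \<epsilon>" y] eps by (intro exI[of _ "(1 + \<epsilon>) * y powr \<epsilon>"]) auto
next
  case False
  have "pm y + - ((1 + \<epsilon>) * (- y) powr \<epsilon>) * (z - y) \<le> pm z" for z
    using powr_tangent[of "1 + \<epsilon>" "- y" "- z"] eps False by (simp add: algebra_simps)
  then show ?thesis by blast
qed

text \<open>
Two atoms can be merged into one without changing their mean or increasing their moment.
\<close>
lemma pm_jensen: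
  assumes "0 \<le> u" "0 \<le> v"
  obtains y where "(u + v) * y = u * y0 + v * y1" "(u + v) * pm y \<le> u * pm y0 + v * pm y1"
proof (cases "u + v = 0")
  case True
  with assms have "u = 0" "v = 0" by auto
  then show ?thesis using that[of 0] by simp
next
  case False
  define y where "y = (u * y0 + v * y1) / (u + v)"
  obtain A where A: "\<And>z. pm y + A * (z - y) \<le> pm z" using pm_subgradient by blast
  have e: "(u + v) * y = u * y0 + v * y1" using False by (simp add: y_def)
  have "u * (pm y + A * (y0 - y)) + v * (pm y + A * (y1 - y)) \<le> u * pm y0 + v * pm y1"
    using assms A by (intro add_mono mult_left_mono) auto
  moreover have "u * (pm y + A * (y0 - y)) + v * (pm y + A * (y1 - y)) = (u + v) * pm y + A * (u * y0 + v * y1 - (u + v) * y)"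
    by (simp add: algebra_simps)
  ultimately show ?thesis using that[of y] e by simp
qed

lemma reachI:
  assumes "\<phi> \<in> borel_measurable borel" "\<And>x. 0 < \<phi> x"
     "integrable \<eta> \<phi>" "integrable \<eta> (\<lambda>x. \<phi> x * x)" "integrable \<eta> (\<lambda>x. \<phi> x * pm x)"
     "integrable \<eta> (\<lambda>x. ln (\<phi> x))" "(\<integral>x. \<phi> x \<partial>\<eta>) \<le> 1"
     "t \<le> \<sigma> * (\<integral>x. \<phi> x * x \<partial>\<eta>) + (1 - (\<integral>x. \<phi> x \<partial>\<eta>)) * y"
     "(\<integral>x. \<phi> x * pm x \<partial>\<eta>) + (1 - (\<integral>x. \<phi> x \<partial>\<eta>)) * pm y \<le> \<Gamma>"
     "- (\<integral>x. ln (\<phi> x) \<partial>\<eta>) \<le> c"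
   shows "reach \<eta> t c"
  unfolding reach_def using assms by (intro exI[of _ \<phi>] exI[of _ y]) auto

text \<open>
Mixing two reweightings mixes thresholds and moments linearly, and the value is
convex because the logarithm is concave.
\<close>
lemma reach_convex:
  assumes \<eta>: "fin_mom \<eta>" and r0: "reach \<eta> t0 c0" and r1: "reach \<eta> t1 c1" and s: "0 \<le> s" "s \<le> 1"
  shows "reach \<eta> ((1 - s) * t0 + s * t1) ((1 - s) * c0 + s * c1)"
proof (cases "s = 0 \<or> s = 1")
  case True
  then show ?thesis using r0 r1 by auto
next
  case False
  then have s: "0 < s" "s < 1" using s by auto
  note f = fin_momD[OF \<eta>]
  interpret real_distribution \<eta> by (rule f)
  obtain \<phi>0 y0 where p0[measurable]: "\<phi>0 \<in> borel_measurable borel" and pos0: "\<And>x. 0 < \<phi>0 x"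
     and i0: "integrable \<eta> \<phi>0" "integrable \<eta> (\<lambda>x. \<phi>0 x * x)" "integrable \<eta> (\<lambda>x. \<phi>0 x * pm x)"
     "integrable \<eta> (\<lambda>x. ln (\<phi>0 x))" and w0: "(\<integral>x. \<phi>0 x \<partial>\<eta>) \<le> 1"
     and m0: "t0 \<le> \<sigma> * (\<integral>x. \<phi>0 x * x \<partial>\<eta>) + (1 - (\<integral>x. \<phi>0 x \<partial>\<eta>)) * y0"
     and q0: "(\<integral>x. \<phi>0 x * pm x \<partial>\<eta>) + (1 - (\<integral>x. \<phi>0 x \<partial>\<eta>)) * pm y0 \<le> \<Gamma>"
     and c0: "- (\<integral>x. ln (\<phi>0 x) \<partial>\<eta>) \<le> c0" using r0 unfolding reach_def by blast
  obtain \<phi>1 y1 where p1[measurable]: "\<phi>1 \<in> borel_measurable borel" and pos1: "\<And>x. 0 < \<phi>1 x"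
     and i1: "integrable \<eta> \<phi>1" "integrable \<eta> (\<lambda>x. \<phi>1 x * x)" "integrable \<eta> (\<lambda>x. \<phi>1 x * pm x)"
     "integrable \<eta> (\<lambda>x. ln (\<phi>1 x))" and w1: "(\<integral>x. \<phi>1 x \<partial>\<eta>) \<le> 1"
     and m1: "t1 \<le> \<sigma> * (\<integral>x. \<phi>1 x * x \<partial>\<eta>) + (1 - (\<integral>x. \<phi>1 x \<partial>\<eta>)) * y1"
     and q1: "(\<integral>x. \<phi>1 x * pm x \<partial>\<eta>) + (1 - (\<integral>x. \<phi>1 x \<partial>\<eta>)) * pm y1 \<le> \<Gamma>"
     and c1: "- (\<integral>x. ln (\<phi>1 x) \<partial>\<eta>) \<le> c1" using r1 unfolding reach_def by blast
  define \<phi> where "\<phi> x = (1 - s) * \<phi>0 x + s * \<phi>1 x" for x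
  define u v where "u = (1 - s) * (1 - (\<integral>x. \<phi>0 x \<partial>\<eta>))" and "v = s * (1 - (\<integral>x. \<phi>1 x \<partial>\<eta>))"
  have uv: "0 \<le> u" "0 \<le> v" using s w0 w1 by (auto simp: u_def v_def)
  obtain y where y: "(u + v) * y = u * y0 + v * y1" "(u + v) * pm y \<le> u * pm y0 + v * pm y1"
    using pm_jensen[OF uv] by blast
  have [measurable]: "\<phi> \<in> borel_measurable borel" unfolding \<phi>_def[abs_def] by measurable
  have pos: "0 < \<phi> x" for x using s pos0[of x] pos1[of x] by (simp add: \<phi>_def add_pos_pos)
  have e1: "(\<lambda>x. \<phi> x * g x) = (\<lambda>x. (1 - s) * (\<phi>0 x * g x) + s * (\<phi>1 x * g x))" for g :: "real \<Rightarrow> real"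
    by (auto simp: \<phi>_def algebra_simps)
  have i: "integrable \<eta> \<phi>" "integrable \<eta> (\<lambda>x. \<phi> x * x)" "integrable \<eta> (\<lambda>x. \<phi> x * pm x)"
    unfolding e1 using i0 i1 by (auto simp: \<phi>_def[abs_def])
  have w: "1 - (\<integral>x. \<phi> x \<partial>\<eta>) = u + v"
    using i0 i1 by (simp add: \<phi>_def u_def v_def algebra_simps)
  have lnc: "(1 - s) * ln (\<phi>0 x) + s * ln (\<phi>1 x) \<le> ln (\<phi> x)" for x
  proof -
    have "ln (\<phi>0 x powr (1 - s) * \<phi>1 x powr s) \<le> ln ((1 - s) * \<phi>0 x + s * \<phi>1 x)"
      using s pos0[of x] pos1[of x] by (subst ln_le_cancel_iff) (auto intro!: Youngs_inequality_0 add_pos_pos)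
    then show ?thesis using pos0[of x] pos1[of x] by (simp add: \<phi>_def ln_mult)
  qed
  have iln: "integrable \<eta> (\<lambda>x. ln (\<phi> x))"
  proof (rule Bochner_Integration.integrable_bound)
    show "integrable \<eta> (\<lambda>x. \<bar>(1 - s) * ln (\<phi>0 x) + s * ln (\<phi>1 x)\<bar> + \<bar>\<phi> x\<bar>)"
      using i0 i1 i by auto
    show "AE x in \<eta>. norm (ln (\<phi> x)) \<le> norm (\<bar>(1 - s) * ln (\<phi>0 x) + s * ln (\<phi>1 x)\<bar> + \<bar>\<phi> x\<bar>)"
    proof (intro AE_I2)
      fix x
      show "norm (ln (\<phi> x)) \<le> norm (\<bar>(1 - s) * ln (\<phi>0 x) + s * ln (\<phi>1 x)\<bar> + \<bar>\<phi> x\<bar>)"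
        using ln_le_minus_one[OF pos[of x]] lnc[of x] by simp
    qed
  qed auto
  show ?thesis
  proof (rule reachI[where \<phi>=\<phi> and y=y])
    have "(1 - s) * t0 + s * t1 \<le> (1 - s) * (\<sigma> * (\<integral>x. \<phi>0 x * x \<partial>\<eta>) + (1 - (\<integral>x. \<phi>0 x \<partial>\<eta>)) * y0)
       + s * (\<sigma> * (\<integral>x. \<phi>1 x * x \<partial>\<eta>) + (1 - (\<integral>x. \<phi>1 x \<partial>\<eta>)) * y1)"
      using m0 m1 s by (intro add_mono mult_left_mono) auto
    also have "\<dots> = \<sigma> * ((1 - s) * (\<integral>x. \<phi>0 x * x \<partial>\<eta>) + s * (\<integral>x. \<phi>1 x * x \<partial>\<eta>)) + (u * y0 + v * y1)"
      by (simp add: u_def v_def algebra_simps)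
    also have "\<dots> = \<sigma> * (\<integral>x. \<phi> x * x \<partial>\<eta>) + (1 - (\<integral>x. \<phi> x \<partial>\<eta>)) * y"
      unfolding w y(1) e1 using i0 i1 by simp
    finally show "(1 - s) * t0 + s * t1 \<le> \<sigma> * (\<integral>x. \<phi> x * x \<partial>\<eta>) + (1 - (\<integral>x. \<phi> x \<partial>\<eta>)) * y" .
    have "(\<integral>x. \<phi> x * pm x \<partial>\<eta>) + (1 - (\<integral>x. \<phi> x \<partial>\<eta>)) * pm y
       \<le> (1 - s) * (\<integral>x. \<phi>0 x * pm x \<partial>\<eta>) + s * (\<integral>x. \<phi>1 x * pm x \<partial>\<eta>) + (u * pm y0 + v * pm y1)"
      unfolding w e1 using i0 i1 y(2) by simp
    also have "\<dots> = (1 - s) * ((\<integral>x. \<phi>0 x * pm x \<partial>\<eta>) + (1 - (\<integral>x. \<phi>0 x \<partial>\<eta>)) * pm y0)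
       + s * ((\<integral>x. \<phi>1 x * pm x \<partial>\<eta>) + (1 - (\<integral>x. \<phi>1 x \<partial>\<eta>)) * pm y1)"
      by (simp add: u_def v_def algebra_simps)
    also have "\<dots> \<le> (1 - s) * \<Gamma> + s * \<Gamma>"
      using q0 q1 s by (intro add_mono mult_left_mono) auto
    finally show "(\<integral>x. \<phi> x * pm x \<partial>\<eta>) + (1 - (\<integral>x. \<phi> x \<partial>\<eta>)) * pm y \<le> \<Gamma>" by (simp add: algebra_simps)
    have "(1 - s) * (\<integral>x. ln (\<phi>0 x) \<partial>\<eta>) + s * (\<integral>x. ln (\<phi>1 x) \<partial>\<eta>) = (\<integral>x. (1 - s) * ln (\<phi>0 x) + s * ln (\<phi>1 x) \<partial>\<eta>)"
      using i0 i1 by simp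
    also have "\<dots> \<le> (\<integral>x. ln (\<phi> x) \<partial>\<eta>)"
      using lnc iln i0 i1 by (intro integral_mono) auto
    finally have "- (\<integral>x. ln (\<phi> x) \<partial>\<eta>) \<le> (1 - s) * (- (\<integral>x. ln (\<phi>0 x) \<partial>\<eta>)) + s * (- (\<integral>x. ln (\<phi>1 x) \<partial>\<eta>))" by simp
    also have "\<dots> \<le> (1 - s) * c0 + s * c1"
      using c0 c1 s by (intro add_mono mult_left_mono) auto
    finally show "- (\<integral>x. ln (\<phi> x) \<partial>\<eta>) \<le> (1 - s) * c0 + s * c1" .
  qed (use pos i iln uv w in auto)
qed

lemma reach_mean:
  assumes \<eta>: "fin_mom \<eta>" and m: "(\<integral>x. pm x \<partial>\<eta>) \<le> \<Gamma>"
  shows "reach \<eta> (\<sigma> * mean \<eta>) 0"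
proof -
  note f = fin_momD[OF \<eta>]
  interpret real_distribution \<eta> by (rule f)
  show ?thesis
    by (rule reachI[where \<phi>="\<lambda>_. 1" and y=0]) (use f m prob_space in \<open>auto simp: mean_def\<close>)
qed

text \<open>
Below $M$ the threshold is reached by $e \eta + (1-e) \delta_z$ with an atom between $t$ and $M$ and small $e$.
\<close>
lemma reach_exists:
  assumes \<eta>: "fin_mom \<eta>" and m: "(\<integral>x. pm x \<partial>\<eta>) \<le> \<Gamma>" and t: "t < M"
  obtains c where "reach \<eta> t c"
proof -
  note f = fin_momD[OF \<eta>]
  interpret real_distribution \<eta> by (rule f)
  define z where "z = (max t 0 + M) / 2"
  have z: "t < z" "0 < z" "z < M" using t M_pos by (auto simp: z_def max_def)
  have zp: "pm z \<le> \<Gamma>" using powr_less_Gamma[of z] z by simp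
  define e where "e = min (1/2) ((z - t) / (1 + \<bar>z - \<sigma> * mean \<eta>\<bar>))"
  have "0 < e" using z by (auto simp: e_def)
  moreover have "e \<le> 1/2" unfolding e_def by (rule min.cobounded1)
  ultimately have e: "0 < e" "e \<le> 1/2" by auto
  have "e * (z - \<sigma> * mean \<eta>) \<le> e * (1 + \<bar>z - \<sigma> * mean \<eta>\<bar>)" using e by (intro mult_left_mono) auto
  also have "\<dots> \<le> (z - t) / (1 + \<bar>z - \<sigma> * mean \<eta>\<bar>) * (1 + \<bar>z - \<sigma> * mean \<eta>\<bar>)"
    by (intro mult_right_mono) (auto simp: e_def)
  also have "\<dots> = z - t" by simp
  finally have le: "t \<le> \<sigma> * (e * mean \<eta>) + (1 - e) * z" by (simp add: algebra_simps)
  have "e * (\<integral>x. pm x \<partial>\<eta>) + (1 - e) * pm z \<le> e * \<Gamma> + (1 - e) * \<Gamma>"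
    using e m zp by (intro add_mono mult_left_mono) auto
  then have "reach \<eta> t (- ln e)"
    using e le prob_space f by (intro reachI[where \<phi>="\<lambda>_. e" and y=z]) (auto simp: mean_def algebra_simps)
  then show ?thesis using that by blast
qed

lemma KLs_nonneg: assumes "fin_mom \<eta>" shows "0 \<le> KLs \<eta> t"
  using weak_duality[OF assms bets_0, of t] by (simp add: zero_ereal_def)

lemma KLs_mono: "t \<le> t' \<Longrightarrow> KLs \<eta> t \<le> KLs \<eta> t'"
  unfolding KLs_def by (rule INF_superset_mono) auto

lemma reach_of_KLs_less:
  assumes \<eta>: "fin_mom \<eta>" and t: "t < M" and "KLs \<eta> t < ereal c"
  shows "reach \<eta> t c"
proof -
  obtain c0 where c0: "KLs \<eta> t < ereal c0" "ereal c0 < ereal c"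
    using ereal_dense2[OF assms(3)] by blast
  show ?thesis
  proof (rule strong_duality[OF \<eta> t, of c0])
    fix l s assume l: "l \<in> bets t" and s: "0 < s" and h: "\<And>x. s \<le> bet t l x"
    have "0 < bet t l x" for x using s h[of x] by linarith
    then have "ereal (\<integral>x. ln (bet t l x) \<partial>\<eta>) \<le> KLs \<eta> t"
      using fin_momD[OF \<eta>] s h by (intro weak_duality[OF \<eta> l] integrable_ln_bdd_below[of _ _ s]) auto
    then show "(\<integral>x. ln (bet t l x) \<partial>\<eta>) \<le> c0" using c0 by (metis ereal_less_eq(3) less_imp_le order_trans)
  qed (use c0 in auto)
qed

lemma heavy_mean_le:
  assumes "\<kappa> \<in> H" shows "\<sigma> * mean \<kappa> \<le> M"
proof -
  note f = fin_momD[OF heavy_fin_mom(1)[OF assms]]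
  interpret real_distribution \<kappa> by (rule f)
  have "M powr (1 + \<epsilon>) + (1 + \<epsilon>) * M powr \<epsilon> * (\<sigma> * x - M) \<le> pm x" for x
    using powr_tangent[of "1 + \<epsilon>" M "\<sigma> * x"] eps M_pos by simp
  then have "(\<integral>x. M powr (1 + \<epsilon>) + (1 + \<epsilon>) * M powr \<epsilon> * (\<sigma> * x - M) \<partial>\<kappa>) \<le> (\<integral>x. pm x \<partial>\<kappa>)"
    using f by (intro integral_mono) auto
  also have "\<dots> \<le> \<Gamma>" by (rule heavy_fin_mom(2)[OF assms])
  finally have "(1 + \<epsilon>) * M powr \<epsilon> * (\<sigma> * mean \<kappa> - M) \<le> 0"
    using f prob_space by (simp add: mean_def M_powr)
  moreover have "0 < (1 + \<epsilon>) * M powr \<epsilon>" using eps M_pos by simp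
  ultimately show ?thesis
    by (smt (verit) mult_pos_pos)
qed

text \<open>
The equality case of Jensen's inequality. It covers the degenerate members of the class, for which
there is no room between the mean and $M$ as duality requires.
\<close>
lemma AE_eq_M_of_mean:
  assumes "\<kappa> \<in> H" "M \<le> \<sigma> * mean \<kappa>" shows "AE x in \<kappa>. \<sigma> * x = M"
proof -
  note f = fin_momD[OF heavy_fin_mom(1)[OF assms(1)]]
  interpret real_distribution \<kappa> by (rule f)
  define g where "g x = pm x - M powr (1 + \<epsilon>) - (1 + \<epsilon>) * M powr \<epsilon> * (\<sigma> * x - M)" for x
  have g0: "0 \<le> g x" for x
    using powr_tangent[of "1 + \<epsilon>" M "\<sigma> * x"] eps M_pos by (simp add: g_def)
  have g1: "0 < g x" if "\<sigma> * x \<noteq> M" for x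
    using powr_tangent_strict[of "1 + \<epsilon>" M "\<sigma> * x"] eps M_pos that by (simp add: g_def)
  have ig: "integrable \<kappa> g" unfolding g_def using f by auto
  have "0 \<le> (1 + \<epsilon>) * M powr \<epsilon> * (\<sigma> * mean \<kappa> - M)" using assms eps by auto
  moreover have "(\<integral>x. g x \<partial>\<kappa>) = (\<integral>x. pm x \<partial>\<kappa>) - \<Gamma> - (1 + \<epsilon>) * M powr \<epsilon> * (\<sigma> * mean \<kappa> - M)"
    unfolding g_def using f prob_space by (simp add: mean_def M_powr)
  moreover have "0 \<le> (\<integral>x. g x \<partial>\<kappa>)" using g0 by (intro integral_nonneg_AE) auto
  ultimately have "(\<integral>x. g x \<partial>\<kappa>) = 0" using heavy_fin_mom(2)[OF assms(1)] by linarith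
  then have "AE x in \<kappa>. g x = 0" using ig g0 by (subst (asm) integral_nonneg_eq_0_iff_AE) auto
  then show ?thesis by eventually_elim (use g1 in force)
qed

lemma KLs_top:
  assumes "M < t" shows "KLs \<eta> t = \<infinity>"
proof -
  have e: "{\<kappa> \<in> H. t \<le> \<sigma> * mean \<kappa>} = {}" using heavy_mean_le assms by force
  show ?thesis unfolding KLs_def e by (simp add: top_ereal_def)
qed

end

section \<open>The rate function of a distribution inside the class\<close>

locale interior_class = moment_class +
  fixes \<nu> :: "real measure"
  assumes nu: "fin_mom \<nu>" and nu_mom: "(\<integral>x. pm x \<partial>\<nu>) < \<Gamma>"
begin

definition mid :: real where "mid = \<sigma> * mean \<nu>"
definition rate :: "real \<Rightarrow> real" where "rate t = real_of_ereal (KLs \<nu> t)"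

sublocale nu: real_distribution \<nu> using fin_momD(1)[OF nu] .

lemma KLs_rate: assumes "t < M" shows "KLs \<nu> t = ereal (rate t)"
proof -
  obtain c where "reach \<nu> t c" using reach_exists[OF nu _ assms] nu_mom by auto
  then have "KLs \<nu> t \<le> ereal c" by (rule KLs_le_of_reach[OF nu])
  moreover have "0 \<le> KLs \<nu> t" by (rule KLs_nonneg[OF nu])
  ultimately show ?thesis unfolding rate_def by (cases "KLs \<nu> t") auto
qed

lemma rate_nonneg: "t < M \<Longrightarrow> 0 \<le> rate t"
  using KLs_nonneg[OF nu, of t] by (simp add: KLs_rate zero_ereal_def)

lemma rate_mono: "t \<le> t' \<Longrightarrow> t' < M \<Longrightarrow> rate t \<le> rate t'"
  using KLs_mono[of t t' \<nu>] by (simp add: KLs_rate)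

lemma reach_rate: "t < M \<Longrightarrow> rate t < c \<Longrightarrow> reach \<nu> t c"
  using reach_of_KLs_less[OF nu, of t c] by (simp add: KLs_rate)

lemma rate_le: "t < M \<Longrightarrow> reach \<nu> t c \<Longrightarrow> rate t \<le> c"
  using KLs_le_of_reach[OF nu, of t c] by (simp add: KLs_rate)

lemma mid_less: "mid < M"
proof -
  have H: "\<nu> \<in> H"
    using fin_momD[OF nu] nu_mom nn_integral_eq_integral[of \<nu> pm]
    by (auto simp: heavy_tailed_def ennreal_leI less_imp_le)
  show ?thesis
  proof (rule ccontr)
    assume "\<not> mid < M"
    then have "AE x in \<nu>. \<sigma> * x = M" using H by (intro AE_eq_M_of_mean) (auto simp: mid_def)
    then have "AE x in \<nu>. pm x = \<Gamma>"
    proof eventually_elim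
      case (elim x)
      then have "\<bar>x\<bar> = M" using sig_sq(4)[of x] M_pos by simp
      then show ?case by (simp add: M_powr)
    qed
    then have "(\<integral>x. pm x \<partial>\<nu>) = (\<integral>x. \<Gamma> \<partial>\<nu>)" by (intro integral_cong_AE) auto
    then show False using nu_mom nu.prob_space by simp
  qed
qed

lemma rate_mid: "rate mid = 0"
proof -
  have "rate mid \<le> 0" unfolding mid_def using mid_less mid_def reach_mean[OF nu] nu_mom by (intro rate_le) auto
  then show ?thesis using rate_nonneg[OF mid_less] by simp
qed

lemma rate_convex: "convex_on {..<M} rate"
proof (rule convex_onI)
  fix s t0 t1 :: real assume s: "0 < s" "s < 1" and t: "t0 \<in> {..<M}" "t1 \<in> {..<M}"
  have lt: "(1 - s) * t0 + s * t1 < M"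
    using t s by (intro convex_bound_lt) auto
  show "rate ((1 - s) *\<^sub>R t0 + s *\<^sub>R t1) \<le> (1 - s) * rate t0 + s * rate t1"
  proof (rule field_le_epsilon)
    fix e :: real assume e: "0 < e"
    have "reach \<nu> ((1 - s) * t0 + s * t1) ((1 - s) * (rate t0 + e) + s * (rate t1 + e))"
      using s t e by (intro reach_convex[OF nu] reach_rate) auto
    then have "rate ((1 - s) * t0 + s * t1) \<le> (1 - s) * (rate t0 + e) + s * (rate t1 + e)"
      using lt by (intro rate_le) auto
    then show "rate ((1 - s) *\<^sub>R t0 + s *\<^sub>R t1) \<le> (1 - s) * rate t0 + s * rate t1 + e" by (simp add: algebra_simps)
  qed
qed (rule convex_real_interval)

lemma rate_cont: "continuous_on {..<M} rate"
  by (rule convex_on_continuous[OF open_lessThan rate_convex])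

lemma rate_ge_dual:
  assumes "t < M" "l \<in> bets t" "0 < s" "\<And>x. s \<le> bet t l x"
  shows "(\<integral>x. ln (bet t l x) \<partial>\<nu>) \<le> rate t"
proof -
  have "0 < bet t l x" for x using assms(3) assms(4)[of x] by linarith
  then have "ereal (\<integral>x. ln (bet t l x) \<partial>\<nu>) \<le> KLs \<nu> t"
    using fin_momD[OF nu] assms by (intro weak_duality[OF nu] integrable_ln_bdd_below[of _ _ s]) auto
  then show ?thesis using assms by (simp add: KLs_rate)
qed

text \<open>
If no bet had positive expected logarithm, the zero bet would be optimal, and by the first-order
condition no bet would have expected payoff above 1. But the bet tangent at a far point has a steep
slope, so that its gain from the distance $t - mid$ outweighs the slack in the moment.
\<close>
lemma rate_pos:
  assumes t: "mid < t" "t < M" shows "0 < rate t"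
proof (rule ccontr)
  assume "\<not> 0 < rate t"
  then have f0: "rate t \<le> 0" by simp
  \<comment> \<open>Chosen so that slope times $t - mid$ equals $\<Gamma> + 1$, more than the slack in the moment can be.\<close>
  define y where "y = ((\<Gamma> + 1) / ((1 + \<epsilon>) * (t - mid))) powr (1 / \<epsilon>)"
  have y: "0 \<le> y" by (simp add: y_def)
  have "y powr \<epsilon> = (\<Gamma> + 1) / ((1 + \<epsilon>) * (t - mid))"
    using eps Gam t by (simp add: y_def powr_powr)
  then have A: "(1 + \<epsilon>) * y powr \<epsilon> * (t - mid) = \<Gamma> + 1" 
  proof -
    have "(1 + \<epsilon>) * (t - mid) \<noteq> 0" using eps t by auto
    then have "((1 + \<epsilon>) * (t - mid)) * y powr \<epsilon> = \<Gamma> + 1"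
      unfolding \<open>y powr \<epsilon> = _\<close> times_divide_eq_right by (rule nonzero_mult_div_cancel_left)
    then show ?thesis by (simp add: mult_ac)
  qed
  obtain b where b: "0 < b" "(b * ((1 + \<epsilon>) * y powr \<epsilon>), b) \<in> bets t" using tangent_in_bets[OF t(2) y] by blast
  define l where "l = (b * ((1 + \<epsilon>) * y powr \<epsilon>), b)"
  have l: "l \<in> bets t" using b by (simp add: l_def)
  have "(\<integral>x. bet t l x / 1 \<partial>\<nu>) \<le> 1"
  proof (rule first_order_optimality(2)[OF fin_momD(2)[OF nu], where s=1 and ?h0.0="\<lambda>_. 1"])
    fix \<theta> :: real assume \<theta>: "0 < \<theta>" "\<theta> < 1"
    have e: "(1 - \<theta>) * 1 + \<theta> * bet t l x = bet t ((1 - \<theta>) *\<^sub>R 0 + \<theta> *\<^sub>R l) x" for x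
      by (simp only: bet_convex bet_0)
    have "(1 - \<theta>) \<le> bet t ((1 - \<theta>) *\<^sub>R 0 + \<theta> *\<^sub>R l) x" for x
      using l \<theta> by (simp add: e[symmetric] bets_def del: scaleR_zero_right)
    then have "(\<integral>x. ln (bet t ((1 - \<theta>) *\<^sub>R 0 + \<theta> *\<^sub>R l) x) \<partial>\<nu>) \<le> rate t"
      using \<theta> l t by (intro rate_ge_dual[where s="1 - \<theta>"] bets_convex) auto
    then show "(\<integral>x. ln ((1 - \<theta>) * 1 + \<theta> * bet t l x) \<partial>\<nu>) \<le> (\<integral>x. ln 1 \<partial>\<nu>)"
      unfolding e using f0 by simp
  qed (use l fin_momD(5)[OF nu] in \<open>auto simp: bets_def\<close>)
  moreover have "(\<integral>x. bet t l x \<partial>\<nu>) = 1 + b * ((1 + \<epsilon>) * y powr \<epsilon> * (t - mid)) + b * ((\<integral>x. pm x \<partial>\<nu>) - \<Gamma>)"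
    unfolding bet_def mid_def mean_def l_def using fin_momD[OF nu] nu.prob_space by (simp add: algebra_simps)
  ultimately have "b * (1 + (\<integral>x. pm x \<partial>\<nu>)) \<le> 0" unfolding A by (simp add: algebra_simps)
  moreover have "0 \<le> (\<integral>x. pm x \<partial>\<nu>)" by (intro integral_nonneg_AE) auto
  ultimately show False using b by (smt (verit) mult_pos_pos)
qed

text \<open>
Convexity together with the value 0 at the mean and positive values beyond it.
\<close>
lemma rate_strict:
  assumes "mid \<le> t1" "t1 < t2" "t2 < M" shows "rate t1 < rate t2"
proof -
  define s where "s = (t1 - mid) / (t2 - mid)"
  have s: "0 \<le> s" "s < 1" using assms by (auto simp: s_def field_simps)
  have t1: "t1 = (1 - s) *\<^sub>R mid + s *\<^sub>R t2"
  proof -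
    have "s * (t2 - mid) = t1 - mid" using assms by (simp add: s_def)
    then show ?thesis by (simp add: algebra_simps)
  qed
  have "rate t1 \<le> (1 - s) * rate mid + s * rate t2"
    unfolding t1 using convex_onD[OF rate_convex, of s mid t2] s assms by auto
  also have "\<dots> = s * rate t2" by (simp add: rate_mid)
  also have "\<dots> < rate t2" using rate_pos[of t2] assms s by simp
  finally show ?thesis .
qed

text \<open>
Tangency at $M$ itself: as $t$ approaches $M$, the stakes on the gap $g$ between the power and its tangent at
$M$ may grow without bound while the payoff remains at least $1/2$. Since $\nu$ is not concentrated
at $M$, the gap exceeds some $r > 0$ with positive probability $q$, so the expected logarithm diverges.
\<close>
lemma rate_unbounded: "\<exists>t. mid < t \<and> t < M \<and> c < rate t"
proof -
  define A where "A = (1 + \<epsilon>) * M powr \<epsilon>"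
  have A: "0 < A" using eps M_pos by (simp add: A_def)
  define g where "g x = pm x - \<Gamma> - A * (\<sigma> * x - M)" for x
  have [measurable]: "g \<in> borel_measurable borel" unfolding g_def[abs_def] by measurable
  have g0: "0 \<le> g x" for x
    using powr_tangent[of "1 + \<epsilon>" M "\<sigma> * x"] eps M_pos by (simp add: g_def A_def M_powr)
  have g1: "0 < g x" if "\<sigma> * x \<noteq> M" for x
    using powr_tangent_strict[of "1 + \<epsilon>" M "\<sigma> * x"] eps M_pos that by (simp add: g_def A_def M_powr)
  obtain n :: nat where n: "\<not> (AE x in \<nu>. g x \<le> 1 / (real n + 1))"
  proof (rule ccontr)
    assume "\<not> thesis"
    then have "\<And>n. AE x in \<nu>. g x \<le> 1 / (real n + 1)" using that by blast
    then have "AE x in \<nu>. \<forall>n. g x \<le> 1 / (real n + 1)" by (subst AE_all_countable) auto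
    then have "AE x in \<nu>. \<sigma> * x = M"
    proof eventually_elim
      case (elim x)
      have "(\<lambda>n. 1 / (real n + 1)) \<longlonglongrightarrow> 0" by real_asymp
      then have "g x \<le> 0" using elim by (intro LIMSEQ_le_const) auto
      then show ?case using g1[of x] by force
    qed
    then have "(\<integral>x. \<sigma> * x \<partial>\<nu>) = (\<integral>x. M \<partial>\<nu>)" by (intro integral_cong_AE) auto
    then show False using mid_less nu.prob_space by (simp add: mid_def mean_def)
  qed
  define r where "r = 1 / (real n + 1)"
  have r: "0 < r" by (simp add: r_def)
  define q where "q = measure \<nu> {x. r < g x}"
  have q: "0 < q"
  proof (rule ccontr)
    assume "\<not> 0 < q"
    then have "q = 0" by (simp add: q_def zero_less_measure_iff)
    then have "emeasure \<nu> {x. r < g x} = 0" by (simp add: q_def nu.emeasure_eq_measure)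
    then have "AE x in \<nu>. g x \<le> r" by (intro AE_I[where N="{x. r < g x}"]) auto
    then show False using n by (simp add: r_def)
  qed
  \<comment> \<open>Large enough for $q \ln (1 + 2 b r)$ to beat $c + \ln 2$; the stake $a$ and the threshold $t$ then follow from tangency at $M$ and payoff $1/2$ at worst.\<close>
  define b where "b = exp ((\<bar>c\<bar> + ln 2 + 1) / q) / (2 * r)"
  have b: "0 < b" using r by (simp add: b_def)
  define a where "a = b * A"
  have a: "0 < a" using b A by (simp add: a_def)
  define t where "t = M - 1 / (2 * a)"
  have t: "t < M" using a by (simp add: t_def)
  have aMt: "a * (M - t) = 1/2" using a by (simp add: t_def)
  have eq: "bet t (a, b) x = 1/2 + b * g x" for x
  proof -
    have "bet t (a, b) x = 1 - a * (M - t) + a * (M - \<sigma> * x) + b * (pm x - \<Gamma>)" by (simp add: bet_def algebra_simps)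
    then show ?thesis unfolding aMt by (simp add: a_def g_def algebra_simps)
  qed
  have ge: "1/2 \<le> bet t (a, b) x" for x unfolding eq using b g0[of x] by simp
  have mem: "(a, b) \<in> bets t"
  proof -
    have "0 \<le> bet t (a, b) x" for x using ge[of x] by linarith
    then show ?thesis using a b by (auto simp: bets_def)
  qed
  have "(\<integral>x. ln (1/2) + ln (1 + 2 * b * r) * indicator {x. r < g x} x \<partial>\<nu>) \<le> (\<integral>x. ln (bet t (a, b) x) \<partial>\<nu>)"
  proof (rule integral_mono)
    show "integrable \<nu> (\<lambda>x. ln (bet t (a, b) x))"
      using fin_momD[OF nu] ge by (intro integrable_ln_bdd_below[of _ _ "1/2"]) auto
    show "integrable \<nu> (\<lambda>x. ln (1/2) + ln (1 + 2 * b * r) * indicator {x. r < g x} x)" 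
      by (auto intro!: Bochner_Integration.integrable_add integrable_mult_right integrable_real_indicator simp: nu.emeasure_eq_measure)
    fix x
    show "ln (1/2) + ln (1 + 2 * b * r) * indicator {x. r < g x} x \<le> ln (bet t (a, b) x)"
    proof (cases "r < g x")
      case True
      have "b * r \<le> b * g x" using True b by simp
      have "ln (1/2) + ln (1 + 2 * b * r) = ln (1/2 * (1 + 2 * b * r))"
        using b r by (subst ln_mult_pos) (auto intro!: add_pos_pos mult_pos_pos)
      also have "\<dots> \<le> ln (bet t (a, b) x)"
        unfolding eq using \<open>b * r \<le> b * g x\<close> b r
        by (subst ln_le_cancel_iff) (auto intro!: mult_pos_pos add_pos_pos add_pos_nonneg g0 simp: algebra_simps less_imp_le)
      finally show ?thesis using True by simp
    next
      case False
      have "ln (1/2) \<le> ln (bet t (a, b) x)" using ge[of x] by (subst ln_le_cancel_iff) auto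
      then show ?thesis using False by simp
    qed
  qed
  also have "\<dots> \<le> rate t" using t mem ge by (intro rate_ge_dual[where s="1/2"]) auto
  also have "(\<integral>x. ln (1/2) + ln (1 + 2 * b * r) * indicator {x. r < g x} x \<partial>\<nu>) = ln (1/2) + ln (1 + 2 * b * r) * q"
    using nu.prob_space by (subst Bochner_Integration.integral_add)
      (auto intro!: integrable_mult_right integrable_real_indicator simp: q_def nu.emeasure_eq_measure)
  finally have lb: "ln (1/2) + ln (1 + 2 * b * r) * q \<le> rate t" .
  have "(\<bar>c\<bar> + ln 2 + 1) / q = ln (2 * b * r)" using r by (simp add: b_def)
  also have "\<dots> \<le> ln (1 + 2 * b * r)" using b r by (subst ln_le_cancel_iff) (auto intro!: add_pos_pos mult_pos_pos)
  finally have "\<bar>c\<bar> + ln 2 + 1 \<le> ln (1 + 2 * b * r) * q" using q by (simp add: field_simps)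
  then have ct: "c < rate t" using lb by (simp add: ln_div)
  define t' where "t' = max t ((mid + M) / 2)"
  have "mid < t'" "t' < M" "t \<le> t'" using t mid_less by (auto simp: t'_def max_def field_simps)
  then show ?thesis using rate_mono[of t t'] ct by (intro exI[of _ t']) auto
qed

lemma root_exists:
  assumes c: "0 < c" obtains t where "mid < t" "t < M" "rate t = c"
proof -
  obtain t2 where t2: "mid < t2" "t2 < M" "c < rate t2" using rate_unbounded by blast
  have "continuous_on {mid..t2} rate" using rate_cont by (rule continuous_on_subset) (use t2 in auto)
  then obtain t where t: "mid \<le> t" "t \<le> t2" "rate t = c"
    using IVT'[of rate mid c t2] t2 c rate_mid by auto
  then have "mid \<noteq> t" using rate_mid c by auto
  then show ?thesis using that[of t] t t2 by auto
qed

lemma KLs_ge_M: assumes "M \<le> t" shows "KLs \<nu> t = \<infinity>"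
proof (rule ereal_top)
  fix c
  obtain t' where "mid < t'" "t' < M" "c < rate t'" using rate_unbounded by blast
  then show "ereal c \<le> KLs \<nu> t" using KLs_mono[of t' t \<nu>] assms KLs_rate[of t'] by (metis ereal_less_eq(3) less_imp_le order_trans)
qed

lemma root_unique:
  assumes c: "0 < c" shows "\<exists>!t. mid < t \<and> KLs \<nu> t = ereal c"
proof -
  obtain t where t: "mid < t" "t < M" "rate t = c" using root_exists[OF c] .
  show ?thesis
  proof (rule ex1I[of _ t])
    show "mid < t \<and> KLs \<nu> t = ereal c" using t KLs_rate by simp
    fix t' assume t': "mid < t' \<and> KLs \<nu> t' = ereal c"
    then have lt: "t' < M" using KLs_ge_M[of t'] by (cases "t' < M") auto
    then have "rate t' = c" using t' KLs_rate by simp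
    then show "t' = t" using rate_strict[of t t'] rate_strict[of t' t] t t' lt by force
  qed
qed

end

section \<open>Weak law of large numbers and empirical measures\<close>

definition avg :: "(real \<Rightarrow> real) \<Rightarrow> nat \<Rightarrow> (nat \<Rightarrow> real) \<Rightarrow> real" where
  "avg g n x = (\<Sum>i<n. g (x i)) / real n"

abbreviation iid :: "real measure \<Rightarrow> (nat \<Rightarrow> real) measure" where
  "iid \<nu> \<equiv> \<Pi>\<^sub>M i\<in>(UNIV :: nat set). \<nu>"

lemma tendsto_0_le_epsilon:
  fixes a :: "'a \<Rightarrow> real"
  assumes "\<And>d. 0 < d \<Longrightarrow> \<forall>\<^sub>F n in F. a n \<le> d" "\<And>n. 0 \<le> a n"
  shows "(a \<longlongrightarrow> 0) F"
proof (rule tendstoI)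
  fix e :: real assume "0 < e"
  then have "\<forall>\<^sub>F n in F. a n \<le> e / 2" by (intro assms) auto
  then show "\<forall>\<^sub>F n in F. dist (a n) 0 < e"
    by eventually_elim (use assms(2) \<open>0 < e\<close> in \<open>auto simp: dist_real_def\<close>)
qed

lemma prob_space_iid: "prob_space \<nu> \<Longrightarrow> prob_space (iid \<nu>)"
  by (rule prob_space_PiM)

lemma measurable_avg[measurable]:
  assumes "sets \<nu> = sets borel" "g \<in> borel_measurable borel"
  shows "avg g n \<in> borel_measurable (iid \<nu>)"
proof -
  have [measurable_cong]: "sets \<nu> = sets borel" by fact
  note assms(2)[measurable]
  show ?thesis unfolding avg_def[abs_def] by measurable
qed

lemma indep_vars_iid:
  assumes N: "real_distribution \<nu>" and g[measurable]: "g \<in> borel_measurable borel"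
  shows "prob_space.indep_vars (iid \<nu>) (\<lambda>_. borel) (\<lambda>i x. g (x i)) I"
proof -
  interpret real_distribution \<nu> by fact
  interpret P: prob_space "iid \<nu>" by (rule prob_space_iid) (rule prob_space_axioms)
  have c: "distr (iid \<nu>) \<nu> (\<lambda>x. x i) = \<nu>" for i
    by (rule distr_PiM_component) (auto intro: prob_space_axioms)
  have "P.indep_vars (\<lambda>_. \<nu>) (\<lambda>i x. x i) UNIV"
    by (subst P.indep_vars_iff_distr_eq_PiM) (simp_all add: c restrict_UNIV)
  then have "P.indep_vars (\<lambda>_. \<nu>) (\<lambda>i x. x i) I" by (rule P.indep_vars_subset) auto
  then show ?thesis by (rule P.indep_vars_compose2) auto
qed

lemma weak_law_bounded:
  assumes N: "real_distribution \<nu>" and g[measurable]: "g \<in> borel_measurable borel"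
    and b: "\<And>x. \<bar>g x\<bar> \<le> K" and e: "0 < e"
  shows "(\<lambda>n. measure (iid \<nu>) {x\<in>space (iid \<nu>). e \<le> \<bar>avg g n x - (\<integral>x. g x \<partial>\<nu>)\<bar>}) \<longlonglongrightarrow> 0"
proof -
  interpret real_distribution \<nu> by fact
  interpret P: prob_space "iid \<nu>" by (rule prob_space_iid) (rule prob_space_axioms)
  have K: "0 \<le> K" using b[of 0] by linarith
  have c: "distr (iid \<nu>) \<nu> (\<lambda>x. x i) = \<nu>" for i
    by (rule distr_PiM_component) (auto intro: prob_space_axioms)
  have d: "distr (iid \<nu>) borel (\<lambda>x. g (x i)) = distr \<nu> borel g" for i
    by (subst (2) c[symmetric, of i]) (auto simp: distr_distr comp_def)
  have ex: "P.expectation (\<lambda>x. g (x i)) = (\<integral>x. g x \<partial>\<nu>)" for i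
    by (subst (2) c[symmetric, of i]) (auto simp: integral_distr)
  have h1: "\<forall>\<^sub>F n in sequentially. measure (iid \<nu>) {x\<in>space (iid \<nu>). e \<le> \<bar>avg g n x - (\<integral>x. g x \<partial>\<nu>)\<bar>}
      \<le> 2 * exp (-2 * real n * e\<^sup>2 / (2 * K + 2)\<^sup>2)"
    using eventually_gt_at_top[of 0]
  proof eventually_elim
    case (elim n)
    interpret X: Hoeffding_ineq_iid "iid \<nu>" "{..<n}" "\<lambda>i x. g (x i)" "\<lambda>x. g (x 0)" "- K - 1" "K + 1" "\<integral>x. g x \<partial>\<nu>"
    proof unfold_locales
      show "P.indep_vars (\<lambda>_. borel) (\<lambda>i x. g (x i)) {..<n}" by (rule indep_vars_iid[OF N g])
      show "AE x in iid \<nu>. g (x 0) \<in> {- K - 1..K + 1}" using b by (intro AE_I2) (smt (verit) atLeastAtMost_iff)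
    qed (auto simp: d ex)
    show ?case
      using X.Hoeffding_ineq_abs_ge'[of e] e K elim by (auto simp: avg_def)
  qed
  have h2: "(\<lambda>n. 2 * exp (-2 * real n * e\<^sup>2 / (2 * K + 2)\<^sup>2)) \<longlonglongrightarrow> 0"
  proof -
    define q where "q = 2 * e\<^sup>2 / (2 * K + 2)\<^sup>2"
    have q: "0 < q" using e K by (auto simp: q_def)
    have "(\<lambda>n. 2 * exp (- (real n * q))) \<longlonglongrightarrow> 0" using q by real_asymp
    then show ?thesis by (simp add: q_def mult_ac)
  qed
  show ?thesis
    by (rule tendsto_sandwich[OF _ h1 tendsto_const h2]) auto
qed

text \<open>
Only a first moment is available, so $g$ is truncated. The truncated part obeys Hoeffding's inequality
and the remainder is small in mean, uniformly in $n$, by Markov's inequality.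
\<close>
lemma weak_law:
  assumes N: "real_distribution \<nu>" and g[measurable]: "g \<in> borel_measurable borel"
    and i: "integrable \<nu> g" and e: "0 < e"
  shows "(\<lambda>n. measure (iid \<nu>) {x\<in>space (iid \<nu>). e \<le> \<bar>avg g n x - (\<integral>x. g x \<partial>\<nu>)\<bar>}) \<longlonglongrightarrow> 0"
proof -
  interpret real_distribution \<nu> by fact
  interpret P: prob_space "iid \<nu>" by (rule prob_space_iid) (rule prob_space_axioms)
  have c: "distr (iid \<nu>) \<nu> (\<lambda>x. x i) = \<nu>" for i
    by (rule distr_PiM_component) (auto intro: prob_space_axioms)
  define lo where "lo k x = (if \<bar>g x\<bar> \<le> real k then g x else 0)" for k :: nat and x
  have [measurable]: "lo k \<in> borel_measurable borel" for k unfolding lo_def[abs_def] by measurable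
  have ilo: "integrable \<nu> (lo k)" for k
    by (rule Bochner_Integration.integrable_bound[OF i]) (auto simp: lo_def)
  have "(\<lambda>k. \<integral>x. \<bar>g x - lo k x\<bar> \<partial>\<nu>) \<longlonglongrightarrow> (\<integral>x. 0 \<partial>\<nu>)"
  proof (rule integral_dominated_convergence[where w="\<lambda>x. \<bar>g x\<bar>"])
    show "AE x in \<nu>. (\<lambda>k. \<bar>g x - lo k x\<bar>) \<longlonglongrightarrow> 0"
    proof (intro AE_I2 tendsto_eventually)
      fix x
      obtain k0 :: nat where "\<bar>g x\<bar> \<le> real k0" using real_arch_simple by blast
      then show "\<forall>\<^sub>F k in sequentially. \<bar>g x - lo k x\<bar> = 0"
        by (intro eventually_sequentiallyI[of k0]) (auto simp: lo_def)
    qed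
  qed (use i in \<open>auto simp: lo_def\<close>)
  then have tail: "(\<lambda>k. \<integral>x. \<bar>g x - lo k x\<bar> \<partial>\<nu>) \<longlonglongrightarrow> 0" by simp
  show ?thesis
  proof (rule tendsto_0_le_epsilon)
    fix d :: real assume d: "0 < d"
    \<comment> \<open>The tail mass must make both the bias at most $e/3$ and the Markov bound at most $d/2$.\<close>
    define \<rho> where "\<rho> = min (e / 3) (e * d / 6)"
    have \<rho>: "0 < \<rho>" using e d by (simp add: \<rho>_def)
    obtain k where k: "(\<integral>x. \<bar>g x - lo k x\<bar> \<partial>\<nu>) < \<rho>"
      using order_tendstoD(2)[OF tail \<rho>] by (auto simp: eventually_sequentially)
    define h where "h x = \<bar>g x - lo k x\<bar>" for x
    have [measurable]: "h \<in> borel_measurable borel" unfolding h_def[abs_def] by measurable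
    have ih: "integrable \<nu> h" unfolding h_def using i ilo by auto
    have h0: "0 \<le> avg h n x" for n x by (auto simp: avg_def h_def intro!: sum_nonneg divide_nonneg_nonneg)
    have markov: "measure (iid \<nu>) {x\<in>space (iid \<nu>). e / 3 \<le> avg h n x} \<le> d / 2" if n: "0 < n" for n
    proof -
      have ihi: "integrable (iid \<nu>) (\<lambda>x. h (x i))" for i
        using ih by (subst (asm) c[symmetric, of i]) (auto simp: integrable_distr_eq)
      have eh: "(\<integral>x. h (x i) \<partial>iid \<nu>) = (\<integral>x. h x \<partial>\<nu>)" for i
        by (subst (2) c[symmetric, of i]) (auto simp: integral_distr)
      have ia: "integrable (iid \<nu>) (avg h n)" unfolding avg_def using ihi by auto
      have ea: "(\<integral>x. avg h n x \<partial>iid \<nu>) = (\<integral>x. h x \<partial>\<nu>)" unfolding avg_def using ihi n by (simp add: eh)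
      have "measure (iid \<nu>) {x\<in>space (iid \<nu>). e / 3 \<le> avg h n x} \<le> (\<integral>x. avg h n x \<partial>iid \<nu>) / (e / 3)"
        using e ia h0 by (intro integral_Markov_inequality_measure[where A="{}"]) auto
      also have "\<dots> \<le> \<rho> / (e / 3)" unfolding ea using k e by (intro divide_right_mono) (auto simp: h_def[abs_def])
      also have "\<dots> \<le> (e * d / 6) / (e / 3)" using e by (intro divide_right_mono) (auto simp: \<rho>_def)
      also have "\<dots> = d / 2" using e by simp
      finally show ?thesis .
    qed
    have "(\<lambda>n. measure (iid \<nu>) {x\<in>space (iid \<nu>). e / 3 \<le> \<bar>avg (lo k) n x - (\<integral>x. lo k x \<partial>\<nu>)\<bar>}) \<longlonglongrightarrow> 0"
      using e by (intro weak_law_bounded[OF N, where K="real k"]) (auto simp: lo_def)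
    then have "\<forall>\<^sub>F n in sequentially. measure (iid \<nu>) {x\<in>space (iid \<nu>). e / 3 \<le> \<bar>avg (lo k) n x - (\<integral>x. lo k x \<partial>\<nu>)\<bar>} < d / 2"
      using d by (intro order_tendstoD) auto
    then show "\<forall>\<^sub>F n in sequentially. measure (iid \<nu>) {x\<in>space (iid \<nu>). e \<le> \<bar>avg g n x - (\<integral>x. g x \<partial>\<nu>)\<bar>} \<le> d"
      using eventually_gt_at_top[of 0]
    proof eventually_elim
      case (elim n)
      let ?A = "{x\<in>space (iid \<nu>). e / 3 \<le> \<bar>avg (lo k) n x - (\<integral>x. lo k x \<partial>\<nu>)\<bar>}"
      let ?B = "{x\<in>space (iid \<nu>). e / 3 \<le> avg h n x}"
      have bias: "\<bar>(\<integral>x. g x \<partial>\<nu>) - (\<integral>x. lo k x \<partial>\<nu>)\<bar> < e / 3"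
      proof -
        have "(\<integral>x. g x \<partial>\<nu>) - (\<integral>x. lo k x \<partial>\<nu>) = (\<integral>x. g x - lo k x \<partial>\<nu>)" using i ilo by simp
        also have "\<bar>\<dots>\<bar> \<le> (\<integral>x. h x \<partial>\<nu>)" unfolding h_def by (rule integral_abs_bound)
        also have "\<dots> < e / 3" using k by (simp add: h_def[abs_def] \<rho>_def)
        finally show ?thesis .
      qed
      have "x \<in> ?A \<union> ?B" if x: "x \<in> space (iid \<nu>)" "e \<le> \<bar>avg g n x - (\<integral>x. g x \<partial>\<nu>)\<bar>" for x
      proof -
        have "avg g n x - avg (lo k) n x = (\<Sum>i<n. g (x i) - lo k (x i)) / n"
          by (simp add: avg_def sum_subtractf diff_divide_distrib)
        also have "\<bar>\<dots>\<bar> \<le> avg h n x"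
          unfolding avg_def h_def by (simp add: divide_right_mono sum_abs)
        finally have "e / 3 \<le> \<bar>avg (lo k) n x - (\<integral>x. lo k x \<partial>\<nu>)\<bar> \<or> e / 3 \<le> avg h n x"
          using x(2) bias by arith
        then show ?thesis using x(1) by blast
      qed
      then have "measure (iid \<nu>) {x\<in>space (iid \<nu>). e \<le> \<bar>avg g n x - (\<integral>x. g x \<partial>\<nu>)\<bar>} \<le> measure (iid \<nu>) (?A \<union> ?B)"
        by (intro P.finite_measure_mono) auto
      also have "\<dots> \<le> measure (iid \<nu>) ?A + measure (iid \<nu>) ?B"
        by (intro measure_Un_le) auto
      also have "\<dots> \<le> d / 2 + d / 2" using elim markov by (intro add_mono) auto
      finally show ?case by simp
    qed
  qed auto
qed

lemma weak_law_upper: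
  assumes N: "real_distribution \<nu>" and g[measurable]: "g \<in> borel_measurable borel"
    and i: "integrable \<nu> g" and b: "(\<integral>x. g x \<partial>\<nu>) < b"
  shows "(\<lambda>n. measure (iid \<nu>) {x\<in>space (iid \<nu>). b \<le> avg g n x}) \<longlonglongrightarrow> 0"
proof (rule tendsto_sandwich[OF _ _ tendsto_const])
  interpret real_distribution \<nu> by fact
  interpret P: prob_space "iid \<nu>" by (rule prob_space_iid) (rule prob_space_axioms)
  show "(\<lambda>n. measure (iid \<nu>) {x\<in>space (iid \<nu>). b - (\<integral>x. g x \<partial>\<nu>) \<le> \<bar>avg g n x - (\<integral>x. g x \<partial>\<nu>)\<bar>}) \<longlonglongrightarrow> 0"
    using b by (intro weak_law[OF N g i]) auto
  show "\<forall>\<^sub>F n in sequentially. measure (iid \<nu>) {x\<in>space (iid \<nu>). b \<le> avg g n x}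
     \<le> measure (iid \<nu>) {x\<in>space (iid \<nu>). b - (\<integral>x. g x \<partial>\<nu>) \<le> \<bar>avg g n x - (\<integral>x. g x \<partial>\<nu>)\<bar>}"
    by (intro always_eventually allI P.finite_measure_mono) auto
qed auto

lemma empirical_integral:
  assumes n: "0 < n" and g[measurable]: "g \<in> borel_measurable borel"
  shows "integrable (empirical n x) g" "(\<integral>z. g z \<partial>empirical n x) = avg g n x"
proof -
  have [measurable]: "x \<in> uniform_count_measure {..<n} \<rightarrow>\<^sub>M borel"
    by (auto simp: measurable_def space_uniform_count_measure sets_uniform_count_measure)
  show "integrable (empirical n x) g"
    unfolding empirical_def by (simp add: integrable_distr_eq uniform_count_measure_def integrable_point_measure_finite)
  show "(\<integral>z. g z \<partial>empirical n x) = avg g n x"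
    unfolding empirical_def avg_def by (simp add: integral_distr integral_uniform_count_measure)
qed

lemma real_distribution_empirical:
  assumes n: "0 < n" shows "real_distribution (empirical n x)"
proof -
  interpret prob_space "uniform_count_measure {..<n}"
    using n by (intro prob_space_uniform_count_measure) auto
  have "x \<in> uniform_count_measure {..<n} \<rightarrow>\<^sub>M borel"
    by (auto simp: measurable_def space_uniform_count_measure sets_uniform_count_measure)
  then show ?thesis
    unfolding empirical_def
    by (intro real_distribution.intro prob_space_distr real_distribution_axioms.intro) auto
qed

lemma mean_empirical: "0 < n \<Longrightarrow> mean (empirical n x) = avg (\<lambda>z. z) n x"
  unfolding mean_def by (intro empirical_integral) auto

lemma AE_empirical:
  assumes n: "0 < n" and [measurable]: "Measurable.pred borel Q"
  shows "(AE z in empirical n x. Q z) \<longleftrightarrow> (\<forall>i<n. Q (x i))"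
proof -
  have [measurable]: "x \<in> uniform_count_measure {..<n} \<rightarrow>\<^sub>M borel"
    by (auto simp: measurable_def space_uniform_count_measure sets_uniform_count_measure)
  show ?thesis unfolding empirical_def
    apply (subst AE_distr_iff)
    subgoal by measurable
    subgoal by measurable
    subgoal unfolding uniform_count_measure_def AE_point_measure using n by auto
    done
qed

lemma empirical_restrict: "empirical n (restrict x {..<n}) = empirical n x"
  unfolding empirical_def by (intro distr_cong) (auto simp: space_uniform_count_measure)

lemma nn_integral_prod_iid:
  assumes N: "real_distribution \<nu>" and g[measurable]: "g \<in> borel_measurable borel"
  shows "(\<integral>\<^sup>+x. (\<Prod>i<n. g (x i)) \<partial>iid \<nu>) = (\<integral>\<^sup>+z. g z \<partial>\<nu>) ^ n"
proof -
  interpret real_distribution \<nu> by fact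
  interpret PP: product_prob_space "\<lambda>_. \<nu>" "UNIV :: nat set" by standard
  have "(\<integral>\<^sup>+x. (\<Prod>i<n. g (x i)) \<partial>iid \<nu>) = (\<integral>\<^sup>+x. (\<Prod>i<n. g (restrict x {..<n} i)) \<partial>iid \<nu>)"
    by (intro nn_integral_cong prod.cong) auto
  also have "\<dots> = (\<integral>\<^sup>+x. (\<Prod>i<n. g (x i)) \<partial>distr (iid \<nu>) (\<Pi>\<^sub>M i\<in>{..<n}. \<nu>) (\<lambda>x. restrict x {..<n}))"
    by (subst nn_integral_distr) auto
  also have "\<dots> = (\<integral>\<^sup>+x. (\<Prod>i<n. g (x i)) \<partial>(\<Pi>\<^sub>M i\<in>{..<n}. \<nu>))"
    by (subst PP.distr_PiM_restrict_finite) auto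
  also have "\<dots> = (\<Prod>i<n. \<integral>\<^sup>+z. g z \<partial>\<nu>)"
    by (intro PP.product_nn_integral_prod) auto
  finally show ?thesis by simp
qed

text \<open>
The index is independent of the events, so a bound that holds for each fixed index survives
averaging over the index.
\<close>
lemma random_index_bound:
  fixes T :: "'b \<Rightarrow> nat" and B :: "nat \<Rightarrow> 'a set"
  assumes "prob_space P" "prob_space Q" and B[measurable]: "\<And>n. B n \<in> sets P"
    and T[measurable]: "T \<in> Q \<rightarrow>\<^sub>M count_space UNIV"
    and le: "\<And>n. n \<in> N \<Longrightarrow> measure P (B n) \<le> d" and d: "0 \<le> d"
  shows "{\<omega>\<in>space (P \<Otimes>\<^sub>M Q). T (snd \<omega>) \<in> N \<and> fst \<omega> \<in> B (T (snd \<omega>))} \<in> sets (P \<Otimes>\<^sub>M Q)"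
    "measure (P \<Otimes>\<^sub>M Q) {\<omega>\<in>space (P \<Otimes>\<^sub>M Q). T (snd \<omega>) \<in> N \<and> fst \<omega> \<in> B (T (snd \<omega>))} \<le> d"
proof -
  interpret P: prob_space P by fact
  interpret Q: prob_space Q by fact
  interpret PQ: pair_prob_space P Q by standard
  let ?A = "{\<omega>\<in>space (P \<Otimes>\<^sub>M Q). T (snd \<omega>) \<in> N \<and> fst \<omega> \<in> B (T (snd \<omega>))}"
  have "?A = (\<Union>n\<in>N. {\<omega>\<in>space (P \<Otimes>\<^sub>M Q). T (snd \<omega>) = n \<and> fst \<omega> \<in> B n})" by auto
  also have "\<dots> \<in> sets (P \<Otimes>\<^sub>M Q)" by (intro sets.countable_UN'') auto
  finally show A[measurable]: "?A \<in> sets (P \<Otimes>\<^sub>M Q)" .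
  have "emeasure (P \<Otimes>\<^sub>M Q) ?A = (\<integral>\<^sup>+y. emeasure P ((\<lambda>x. (x, y)) -` ?A) \<partial>Q)"
    by (rule PQ.emeasure_pair_measure_alt2) (rule A)
  also have "\<dots> \<le> (\<integral>\<^sup>+y. ennreal d \<partial>Q)"
  proof (intro nn_integral_mono)
    fix y assume y: "y \<in> space Q"
    have "(\<lambda>x. (x, y)) -` ?A = (if T y \<in> N then B (T y) else {})"
      using y sets.sets_into_space[OF B] by (auto simp: space_pair_measure)
    then show "emeasure P ((\<lambda>x. (x, y)) -` ?A) \<le> ennreal d"
      using le d by (auto simp: P.emeasure_eq_measure intro!: ennreal_leI)
  qed
  also have "\<dots> = ennreal d" by (simp add: Q.emeasure_space_1)
  finally show "measure (P \<Otimes>\<^sub>M Q) ?A \<le> d"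
    using d by (simp add: PQ.emeasure_eq_measure)
qed

section \<open>Coverage at a fixed sample size\<close>

context moment_class begin

lemma fin_mom_empirical: "0 < n \<Longrightarrow> fin_mom (empirical n x)"
  unfolding fin_mom_def by (intro conjI real_distribution_empirical empirical_integral) auto

text \<open>
Both halves of the duality, for an empirical measure, whose expected logarithm is that of the capital
after betting on each sample. This form involves no infimum over measures and is
used for coverage as well as for measurability.
\<close>
lemma KLs_empirical_le_iff:
  assumes n: "0 < n" and t: "t < M"
  shows "KLs (empirical n x) t \<le> ereal c \<longleftrightarrow> (\<forall>l\<in>bets t. (\<Prod>i<n. bet t l (x i)) \<le> exp (n * c))"
proof -
  have avg_ln: "exp (n * (\<integral>z. ln (bet t l z) \<partial>empirical n x)) = (\<Prod>i<n. bet t l (x i))"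
    if "\<And>i. i < n \<Longrightarrow> 0 < bet t l (x i)" for l
  proof -
    have "n * (\<integral>z. ln (bet t l z) \<partial>empirical n x) = (\<Sum>i<n. ln (bet t l (x i)))"
      using n by (simp add: empirical_integral avg_def)
    also have "exp \<dots> = (\<Prod>i<n. exp (ln (bet t l (x i))))" by (rule exp_sum) simp
    also have "\<dots> = (\<Prod>i<n. bet t l (x i))" using that by (intro prod.cong) auto
    finally show ?thesis .
  qed
  show ?thesis
  proof (intro iffI ballI)
    fix l assume le: "KLs (empirical n x) t \<le> ereal c" and l: "l \<in> bets t"
    show "(\<Prod>i<n. bet t l (x i)) \<le> exp (n * c)"
    proof (cases "\<exists>i<n. bet t l (x i) = 0")
      case True
      then have z: "(\<Prod>i<n. bet t l (x i)) = 0" by (intro prod_zero) auto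
      show ?thesis unfolding z by simp
    next
      case False
      then have pos: "0 < bet t l (x i)" if "i < n" for i using l that by (auto simp: bets_def less_le)
      have "ereal (\<integral>z. ln (bet t l z) \<partial>empirical n x) \<le> KLs (empirical n x) t"
        using n pos by (intro weak_duality[OF fin_mom_empirical[OF n] l]) (auto simp: AE_empirical empirical_integral)
      with le have "(\<integral>z. ln (bet t l z) \<partial>empirical n x) \<le> c" by (metis ereal_less_eq(3) order_trans)
      then have "exp (n * (\<integral>z. ln (bet t l z) \<partial>empirical n x)) \<le> exp (n * c)" by (simp add: mult_left_mono)
      then show ?thesis using avg_ln[OF pos] by simp
    qed
  next
    assume d: "\<forall>l\<in>bets t. (\<Prod>i<n. bet t l (x i)) \<le> exp (n * c)"
    show "KLs (empirical n x) t \<le> ereal c"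
    proof (rule ccontr)
      assume "\<not> ?thesis"
      then obtain c' where c': "ereal c < ereal c'" "ereal c' < KLs (empirical n x) t"
        using ereal_dense2[of "ereal c" "KLs (empirical n x) t"] by (auto simp: not_le)
      have "reach (empirical n x) t c'"
      proof (rule strong_duality[OF fin_mom_empirical[OF n] t, of c])
        fix l s assume l: "l \<in> bets t" "0 < s" "\<And>z. s \<le> bet t l z"
        have "0 < bet t l z" for z using l(2) l(3)[of z] by linarith
        then have "exp (n * (\<integral>z. ln (bet t l z) \<partial>empirical n x)) \<le> exp (n * c)"
          using d l by (subst avg_ln) auto
        then show "(\<integral>z. ln (bet t l z) \<partial>empirical n x) \<le> c" using n by simp
      qed (use c' in auto)
      then have "KLs (empirical n x) t \<le> ereal c'" by (rule KLs_le_of_reach[OF fin_mom_empirical[OF n]])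
      then show False using c' by simp
    qed
  qed
qed

text \<open>
By duality and continuity of the capital in the stakes, a countable dense set of
bets decides the inequality.
\<close>
lemma KLs_empirical_measurable:
  assumes n: "0 < n" and t: "t < M"
  shows "Measurable.pred (\<Pi>\<^sub>M i\<in>{..<n}. (borel :: real measure)) (\<lambda>x. KLs (empirical n x) t \<le> ereal c)"
proof -
  obtain T where T: "countable T" "T \<subseteq> bets t" "bets t \<subseteq> closure T" by (rule separable)
  have eq: "(\<forall>l\<in>bets t. (\<Prod>i<n. bet t l (x i)) \<le> K) \<longleftrightarrow> (\<forall>l\<in>T. (\<Prod>i<n. bet t l (x i)) \<le> K)" for x K
  proof
    assume a: "\<forall>l\<in>T. (\<Prod>i<n. bet t l (x i)) \<le> K"
    have "closed {l. (\<Prod>i<n. bet t l (x i)) \<le> K}"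
      by (intro closed_Collect_le continuous_on_prod bet_continuous continuous_on_const)
    moreover have "T \<subseteq> {l. (\<Prod>i<n. bet t l (x i)) \<le> K}" using a by auto
    ultimately have "closure T \<subseteq> {l. (\<Prod>i<n. bet t l (x i)) \<le> K}" by (simp add: closure_minimal)
    then show "\<forall>l\<in>bets t. (\<Prod>i<n. bet t l (x i)) \<le> K" using T by auto
  qed (use T in auto)
  have "Measurable.pred (\<Pi>\<^sub>M i\<in>{..<n}. (borel :: real measure)) (\<lambda>x. \<forall>l\<in>T. (\<Prod>i<n. bet t l (x i)) \<le> exp (n * c))"
    unfolding pred_def using T(1) by (intro sets.sets_Collect_countable_All') measurable
  then show ?thesis unfolding KLs_empirical_le_iff[OF n t] eq .
qed

lemma bets_area:
  assumes t: "t < M"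
  obtains a where "0 < a" "emeasure lborel (bets t) = ennreal a" "bets t \<in> sets borel"
proof -
  have comp: "compact (bets t)" by (rule bets_compact[OF t])
  \<comment> \<open>A rectangle with moment stake dominating the mean stake, small enough for the constant 1 to absorb all losses.\<close>
  define b where "b = 1 / (\<bar>t\<bar> + 1 + 2 * \<Gamma>)"
  have b: "0 < b" "b * (\<bar>t\<bar> + 1 + 2 * \<Gamma>) = 1" using Gam by (auto simp: b_def add_pos_nonneg add_nonneg_eq_0_iff)
  have sub: "{0..b} \<times> {b..2 * b} \<subseteq> bets t"
  proof
    fix l assume l: "l \<in> {0..b} \<times> {b..2 * b}"
    have "0 \<le> bet t l x" for x
    proof -
      have "- (\<bar>t\<bar> + (1 + pm x)) \<le> t - \<sigma> * x" using abs_le_pm[of x] sig by auto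
      then have "fst l * (- (\<bar>t\<bar> + (1 + pm x))) \<le> fst l * (t - \<sigma> * x)"
        using l by (intro mult_left_mono) auto
      moreover have "fst l * (\<bar>t\<bar> + 1) \<le> b * (\<bar>t\<bar> + 1)" using l by (intro mult_right_mono) auto
      moreover have "fst l * pm x \<le> snd l * pm x" using l by (intro mult_right_mono) auto
      moreover have "snd l * \<Gamma> \<le> 2 * b * \<Gamma>" using l Gam by (intro mult_right_mono) auto
      ultimately have "1 - b * (\<bar>t\<bar> + 1) - 2 * b * \<Gamma> \<le> bet t l x" by (simp add: bet_def algebra_simps)
      then show ?thesis using b(2) by (simp add: algebra_simps)
    qed
    then show "l \<in> bets t" using l b by (auto simp: bets_def)
  qed
  have bo: "bets t \<in> sets borel" using comp by (intro borel_closed compact_imp_closed)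
  have "emeasure lborel ({0..b} \<times> {b..2 * b}) = ennreal b * ennreal b"
    using b by (simp add: lborel_prod[symmetric] lborel.emeasure_pair_measure_Times)
  then have "ennreal b * ennreal b \<le> emeasure lborel (bets t)"
    using emeasure_mono[OF sub, of lborel] bo by simp
  moreover have "0 < ennreal b * ennreal b" using b by (simp add: ennreal_mult[symmetric])
  ultimately have pos: "0 < emeasure lborel (bets t)" by order
  have fin_mom: "emeasure lborel (bets t) < \<infinity>" using comp by (rule emeasure_compact_finite)
  have "emeasure lborel (bets t) = ennreal (measure lborel (bets t))"
    using fin_mom by (intro emeasure_eq_ennreal_measure) auto
  with pos that bo show ?thesis by (metis ennreal_less_zero_iff)
qed

text \<open>
The uniform average of the capital over all bets loses only a polynomial factor against any fixed
bet $m$: shrinking the set of bets towards $m$ by the factor $c = 1/(1+n)$ leaves the fraction $c^2$ of its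
area, and on it each payoff is at least $(1-c)$ times that of $m$, with $(1-c)^n \ge 1/e$.
\<close>
lemma mixture_lower_bound:
  assumes t: "t < M" and m: "m \<in> bets t" and a: "emeasure lborel (bets t) = ennreal a" "0 \<le> a" and n: "0 < n"
    and bo[measurable]: "bets t \<in> sets borel"
  shows "ennreal ((\<Prod>i<n. bet t m (x i)) * a / (exp 1 * (1 + real n)\<^sup>2))
    \<le> (\<integral>\<^sup>+l. indicator (bets t) l * (\<Prod>i<n. ennreal (bet t l (x i))) \<partial>lborel)"
proof -
  define c where "c = 1 / (1 + real n)"
  have c: "0 < c" "c < 1" using n by (auto simp: c_def)
  have hm[measurable]: "(\<lambda>l. bet t l z) \<in> borel_measurable borel" for z
    using bet_continuous by (rule borel_measurable_continuous_onI)
  let ?F = "\<lambda>l. indicator (bets t) l * (\<Prod>i<n. ennreal (bet t l (x i)))"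
  have nn: "0 \<le> bet t m z" for z using m by (auto simp: bets_def)
  have "(\<integral>\<^sup>+l. ?F l \<partial>lborel) = (\<integral>\<^sup>+l. ?F l \<partial>density (distr lborel borel (\<lambda>l. (1 - c) *\<^sub>R m + c *\<^sub>R l)) (\<lambda>_. \<bar>c\<bar> ^ DIM(real \<times> real)))"
    using c by (subst lborel_affine[of c "(1 - c) *\<^sub>R m"]) auto
  also have "\<dots> = (\<integral>\<^sup>+l. ennreal (c\<^sup>2) * ?F ((1 - c) *\<^sub>R m + c *\<^sub>R l) \<partial>lborel)"
    using c by (subst nn_integral_density) (auto simp: nn_integral_distr ennreal_power power2_eq_square)
  also have "\<dots> \<ge> (\<integral>\<^sup>+l. ennreal (c\<^sup>2) * ennreal (exp (-1) * (\<Prod>i<n. bet t m (x i))) * indicator (bets t) l \<partial>lborel)"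
  proof (intro nn_integral_mono)
    fix l :: "real \<times> real"
    show "ennreal (c\<^sup>2) * ennreal (exp (-1) * (\<Prod>i<n. bet t m (x i))) * indicator (bets t) l
       \<le> ennreal (c\<^sup>2) * ?F ((1 - c) *\<^sub>R m + c *\<^sub>R l)"
    proof (cases "l \<in> bets t")
      case True
      have mem: "(1 - c) *\<^sub>R m + c *\<^sub>R l \<in> bets t" using bets_convex[OF m True, of c] c by simp
      have "exp (-1) \<le> (1 - c) ^ n"
      proof -
        have "1 / (1 - c) = 1 + 1 / real n" using n by (simp add: c_def field_simps)
        also have "\<dots> \<le> exp (1 / real n)" by (rule exp_ge_add_one_self)
        finally have "(1 / (1 - c)) ^ n \<le> exp (1 / real n) ^ n" using c by (intro power_mono) auto
        also have "\<dots> = exp 1" using n by (simp add: exp_of_nat_mult[symmetric])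
        finally show ?thesis using c by (simp add: power_divide exp_minus field_simps)
      qed
      then have "exp (-1) * (\<Prod>i<n. bet t m (x i)) \<le> (1 - c) ^ n * (\<Prod>i<n. bet t m (x i))"
        using nn by (intro mult_right_mono prod_nonneg) auto
      also have "\<dots> = (\<Prod>i<n. (1 - c) * bet t m (x i))" by (simp add: prod.distrib)
      also have "\<dots> \<le> (\<Prod>i<n. bet t ((1 - c) *\<^sub>R m + c *\<^sub>R l) (x i))"
        using c nn True by (intro prod_mono) (auto simp: bet_convex bets_def)
      finally have "ennreal (exp (-1) * (\<Prod>i<n. bet t m (x i))) \<le> (\<Prod>i<n. ennreal (bet t ((1 - c) *\<^sub>R m + c *\<^sub>R l) (x i)))"
        using mem by (subst prod_ennreal) (auto simp: bets_def intro: ennreal_leI)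
      then show ?thesis using True mem by (auto intro!: mult_left_mono)
    qed auto
  qed
  also have "(\<integral>\<^sup>+l. ennreal (c\<^sup>2) * ennreal (exp (-1) * (\<Prod>i<n. bet t m (x i))) * indicator (bets t) l \<partial>lborel)
      = ennreal (c\<^sup>2) * ennreal (exp (-1) * (\<Prod>i<n. bet t m (x i))) * ennreal a"
    by (subst nn_integral_cmult_indicator) (auto simp: a)
  also have "\<dots> = ennreal ((\<Prod>i<n. bet t m (x i)) * a / (exp 1 * (1 + real n)\<^sup>2))"
    using c a nn by (simp add: ennreal_mult[symmetric] prod_nonneg exp_minus c_def power_divide field_simps)
  finally show ?thesis .
qed

text \<open>
By Fubini the expectation of the mixture is the average of the expected capitals, each of which is
at most 1 by independence.
\<close>
lemma mixture_mean_le: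
  assumes k: "\<kappa> \<in> H" and t: "t \<le> \<sigma> * mean \<kappa>" and bo[measurable]: "bets t \<in> sets borel"
  shows "(\<lambda>x. \<integral>\<^sup>+l. indicator (bets t) l * (\<Prod>i<n. ennreal (bet t l (x i))) \<partial>lborel) \<in> borel_measurable (iid \<kappa>)"
    "(\<integral>\<^sup>+x. (\<integral>\<^sup>+l. indicator (bets t) l * (\<Prod>i<n. ennreal (bet t l (x i))) \<partial>lborel) \<partial>iid \<kappa>) \<le> emeasure lborel (bets t)"
proof -
  note f = fin_momD[OF heavy_fin_mom(1)[OF k]]
  interpret real_distribution \<kappa> by (rule f)
  interpret P: prob_space "iid \<kappa>" by (rule prob_space_iid) (rule prob_space_axioms)
  interpret PL: pair_sigma_finite "iid \<kappa>" "lborel :: (real \<times> real) measure" by standard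
  have [measurable]: "(\<lambda>z. fst z i) \<in> borel_measurable (iid \<kappa> \<Otimes>\<^sub>M lborel)" for i :: nat
    by (rule measurable_compose[OF measurable_fst]) measurable
  have [measurable]: "(\<lambda>z. fst (snd z)) \<in> borel_measurable (iid \<kappa> \<Otimes>\<^sub>M lborel)"
    "(\<lambda>z. snd (snd z)) \<in> borel_measurable (iid \<kappa> \<Otimes>\<^sub>M lborel)"
    by (rule measurable_compose[OF measurable_snd], simp, intro borel_measurable_continuous_onI continuous_intros)+
  have [measurable]: "(\<lambda>(x, l). indicator (bets t) l * (\<Prod>i<n. ennreal (bet t l (x i)))) \<in> borel_measurable (iid \<kappa> \<Otimes>\<^sub>M lborel)"
    unfolding bet_def case_prod_beta by measurable
  show "(\<lambda>x. \<integral>\<^sup>+l. indicator (bets t) l * (\<Prod>i<n. ennreal (bet t l (x i))) \<partial>lborel) \<in> borel_measurable (iid \<kappa>)"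
    by measurable
  have "(\<integral>\<^sup>+x. (\<integral>\<^sup>+l. indicator (bets t) l * (\<Prod>i<n. ennreal (bet t l (x i))) \<partial>lborel) \<partial>iid \<kappa>)
      = (\<integral>\<^sup>+l. (\<integral>\<^sup>+x. indicator (bets t) l * (\<Prod>i<n. ennreal (bet t l (x i))) \<partial>iid \<kappa>) \<partial>lborel)"
    by (rule PL.Fubini'[symmetric]) measurable
  also have "\<dots> \<le> (\<integral>\<^sup>+l. indicator (bets t) l \<partial>lborel)"
  proof (intro nn_integral_mono)
    fix l :: "real \<times> real"
    show "(\<integral>\<^sup>+x. indicator (bets t) l * (\<Prod>i<n. ennreal (bet t l (x i))) \<partial>iid \<kappa>) \<le> indicator (bets t) l"
    proof (cases "l \<in> bets t")
      case True
      have "(\<integral>\<^sup>+x. ennreal (bet t l x) \<partial>\<kappa>) \<le> 1" by (rule bet_mean_le_1[OF k t True])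
      then have "(\<integral>\<^sup>+x. ennreal (bet t l x) \<partial>\<kappa>) ^ n \<le> 1" by (metis power_mono power_one zero_le)
      then show ?thesis using True nn_integral_prod_iid[OF f(1), of "\<lambda>z. ennreal (bet t l z)" n] by simp
    qed auto
  qed
  also have "\<dots> = emeasure lborel (bets t)" by simp
  finally show "(\<integral>\<^sup>+x. (\<integral>\<^sup>+l. indicator (bets t) l * (\<Prod>i<n. ennreal (bet t l (x i))) \<partial>lborel) \<partial>iid \<kappa>) \<le> emeasure lborel (bets t)" .
qed

text \<open>
Mixing over all bets and Markov's inequality. The constants of $\beta$ match the loss of the mixture:
$e^{\beta(n,\delta)} = e (1+n)^2 \cdot 2/\delta$.
\<close>
lemma deviation_bound:
  assumes k: "\<kappa> \<in> H" and n: "0 < n" and d: "0 < \<delta>"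
  obtains B where "B \<in> sets (iid \<kappa>)" "measure (iid \<kappa>) B \<le> \<delta> / 2"
    "\<And>x. x \<in> space (iid \<kappa>) \<Longrightarrow> x \<notin> B \<Longrightarrow> \<sigma> * mean (empirical n x) < \<sigma> * mean \<kappa> \<Longrightarrow>
       ereal n * KLs (empirical n x) (\<sigma> * mean \<kappa>) \<le> ereal (beta n \<delta>)"
proof -
  note f = fin_momD[OF heavy_fin_mom(1)[OF k]]
  interpret real_distribution \<kappa> by (rule f)
  interpret P: prob_space "iid \<kappa>" by (rule prob_space_iid) (rule prob_space_axioms)
  define t where "t = \<sigma> * mean \<kappa>"
  show ?thesis
  proof (cases "t < M")
    \<comment> \<open>At the edge of the class all samples coincide with the mean.\<close>
    case False
    have c: "AE x in iid \<kappa>. \<sigma> * x i = M" for i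
      using False k by (intro AE_PiM_component AE_eq_M_of_mean) (auto simp: t_def prob_space_axioms)
    then have "AE x in iid \<kappa>. \<forall>i. \<sigma> * x i = M" by (subst AE_all_countable) auto
    then obtain B where B: "B \<in> null_sets (iid \<kappa>)" "{x\<in>space (iid \<kappa>). \<not> (\<forall>i. \<sigma> * x i = M)} \<subseteq> B"
      by (auto elim!: AE_E intro: null_setsI)
    show ?thesis
    proof (rule that[of B])
      show "B \<in> sets (iid \<kappa>)" using B by auto
      show "measure (iid \<kappa>) B \<le> \<delta> / 2" using B d by (auto simp: null_sets_def measure_def)
      fix x assume x: "x \<in> space (iid \<kappa>)" "x \<notin> B" and l: "\<sigma> * mean (empirical n x) < \<sigma> * mean \<kappa>"
      then have e: "\<sigma> * x i = M" for i using B(2) by blast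
      have "\<sigma> * mean (empirical n x) = (\<Sum>i<n. \<sigma> * x i) / n"
        using n by (simp add: mean_empirical avg_def sum_distrib_left)
      also have "\<dots> = M" using n by (simp add: e)
      finally show "ereal n * KLs (empirical n x) (\<sigma> * mean \<kappa>) \<le> ereal (beta n \<delta>)"
        using l heavy_mean_le[OF k] by simp
    qed
  next
    case True
    obtain a where a: "0 < a" "emeasure lborel (bets t) = ennreal a" and bo: "bets t \<in> sets borel"
      using bets_area[OF True] by blast
    define W where "W x = (\<integral>\<^sup>+l. indicator (bets t) l * (\<Prod>i<n. ennreal (bet t l (x i))) \<partial>lborel)" for x
    note mm = mixture_mean_le[OF k, of t n, folded W_def, OF _ bo]
    have Wm[measurable]: "W \<in> borel_measurable (iid \<kappa>)" using mm(1) by (simp add: t_def W_def[abs_def])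
    have WE: "(\<integral>\<^sup>+x. W x \<partial>iid \<kappa>) \<le> ennreal a" using mm(2) a by (simp add: t_def)
    let ?B = "{x\<in>space (iid \<kappa>). 1 \<le> ennreal (\<delta> / (2 * a)) * W x}"
    show ?thesis
    proof (rule that[of ?B])
      show B: "?B \<in> sets (iid \<kappa>)" by measurable
      have "emeasure (iid \<kappa>) ?B \<le> ennreal (\<delta> / (2 * a)) * (\<integral>\<^sup>+x. W x * indicator (space (iid \<kappa>)) x \<partial>iid \<kappa>)"
        by (rule nn_integral_Markov_inequality) auto
      also have "(\<integral>\<^sup>+x. W x * indicator (space (iid \<kappa>)) x \<partial>iid \<kappa>) = (\<integral>\<^sup>+x. W x \<partial>iid \<kappa>)"
        by (intro nn_integral_cong) auto
      also have "ennreal (\<delta> / (2 * a)) * \<dots> \<le> ennreal (\<delta> / (2 * a)) * ennreal a"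
        using WE by (intro mult_left_mono) auto
      also have "\<dots> = ennreal (\<delta> / 2)" using a d by (simp add: ennreal_mult[symmetric])
      finally show "measure (iid \<kappa>) ?B \<le> \<delta> / 2" using d by (simp add: P.emeasure_eq_measure)
      fix x assume x: "x \<in> space (iid \<kappa>)" "x \<notin> ?B"
      show "ereal n * KLs (empirical n x) (\<sigma> * mean \<kappa>) \<le> ereal (beta n \<delta>)"
      proof (rule ccontr)
        assume neg: "\<not> ?thesis"
        have "\<not> KLs (empirical n x) t \<le> ereal (beta n \<delta> / n)"
        proof
          assume "KLs (empirical n x) t \<le> ereal (beta n \<delta> / n)"
          then have "ereal n * KLs (empirical n x) t \<le> ereal n * ereal (beta n \<delta> / n)"
            by (intro ereal_mult_left_mono) auto
          then show False using neg n by (simp add: t_def)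
        qed
        then obtain m where m: "m \<in> bets t" "exp (n * (beta n \<delta> / n)) < (\<Prod>i<n. bet t m (x i))"
          unfolding KLs_empirical_le_iff[OF n True] by (auto simp: not_le)
        have "exp (n * (beta n \<delta> / n)) = exp 1 * (2 * (1 + real n)\<^sup>2 / \<delta>)"
          using n d by (simp add: beta_def exp_add)
        with m have big: "exp 1 * (2 * (1 + real n)\<^sup>2 / \<delta>) < (\<Prod>i<n. bet t m (x i))" by simp
        have "2 / \<delta> * a = (exp 1 * (2 * (1 + real n)\<^sup>2 / \<delta>)) * a / (exp 1 * (1 + real n)\<^sup>2)"
          by (simp add: field_simps)
        also have "\<dots> \<le> (\<Prod>i<n. bet t m (x i)) * a / (exp 1 * (1 + real n)\<^sup>2)"
          using big a by (intro divide_right_mono mult_right_mono) auto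
        finally have "ennreal (2 / \<delta> * a) \<le> W x"
          using mixture_lower_bound[OF True m(1) a(2) _ n bo, of x] a
          by (auto simp: W_def intro: order_trans[OF ennreal_leI])
        then have "ennreal (\<delta> / (2 * a)) * ennreal (2 / \<delta> * a) \<le> ennreal (\<delta> / (2 * a)) * W x"
          by (intro mult_left_mono) auto
        also have "ennreal (\<delta> / (2 * a)) * ennreal (2 / \<delta> * a) = 1"
          using a d by (simp add: ennreal_mult[symmetric])
        finally show False using x by simp
      qed
    qed
  qed
qed

section \<open>One endpoint of the interval\<close>

text \<open>
After at least one sample this is the right endpoint of the policy for $\sigma = 1$, and the negative of its left
endpoint for $\sigma = -1$.
\<close>
definition endpt :: "real \<Rightarrow> nat \<Rightarrow> (nat \<Rightarrow> real) \<Rightarrow> ereal" where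
  "endpt \<delta> n x = (let m = \<sigma> * mean (empirical n x);
     S = {t. m < t \<and> ereal n * KLs (empirical n x) t \<le> ereal (beta n \<delta>)}
     in if S = {} then ereal m else Sup (ereal ` S))"

lemma endpt_Sup:
  assumes "{t. \<sigma> * mean (empirical n x) < t \<and> ereal n * KLs (empirical n x) t \<le> ereal (beta n \<delta>)} \<noteq> {}"
  shows "endpt \<delta> n x = Sup (ereal ` {t. \<sigma> * mean (empirical n x) < t \<and> ereal n * KLs (empirical n x) t \<le> ereal (beta n \<delta>)})"
  unfolding endpt_def Let_def using assms by (rule if_not_P)

lemma endpt_ge_mean: "ereal (\<sigma> * mean (empirical n x)) \<le> endpt \<delta> n x"
proof -
  define m where "m = \<sigma> * mean (empirical n x)"
  define S where "S = {t. m < t \<and> ereal n * KLs (empirical n x) t \<le> ereal (beta n \<delta>)}"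
  have "endpt \<delta> n x = (if S = {} then ereal m else Sup (ereal ` S))" unfolding endpt_def S_def m_def Let_def ..
  moreover have "ereal m \<le> Sup (ereal ` S)" if ne: "S \<noteq> {}"
  proof -
    obtain s where "s \<in> S" using ne by blast
    then show ?thesis by (intro SUP_upper2[of s]) (auto simp: S_def)
  qed
  ultimately show ?thesis by (simp add: m_def)
qed

lemma endpt_ge:
  assumes "\<sigma> * mean (empirical n x) < t" "ereal n * KLs (empirical n x) t \<le> ereal (beta n \<delta>)"
  shows "ereal t \<le> endpt \<delta> n x"
proof -
  let ?S = "{t. \<sigma> * mean (empirical n x) < t \<and> ereal n * KLs (empirical n x) t \<le> ereal (beta n \<delta>)}"
  have S: "t \<in> ?S" using assms by simp
  then have "?S \<noteq> {}" by blast
  then have "endpt \<delta> n x = Sup (ereal ` ?S)" by (rule endpt_Sup)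
  with S show ?thesis by (simp only:) (rule SUP_upper)
qed

lemma endpt_le:
  assumes "\<sigma> * mean (empirical n x) \<le> t" "ereal (beta n \<delta>) < ereal n * KLs (empirical n x) t"
  shows "endpt \<delta> n x \<le> ereal t"
proof -
  have "s \<le> t" if s: "ereal n * KLs (empirical n x) s \<le> ereal (beta n \<delta>)" for s
  proof (rule ccontr)
    assume "\<not> s \<le> t"
    then have "ereal n * KLs (empirical n x) t \<le> ereal n * KLs (empirical n x) s"
      by (intro ereal_mult_left_mono KLs_mono) auto
    then show False using s assms(2) by (meson leD order_trans)
  qed
  then show ?thesis unfolding endpt_def Let_def using assms by (auto intro!: SUP_least)
qed

lemma accepted_le_M:
  assumes "0 < n" "ereal n * KLs (empirical n x) s \<le> ereal c" shows "s \<le> M"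
  using assms KLs_top[of s "empirical n x"] by (cases "s \<le> M") auto

lemma endpt_le_M:
  assumes "0 < n" "\<sigma> * mean (empirical n x) \<le> M"
  shows "endpt \<delta> n x \<le> ereal M"
  unfolding endpt_def Let_def using assms accepted_le_M by (auto intro!: SUP_least)

lemma endpt_restrict: "endpt \<delta> n (restrict x {..<n}) = endpt \<delta> n x"
  unfolding endpt_def empirical_restrict ..

text \<open>
The accepted thresholds form an interval starting at the mean, so that rational thresholds below $M$ detect
whether the endpoint exceeds a given level.
\<close>
lemma endpt_measurable:
  assumes n: "0 < n"
  shows "endpt \<delta> n \<in> borel_measurable (\<Pi>\<^sub>M i\<in>{..<n}. (borel :: real measure))"
proof (rule borel_measurableI_greater)
  fix a :: ereal
  let ?N = "\<Pi>\<^sub>M i\<in>{..<n}. (borel :: real measure)"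
  have gle: "ereal n * KLs (empirical n x) q \<le> ereal (beta n \<delta>) \<longleftrightarrow> KLs (empirical n x) q \<le> ereal (beta n \<delta> / n)" for x q
    using n by (cases "KLs (empirical n x) q") (auto simp: field_simps)
  have iff: "a < endpt \<delta> n x \<longleftrightarrow> a < ereal (\<sigma> * avg (\<lambda>z. z) n x) \<or>
     (\<exists>q\<in>\<rat> \<inter> {..<M}. a < ereal q \<and> \<sigma> * avg (\<lambda>z. z) n x < q \<and> KLs (empirical n x) q \<le> ereal (beta n \<delta> / n))" for x
    unfolding mean_empirical[OF n, symmetric] gle[symmetric]
  proof (intro iffI)
    assume l: "a < endpt \<delta> n x"
    show "a < ereal (\<sigma> * mean (empirical n x)) \<or> (\<exists>q\<in>\<rat> \<inter> {..<M}. a < ereal q \<and> \<sigma> * mean (empirical n x) < q \<and> ereal n * KLs (empirical n x) q \<le> ereal (beta n \<delta>))"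
    proof (cases "a < ereal (\<sigma> * mean (empirical n x))")
      case False
      then have "{t. \<sigma> * mean (empirical n x) < t \<and> ereal n * KLs (empirical n x) t \<le> ereal (beta n \<delta>)} \<noteq> {}"
        using l by (auto simp: endpt_def Let_def split: if_splits)
      then obtain s where s: "\<sigma> * mean (empirical n x) < s" "ereal n * KLs (empirical n x) s \<le> ereal (beta n \<delta>)" "a < ereal s"
        using l endpt_Sup[of n x \<delta>] by (auto simp: less_SUP_iff)
      obtain a' where a': "a = ereal a'" using False s by (cases a) auto
      obtain q where q: "q \<in> \<rat>" "a' < q" "q < s" using Rats_dense_in_real[of a' s] s(3) a' by auto
      have "ereal n * KLs (empirical n x) q \<le> ereal n * KLs (empirical n x) s"
        using q by (intro ereal_mult_left_mono KLs_mono) auto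
      then have "ereal n * KLs (empirical n x) q \<le> ereal (beta n \<delta>)" using s(2) by (rule order_trans)
      moreover have "q < M" using accepted_le_M[OF n s(2)] q by simp
      ultimately show ?thesis using q a' False by (intro disjI2 bexI[of _ q]) auto
    qed auto
  next
    assume "a < ereal (\<sigma> * mean (empirical n x)) \<or> (\<exists>q\<in>\<rat> \<inter> {..<M}. a < ereal q \<and> \<sigma> * mean (empirical n x) < q \<and> ereal n * KLs (empirical n x) q \<le> ereal (beta n \<delta>))"
    then show "a < endpt \<delta> n x"
      using endpt_ge_mean[of n x \<delta>] endpt_ge[of n x _ \<delta>] by (auto intro: less_le_trans)
  qed
  have [measurable]: "avg (\<lambda>z. z) n \<in> borel_measurable ?N" unfolding avg_def[abs_def] by measurable
  have "Measurable.pred ?N (\<lambda>x. \<exists>q\<in>\<rat> \<inter> {..<M}. a < ereal q \<and> \<sigma> * avg (\<lambda>z. z) n x < q \<and> KLs (empirical n x) q \<le> ereal (beta n \<delta> / n))"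
  proof (unfold pred_def, rule sets.sets_Collect_countable_Ex', fold pred_def)
    fix q assume "q \<in> \<rat> \<inter> {..<M}"
    then have [measurable]: "Measurable.pred ?N (\<lambda>x. KLs (empirical n x) q \<le> ereal (beta n \<delta> / n))"
      by (intro KLs_empirical_measurable[OF n]) auto
    show "Measurable.pred ?N (\<lambda>x. a < ereal q \<and> \<sigma> * avg (\<lambda>z. z) n x < q \<and> KLs (empirical n x) q \<le> ereal (beta n \<delta> / n))"
      by measurable
  qed (auto intro: countable_rat countable_Int1)
  then have "Measurable.pred ?N (\<lambda>x. a < endpt \<delta> n x)" unfolding iff by measurable
  then show "{x\<in>space ?N. a < endpt \<delta> n x} \<in> sets ?N" by (simp add: pred_def)
qed

end

section \<open>Events of vanishing probability\<close>

text \<open>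
Vanishing probability in the sense of outer measure, so that the notion applies directly to events defined
through infima over measures.
\<close>
definition rare :: "'i filter \<Rightarrow> 'a measure \<Rightarrow> ('i \<Rightarrow> 'a set) \<Rightarrow> bool" where
  "rare F P A \<longleftrightarrow> (\<exists>A'. (\<forall>i. A' i \<in> sets P) \<and> (\<forall>\<^sub>F i in F. A i \<inter> space P \<subseteq> A' i) \<and>
     ((\<lambda>i. measure P (A' i)) \<longlongrightarrow> 0) F)"

lemma rareI: "(\<And>i. A i \<in> sets P) \<Longrightarrow> ((\<lambda>i. measure P (A i)) \<longlongrightarrow> 0) F \<Longrightarrow> rare F P A"
  unfolding rare_def by (intro exI[of _ A]) auto

lemma rare_mono:
  assumes "rare F P A" "\<forall>\<^sub>F i in F. B i \<inter> space P \<subseteq> A i"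
  shows "rare F P B"
proof -
  obtain A' where A': "\<forall>i. A' i \<in> sets P" "\<forall>\<^sub>F i in F. A i \<inter> space P \<subseteq> A' i"
    "((\<lambda>i. measure P (A' i)) \<longlongrightarrow> 0) F" using assms(1) unfolding rare_def by blast
  have "\<forall>\<^sub>F i in F. B i \<inter> space P \<subseteq> A' i"
    using A'(2) assms(2) by eventually_elim blast
  with A' show ?thesis unfolding rare_def by blast
qed

lemma rare_Un:
  assumes "rare F P A" "rare F P B" shows "rare F P (\<lambda>i. A i \<union> B i)"
proof -
  obtain A' where A': "\<And>i. A' i \<in> sets P" "\<forall>\<^sub>F i in F. A i \<inter> space P \<subseteq> A' i"
    "((\<lambda>i. measure P (A' i)) \<longlongrightarrow> 0) F" using assms(1) unfolding rare_def by blast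
  obtain B' where B': "\<And>i. B' i \<in> sets P" "\<forall>\<^sub>F i in F. B i \<inter> space P \<subseteq> B' i"
    "((\<lambda>i. measure P (B' i)) \<longlongrightarrow> 0) F" using assms(2) unfolding rare_def by blast
  have "((\<lambda>i. measure P (A' i) + measure P (B' i)) \<longlongrightarrow> 0) F" using tendsto_add[OF A'(3) B'(3)] by simp
  then have "((\<lambda>i. measure P (A' i \<union> B' i)) \<longlongrightarrow> 0) F"
    by (rule tendsto_sandwich[OF _ _ tendsto_const, rotated 2]) (use A' B' in \<open>auto intro!: always_eventually measure_Un_le\<close>)
  moreover have "\<forall>\<^sub>F i in F. (A i \<union> B i) \<inter> space P \<subseteq> A' i \<union> B' i"
    using A'(2) B'(2) by eventually_elim blast
  ultimately show ?thesis unfolding rare_def using A' B' by (intro exI[of _ "\<lambda>i. A' i \<union> B' i"]) auto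
qed

lemma rare_compose:
  assumes "rare F P A" "filterlim m F F'" shows "rare F' P (\<lambda>i. A (m i))"
proof -
  obtain A' where A': "\<And>i. A' i \<in> sets P" "\<forall>\<^sub>F i in F. A i \<inter> space P \<subseteq> A' i"
    "((\<lambda>i. measure P (A' i)) \<longlongrightarrow> 0) F" using assms(1) unfolding rare_def by blast
  then show ?thesis unfolding rare_def
    using eventually_compose_filterlim[OF A'(2) assms(2)] filterlim_compose[OF A'(3) assms(2)]
    by (intro exI[of _ "\<lambda>i. A' (m i)"]) auto
qed

lemma rare_null:
  assumes "AE x in P. Q x" shows "rare F P (\<lambda>_. {x. \<not> Q x})"
proof -
  obtain N where "N \<in> sets P" "emeasure P N = 0" "{x\<in>space P. \<not> Q x} \<subseteq> N" using assms by (auto elim!: AE_E)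
  then show ?thesis unfolding rare_def by (intro exI[of _ "\<lambda>_. N"]) (auto simp: measure_def intro!: always_eventually)
qed

lemma rare_imp_tendsto:
  assumes "finite_measure P" "rare F P A"
  shows "((\<lambda>i. measure P {x\<in>space P. x \<in> A i}) \<longlongrightarrow> 0) F"
proof -
  interpret finite_measure P by fact
  obtain A' where A': "\<And>i. A' i \<in> sets P" "\<forall>\<^sub>F i in F. A i \<inter> space P \<subseteq> A' i"
    "((\<lambda>i. measure P (A' i)) \<longlongrightarrow> 0) F" using assms(2) unfolding rare_def by blast
  have "\<forall>\<^sub>F i in F. measure P {x\<in>space P. x \<in> A i} \<le> measure P (A' i)"
    using A'(2) by eventually_elim (intro finite_measure_mono A', auto)
  then show ?thesis by (rule tendsto_sandwich[OF _ _ tendsto_const A'(3), rotated]) auto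
qed

lemma rare_snd:
  assumes "prob_space P" "prob_space Q" "rare F Q A"
  shows "rare F (P \<Otimes>\<^sub>M Q) (\<lambda>i. {\<omega>. snd \<omega> \<in> A i})"
proof -
  interpret P: prob_space P by fact
  interpret Q: prob_space Q by fact
  interpret PQ: pair_prob_space P Q by standard
  obtain A' where A': "\<And>i. A' i \<in> sets Q" "\<forall>\<^sub>F i in F. A i \<inter> space Q \<subseteq> A' i"
    "((\<lambda>i. measure Q (A' i)) \<longlongrightarrow> 0) F" using assms(3) unfolding rare_def by blast
  have m: "measure (P \<Otimes>\<^sub>M Q) (space P \<times> A' i) = measure Q (A' i)" for i
    using A'(1)[of i] by (simp add: measure_def Q.emeasure_pair_measure_Times P.emeasure_space_1)
  show ?thesis
    unfolding rare_def
  proof (intro exI[of _ "\<lambda>i. space P \<times> A' i"] conjI allI)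
    show "space P \<times> A' i \<in> sets (P \<Otimes>\<^sub>M Q)" for i using A' by auto
    show "\<forall>\<^sub>F i in F. {\<omega>. snd \<omega> \<in> A i} \<inter> space (P \<Otimes>\<^sub>M Q) \<subseteq> space P \<times> A' i"
      using A'(2) by eventually_elim (auto simp: space_pair_measure)
    show "((\<lambda>i. measure (P \<Otimes>\<^sub>M Q) (space P \<times> A' i)) \<longlongrightarrow> 0) F" unfolding m by (rule A')
  qed
qed

text \<open>
A statement along $n \to \infty$ may be evaluated at an independent random index that tends to infinity in
probability.
\<close>
lemma rare_random_index:
  fixes T :: "'i \<Rightarrow> 'b \<Rightarrow> nat"
  assumes P: "prob_space P" and Q: "prob_space Q" and B: "rare sequentially P B"
    and T[measurable]: "\<And>i. T i \<in> Q \<rightarrow>\<^sub>M count_space UNIV"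
    and large: "\<And>N. rare F Q (\<lambda>i. {c. T i c < N})"
  shows "rare F (P \<Otimes>\<^sub>M Q) (\<lambda>i. {\<omega>. fst \<omega> \<in> B (T i (snd \<omega>))})"
proof -
  interpret P: prob_space P by fact
  interpret Q: prob_space Q by fact
  interpret PQ: pair_prob_space P Q by standard
  obtain B' N0 where B': "\<And>i. B' i \<in> sets P" "\<And>n. N0 \<le> n \<Longrightarrow> B n \<inter> space P \<subseteq> B' n"
    "(\<lambda>i. measure P (B' i)) \<longlonglongrightarrow> 0" using B unfolding rare_def eventually_sequentially by blast
  define E where "E N i = {\<omega>\<in>space (P \<Otimes>\<^sub>M Q). T i (snd \<omega>) \<in> {N..} \<and> fst \<omega> \<in> B' (T i (snd \<omega>))}" for N i
  define S where "S N i = {\<omega>\<in>space (P \<Otimes>\<^sub>M Q). T i (snd \<omega>) < N}" for N i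
  have Em: "E N i \<in> sets (P \<Otimes>\<^sub>M Q)" for N i
    unfolding E_def by (rule random_index_bound(1)[OF P Q B'(1) T, where d=1]) auto
  have Sm: "S N i \<in> sets (P \<Otimes>\<^sub>M Q)" for N i unfolding S_def by measurable
  have S0: "((\<lambda>i. measure (P \<Otimes>\<^sub>M Q) (S N i)) \<longlongrightarrow> 0) F" for N
    using rare_imp_tendsto[OF PQ.finite_measure_axioms rare_snd[OF P Q large[of N]]] by (simp add: S_def)
  have "((\<lambda>i. measure (P \<Otimes>\<^sub>M Q) (E N0 i \<union> S N0 i)) \<longlongrightarrow> 0) F"
  proof (rule tendsto_0_le_epsilon)
    fix d :: real assume d: "0 < d"
    obtain N1 where N1: "\<And>n. N1 \<le> n \<Longrightarrow> measure P (B' n) < d / 2"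
      using order_tendstoD(2)[OF B'(3), of "d / 2"] d by (auto simp: eventually_sequentially)
    define N where "N = max N0 N1"
    have "\<forall>\<^sub>F i in F. measure (P \<Otimes>\<^sub>M Q) (S N i) < d / 2" using order_tendstoD(2)[OF S0, of "d / 2" N] d by auto
    then show "\<forall>\<^sub>F i in F. measure (P \<Otimes>\<^sub>M Q) (E N0 i \<union> S N0 i) \<le> d"
    proof eventually_elim
      case (elim i)
      have "measure (P \<Otimes>\<^sub>M Q) (E N0 i \<union> S N0 i) \<le> measure (P \<Otimes>\<^sub>M Q) (E N i \<union> S N i)"
        using Em Sm by (intro PQ.finite_measure_mono) (auto simp: E_def S_def N_def)
      also have "\<dots> \<le> measure (P \<Otimes>\<^sub>M Q) (E N i) + measure (P \<Otimes>\<^sub>M Q) (S N i)"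
        using Em Sm by (intro measure_Un_le)
      also have "measure (P \<Otimes>\<^sub>M Q) (E N i) \<le> d / 2"
        unfolding E_def using N1 d
        by (intro random_index_bound(2)[OF P Q B'(1) T]) (auto simp: N_def less_imp_le)
      finally show ?case using elim by linarith
    qed
  qed auto
  then show ?thesis unfolding rare_def
  proof (intro exI[of _ "\<lambda>i. E N0 i \<union> S N0 i"] conjI allI always_eventually)
    show "E N0 i \<union> S N0 i \<in> sets (P \<Otimes>\<^sub>M Q)" for i using Em Sm by auto
    show "{\<omega>. fst \<omega> \<in> B (T i (snd \<omega>))} \<inter> space (P \<Otimes>\<^sub>M Q) \<subseteq> E N0 i \<union> S N0 i" for i
    proof
      fix \<omega> assume \<omega>: "\<omega> \<in> {\<omega>. fst \<omega> \<in> B (T i (snd \<omega>))} \<inter> space (P \<Otimes>\<^sub>M Q)"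
      then have "fst \<omega> \<in> B' (T i (snd \<omega>))" if "N0 \<le> T i (snd \<omega>)"
        using B'(2)[OF that] by (auto simp: space_pair_measure)
      then show "\<omega> \<in> E N0 i \<union> S N0 i" using \<omega> by (cases "N0 \<le> T i (snd \<omega>)") (auto simp: E_def S_def)
    qed
  qed
qed

lemma rare_avg:
  assumes "real_distribution \<nu>" "g \<in> borel_measurable borel" "integrable \<nu> g" "(\<integral>x. g x \<partial>\<nu>) < b"
  shows "rare sequentially (iid \<nu>) (\<lambda>n. {x. b \<le> avg g n x})"
proof -
  interpret real_distribution \<nu> by fact
  have [measurable]: "avg g n \<in> borel_measurable (iid \<nu>)" for n using assms by (intro measurable_avg) auto
  have "rare sequentially (iid \<nu>) (\<lambda>n. {x\<in>space (iid \<nu>). b \<le> avg g n x})"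
    by (intro rareI weak_law_upper assms) measurable
  then show ?thesis by (rule rare_mono) (intro always_eventually, auto)
qed

lemmas avg_empirical = empirical_integral(2)

lemma avg_linear:
  "avg (\<lambda>z. g z + h z) n x = avg g n x + avg h n x"
  "avg (\<lambda>z. g z - h z) n x = avg g n x - avg h n x"
  "avg (\<lambda>z. - g z) n x = - avg g n x"
  "avg (\<lambda>z. c * g z) n x = c * avg g n x"
  "avg (\<lambda>z. g z * c) n x = avg g n x * c"
proof -
  show "avg (\<lambda>z. g z + h z) n x = avg g n x + avg h n x" by (simp add: avg_def sum.distrib add_divide_distrib)
  show "avg (\<lambda>z. g z - h z) n x = avg g n x - avg h n x" by (simp add: avg_def sum_subtractf diff_divide_distrib)
  show "avg (\<lambda>z. - g z) n x = - avg g n x" by (simp add: avg_def sum_negf)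
  show "avg (\<lambda>z. c * g z) n x = c * avg g n x" by (simp add: avg_def sum_distrib_left)
  show "avg (\<lambda>z. g z * c) n x = avg g n x * c" by (simp add: avg_def sum_distrib_right)
qed

section \<open>Consistency of the empirical divergence\<close>

context interior_class begin

lemma mean_empirical_rare:
  shows "mid < t \<Longrightarrow> rare sequentially (iid \<nu>) (\<lambda>n. {x. t \<le> \<sigma> * mean (empirical n x)})"
    and "t < mid \<Longrightarrow> rare sequentially (iid \<nu>) (\<lambda>n. {x. \<sigma> * mean (empirical n x) \<le> t})"
proof -
  note fi = fin_momD[OF nu]
  assume "mid < t"
  then have "rare sequentially (iid \<nu>) (\<lambda>n. {x. t \<le> avg (\<lambda>z. \<sigma> * z) n x})"
    apply (intro rare_avg[OF fi(1)])
    subgoal by measurable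
    subgoal by (intro integrable_mult_right fi(4))
    subgoal unfolding mid_def mean_def by (subst integral_mult_right_zero)
    done
  then show "rare sequentially (iid \<nu>) (\<lambda>n. {x. t \<le> \<sigma> * mean (empirical n x)})"
  proof (rule rare_mono)
    show "\<forall>\<^sub>F n in sequentially. {x. t \<le> \<sigma> * mean (empirical n x)} \<inter> space (iid \<nu>) \<subseteq> {x. t \<le> avg (\<lambda>z. \<sigma> * z) n x}"
      using eventually_gt_at_top[of 0] by eventually_elim (auto simp: mean_empirical avg_linear)
  qed
next
  note fi = fin_momD[OF nu]
  assume "t < mid"
  then have "rare sequentially (iid \<nu>) (\<lambda>n. {x. - t \<le> avg (\<lambda>z. - (\<sigma> * z)) n x})"
    apply (intro rare_avg[OF fi(1)])
    subgoal by measurable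
    subgoal by (intro Bochner_Integration.integrable_minus integrable_mult_right fi(4))
    subgoal unfolding mid_def mean_def by (subst Bochner_Integration.integral_minus, subst integral_mult_right_zero) simp
    done
  then show "rare sequentially (iid \<nu>) (\<lambda>n. {x. \<sigma> * mean (empirical n x) \<le> t})"
  proof (rule rare_mono)
    show "\<forall>\<^sub>F n in sequentially. {x. \<sigma> * mean (empirical n x) \<le> t} \<inter> space (iid \<nu>) \<subseteq> {x. - t \<le> avg (\<lambda>z. - (\<sigma> * z)) n x}"
      using eventually_gt_at_top[of 0] by eventually_elim (auto simp: mean_empirical avg_linear)
  qed
qed

text \<open>
A single bet witnesses that the rate of $\nu$ exceeds $c$, and by the weak law it still
does so for the empirical measure.
\<close>
lemma KLs_empirical_lower:
  assumes t: "t < M" and c: "c < rate t"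
  shows "rare sequentially (iid \<nu>) (\<lambda>n. {x. KLs (empirical n x) t \<le> ereal c})"
proof -
  note fi = fin_momD[OF nu]
  have "\<exists>l s. l \<in> bets t \<and> 0 < s \<and> (\<forall>x. s \<le> bet t l x) \<and> c < (\<integral>x. ln (bet t l x) \<partial>\<nu>)"
  proof (rule ccontr)
    assume neg: "\<not> ?thesis"
    have d: "(\<integral>x. ln (bet t l x) \<partial>\<nu>) \<le> c" if "l \<in> bets t" "0 < s" "\<And>x. s \<le> bet t l x" for l s
      using neg that by (meson not_le)
    define c' where "c' = (c + rate t) / 2"
    have c': "c < c'" "c' < rate t" using c by (auto simp: c'_def field_simps)
    have "reach \<nu> t c'" by (rule strong_duality[OF nu t c'(1) d])
    then show False using rate_le[OF t] c' by force
  qed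
  then obtain l s where l: "l \<in> bets t" "0 < s" "\<And>x. s \<le> bet t l x" and gt: "c < (\<integral>x. ln (bet t l x) \<partial>\<nu>)"
    by blast
  have pos: "0 < bet t l x" for x using l(2) l(3)[of x] by linarith
  have il: "integrable \<nu> (\<lambda>x. ln (bet t l x))" by (rule integrable_ln_bdd_below[OF fi(5) l(2,3) fi(2)])
  have "rare sequentially (iid \<nu>) (\<lambda>n. {x. - c \<le> avg (\<lambda>z. - ln (bet t l z)) n x})"
    using il gt by (intro rare_avg[OF fi(1)]) auto
  then show ?thesis
  proof (rule rare_mono)
    show "\<forall>\<^sub>F n in sequentially. {x. KLs (empirical n x) t \<le> ereal c} \<inter> space (iid \<nu>) \<subseteq> {x. - c \<le> avg (\<lambda>z. - ln (bet t l z)) n x}"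
      using eventually_gt_at_top[of 0]
    proof eventually_elim
      case (elim n)
      have "ereal (avg (\<lambda>z. ln (bet t l z)) n x) \<le> KLs (empirical n x) t" for x
        using weak_duality[OF fin_mom_empirical[OF elim] l(1)] pos elim
        by (simp add: empirical_integral)
      then have "avg (\<lambda>z. ln (bet t l z)) n x \<le> c" if "KLs (empirical n x) t \<le> ereal c" for x
        using that by (metis ereal_less_eq(3) order_trans)
      then show ?case by (auto simp: avg_linear)
    qed
  qed
qed

text \<open>
A reweighting of $\nu$ that is feasible with slack in all constraints remains feasible for the empirical
measure, by the weak law for four integrals. Slack in the mean is created by aiming at a
threshold $t' > t$, and slack in mass and moment by moving a small fraction $s$ of the mass to the origin.
\<close>
lemma KLs_empirical_upper:
  assumes t: "t < M" and c: "rate t < c"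
  shows "rare sequentially (iid \<nu>) (\<lambda>n. {x. \<not> KLs (empirical n x) t \<le> ereal c})"
proof -
  note fi = fin_momD[OF nu]
  have "(rate \<longlongrightarrow> rate t) (at t)" 
    using rate_cont t continuous_on_eq_continuous_at[OF open_lessThan, of M rate] by (auto simp: isCont_def)
  then have "(rate \<longlongrightarrow> rate t) (at_right t)" by (rule filterlim_mono) (auto simp: at_le)
  then have "\<forall>\<^sub>F u in at_right t. rate u < c" using c by (rule order_tendstoD)
  moreover have "\<forall>\<^sub>F u in at_right t. u \<in> {t<..<M}" by (rule eventually_at_right_real[OF t])
  ultimately have "\<forall>\<^sub>F u in at_right t. rate u < c \<and> t < u \<and> u < M" by eventually_elim auto
  then obtain t' where t': "rate t' < c" "t < t'" "t' < M"
    using eventually_happens'[of "at_right t"] by auto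
  obtain c0 where c0: "rate t' < c0" "c0 < c" using dense[OF t'(1)] by blast
  obtain \<phi> y where \<phi>[measurable]: "\<phi> \<in> borel_measurable borel" and pos: "\<And>x. 0 < \<phi> x"
     and i: "integrable \<nu> \<phi>" "integrable \<nu> (\<lambda>x. \<phi> x * x)" "integrable \<nu> (\<lambda>x. \<phi> x * pm x)"
     "integrable \<nu> (\<lambda>x. ln (\<phi> x))" and w: "(\<integral>x. \<phi> x \<partial>\<nu>) \<le> 1"
     and mn: "t' \<le> \<sigma> * (\<integral>x. \<phi> x * x \<partial>\<nu>) + (1 - (\<integral>x. \<phi> x \<partial>\<nu>)) * y"
     and mo: "(\<integral>x. \<phi> x * pm x \<partial>\<nu>) + (1 - (\<integral>x. \<phi> x \<partial>\<nu>)) * pm y \<le> \<Gamma>"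
     and val: "- (\<integral>x. ln (\<phi> x) \<partial>\<nu>) \<le> c0"
    using reach_rate[OF t'(3) c0(1)] unfolding reach_def by blast
  have "((\<lambda>s. (1 - s) * t') \<longlongrightarrow> t') (at_right 0)" by (rule tendsto_eq_intros refl | simp)+
  then have "\<forall>\<^sub>F s in at_right 0. t < (1 - s) * t'" using t'(2) by (rule order_tendstoD)
  moreover have "((\<lambda>s. c0 - ln (1 - s)) \<longlongrightarrow> c0) (at_right 0)" by (rule tendsto_eq_intros refl | simp)+
  then have "\<forall>\<^sub>F s in at_right 0. c0 - ln (1 - s) < c" using c0(2) by (rule order_tendstoD)
  moreover have "\<forall>\<^sub>F s in at_right 0. s \<in> {0<..<1::real}" by (rule eventually_at_right_real) simp
  ultimately have "\<forall>\<^sub>F s in at_right 0. t < (1 - s) * t' \<and> c0 - ln (1 - s) < c \<and> 0 < s \<and> s < 1"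
    by eventually_elim auto
  then obtain s where s: "t < (1 - s) * t'" "c0 - ln (1 - s) < c" "0 < s" "s < 1"
    using eventually_happens'[of "at_right (0::real)"] by auto
  define \<psi> where "\<psi> x = (1 - s) * \<phi> x" for x
  define W where "W = (\<integral>x. \<phi> x \<partial>\<nu>)"
  have [measurable]: "\<psi> \<in> borel_measurable borel" unfolding \<psi>_def[abs_def] by measurable
  have \<psi>pos: "0 < \<psi> x" for x using pos s by (simp add: \<psi>_def)
  have W1: "W \<le> 1" using w by (simp add: W_def)
  have nn: "0 \<le> (1 - s) * (1 - W)" using s W1 by simp
  \<comment> \<open>The atom of the original reweighting and the mass moved to the origin, merged into one atom.\<close>
  obtain z where z: "((1 - s) * (1 - W) + s) * z = (1 - s) * (1 - W) * y + s * 0"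
    "((1 - s) * (1 - W) + s) * pm z \<le> (1 - s) * (1 - W) * pm y + s * pm 0"
    using pm_jensen[OF nn less_imp_le[OF s(3)], of y 0] by blast
  have ww: "(1 - s) * (1 - W) + s = 1 - (1 - s) * W" by (simp add: algebra_simps)
  note z = z[unfolded ww]
  have e1: "rare sequentially (iid \<nu>) (\<lambda>n. {x. 1 \<le> avg \<psi> n x})"
  proof (intro rare_avg[OF fi(1)])
    have "(\<integral>x. \<psi> x \<partial>\<nu>) = (1 - s) * W" by (simp add: \<psi>_def W_def)
    also have "\<dots> \<le> (1 - s) * 1" using s W1 by (intro mult_left_mono) auto
    also have "\<dots> < 1" using s by simp
    finally show "(\<integral>x. \<psi> x \<partial>\<nu>) < 1" .
  qed (use i in \<open>auto simp: \<psi>_def[abs_def]\<close>)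
  have e2: "rare sequentially (iid \<nu>) (\<lambda>n. {x. z - t \<le> avg (\<lambda>x. \<psi> x * z - \<sigma> * (\<psi> x * x)) n x})"
  proof (intro rare_avg[OF fi(1)])
    have "(\<integral>x. \<psi> x * z - \<sigma> * (\<psi> x * x) \<partial>\<nu>) = (\<integral>x. ((1 - s) * z) * \<phi> x - (\<sigma> * (1 - s)) * (\<phi> x * x) \<partial>\<nu>)"
      by (simp add: \<psi>_def mult_ac)
    also have "\<dots> = (1 - s) * z * W - \<sigma> * (1 - s) * (\<integral>x. \<phi> x * x \<partial>\<nu>)"
      using i by (simp add: W_def)
    finally have ex: "(\<integral>x. \<psi> x * z - \<sigma> * (\<psi> x * x) \<partial>\<nu>) = (1 - s) * z * W - \<sigma> * (1 - s) * (\<integral>x. \<phi> x * x \<partial>\<nu>)" .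
    have "t < (1 - s) * (\<sigma> * (\<integral>x. \<phi> x * x \<partial>\<nu>) + (1 - W) * y)"
      using s mn by (intro order.strict_trans2[OF s(1)] mult_left_mono) (auto simp: W_def)
    then show "(\<integral>x. \<psi> x * z - \<sigma> * (\<psi> x * x) \<partial>\<nu>) < z - t"
      unfolding ex using z(1) by (simp add: algebra_simps)
    show "integrable \<nu> (\<lambda>x. \<psi> x * z - \<sigma> * (\<psi> x * x))"
      using i by (auto simp: \<psi>_def mult.assoc)
  qed measurable
  have e3: "rare sequentially (iid \<nu>) (\<lambda>n. {x. \<Gamma> - pm z \<le> avg (\<lambda>x. \<psi> x * pm x - \<psi> x * pm z) n x})"
  proof (intro rare_avg[OF fi(1)])
    have "(\<integral>x. \<psi> x * pm x - \<psi> x * pm z \<partial>\<nu>) = (\<integral>x. (1 - s) * (\<phi> x * pm x) - ((1 - s) * pm z) * \<phi> x \<partial>\<nu>)"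
      by (simp add: \<psi>_def mult_ac)
    also have "\<dots> = (1 - s) * (\<integral>x. \<phi> x * pm x \<partial>\<nu>) - (1 - s) * pm z * W"
      using i by (simp add: W_def)
    finally have ex: "(\<integral>x. \<psi> x * pm x - \<psi> x * pm z \<partial>\<nu>) = (1 - s) * (\<integral>x. \<phi> x * pm x \<partial>\<nu>) - (1 - s) * pm z * W" .
    have "(1 - s) * ((\<integral>x. \<phi> x * pm x \<partial>\<nu>) + (1 - W) * pm y) \<le> (1 - s) * \<Gamma>"
      using s mo by (intro mult_left_mono) (auto simp: W_def)
    also have "\<dots> < \<Gamma>" using s Gam by (simp add: algebra_simps)
    finally show "(\<integral>x. \<psi> x * pm x - \<psi> x * pm z \<partial>\<nu>) < \<Gamma> - pm z"
      unfolding ex using z(2) eps by (simp add: algebra_simps)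
    show "integrable \<nu> (\<lambda>x. \<psi> x * pm x - \<psi> x * pm z)"
      using i by (auto simp: \<psi>_def mult.assoc)
  qed measurable
  have ln\<psi>: "ln (\<psi> x) = ln (1 - s) + ln (\<phi> x)" for x
    using s pos[of x] by (simp add: \<psi>_def ln_mult)
  have e4: "rare sequentially (iid \<nu>) (\<lambda>n. {x. c \<le> avg (\<lambda>x. - ln (\<psi> x)) n x})"
  proof (intro rare_avg[OF fi(1)])
    have "(\<integral>x. - ln (\<psi> x) \<partial>\<nu>) = - ln (1 - s) - (\<integral>x. ln (\<phi> x) \<partial>\<nu>)"
      unfolding ln\<psi> using i nu.prob_space by simp
    then show "(\<integral>x. - ln (\<psi> x) \<partial>\<nu>) < c" using val s by simp
    show "integrable \<nu> (\<lambda>x. - ln (\<psi> x))" unfolding ln\<psi> using i by auto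
  qed measurable
  show ?thesis
  proof (rule rare_mono[OF rare_Un[OF rare_Un[OF e1 e2] rare_Un[OF e3 e4]]])
    have key: "KLs (empirical n x) t \<le> ereal c"
      if n: "0 < n" and a: "avg \<psi> n x < 1" "avg (\<lambda>x. \<psi> x * z - \<sigma> * (\<psi> x * x)) n x < z - t"
        "avg (\<lambda>x. \<psi> x * pm x - \<psi> x * pm z) n x < \<Gamma> - pm z" "avg (\<lambda>x. - ln (\<psi> x)) n x < c" for n x
    proof (rule KLs_le_of_reach[OF fin_mom_empirical[OF n]], rule reachI[where \<phi>=\<psi> and y=z])
      show "t \<le> \<sigma> * (\<integral>x. \<psi> x * x \<partial>empirical n x) + (1 - (\<integral>x. \<psi> x \<partial>empirical n x)) * z"
        using a(2) unfolding avg_linear by (simp add: avg_empirical[OF n] algebra_simps)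
      show "(\<integral>x. \<psi> x * pm x \<partial>empirical n x) + (1 - (\<integral>x. \<psi> x \<partial>empirical n x)) * pm z \<le> \<Gamma>"
        using a(3) unfolding avg_linear by (simp add: avg_empirical[OF n] algebra_simps)
    qed (use n a \<psi>pos in \<open>auto simp: avg_empirical avg_linear intro!: empirical_integral\<close>)
    show "\<forall>\<^sub>F n in sequentially. {x. \<not> KLs (empirical n x) t \<le> ereal c} \<inter> space (iid \<nu>)
        \<subseteq> ({x. 1 \<le> avg \<psi> n x} \<union> {x. z - t \<le> avg (\<lambda>x. \<psi> x * z - \<sigma> * (\<psi> x * x)) n x}) \<union>
          ({x. \<Gamma> - pm z \<le> avg (\<lambda>x. \<psi> x * pm x - \<psi> x * pm z) n x} \<union> {x. c \<le> avg (\<lambda>x. - ln (\<psi> x)) n x})"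
      using eventually_gt_at_top[of 0]
    proof eventually_elim
      case (elim n)
      show ?case
      proof (rule subsetI, rule ccontr)
        fix x
        assume "x \<in> {x. \<not> KLs (empirical n x) t \<le> ereal c} \<inter> space (iid \<nu>)"
          "x \<notin> ({x. 1 \<le> avg \<psi> n x} \<union> {x. z - t \<le> avg (\<lambda>x. \<psi> x * z - \<sigma> * (\<psi> x * x)) n x}) \<union>
          ({x. \<Gamma> - pm z \<le> avg (\<lambda>x. \<psi> x * pm x - \<psi> x * pm z) n x} \<union> {x. c \<le> avg (\<lambda>x. - ln (\<psi> x)) n x})"
        then show False using key[OF elim, of x] by (auto simp: not_le)
      qed
    qed
  qed
qed

end

section \<open>Sample sizes within a random budget\<close>

lemma tau_measurable:
  assumes [measurable_cong]: "sets \<C> = sets borel"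
  shows "tau b \<in> iid \<C> \<rightarrow>\<^sub>M count_space UNIV"
proof -
  have eq: "tau b = (\<lambda>c. Sup {n. 1 \<le> n \<and> (\<Sum>i<n. c i) \<le> b})" by (simp add: tau_def fun_eq_iff)
  show ?thesis unfolding eq
  proof (rule measurable_Sup_nat)
    fix n :: nat
    show "Measurable.pred (iid \<C>) (\<lambda>c. n \<in> {n. 1 \<le> n \<and> (\<Sum>i<n. c i) \<le> b})"
      unfolding mem_Collect_eq by measurable
  qed
qed

lemma tau_candidates_bounded:
  fixes c :: "nat \<Rightarrow> real"
  assumes pos: "\<And>i. 0 < c i" and b: "b < (\<Sum>i<m. c i)" and n: "(\<Sum>i<n. c i) \<le> b"
  shows "n < m"
proof (rule ccontr)
  assume "\<not> n < m"
  then have "(\<Sum>i<m. c i) \<le> (\<Sum>i<n. c i)" using pos by (intro sum_mono2) (auto simp: less_imp_le)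
  then show False using b n by simp
qed

lemma tau_less:
  assumes pos: "\<And>i. 0 < c i" and m: "1 \<le> m" and b: "b < (\<Sum>i<m. c i)"
  shows "tau b c < m"
proof (cases "{n. 1 \<le> n \<and> (\<Sum>i<n. c i) \<le> b} = {}")
  case True
  then have "tau b c = 0" unfolding tau_def True by (simp add: Sup_nat_empty)
  then show ?thesis using m by simp
next
  case False
  have "tau b c \<le> m - 1"
    unfolding tau_def using tau_candidates_bounded[OF pos b] by (intro cSup_least False) force
  then show ?thesis using m by simp
qed

text \<open>
The supremum is a maximum only if the total cost eventually exceeds the budget, which is what the
second index $m'$ is for.
\<close>
lemma tau_ge:
  assumes pos: "\<And>i. 0 < c i" and m: "1 \<le> m" "(\<Sum>i<m. c i) \<le> b" and b: "b < (\<Sum>i<m'. c i)"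
  shows "m \<le> tau b c"
  unfolding tau_def
proof (rule cSup_upper)
  show "bdd_above {n. 1 \<le> n \<and> (\<Sum>i<n. c i) \<le> b}"
    using tau_candidates_bounded[OF pos b] by (intro bdd_aboveI[of _ m']) force
qed (use m in auto)

locale cost_budget =
  fixes \<C> :: "real measure" and cbar :: real and B :: "real \<Rightarrow> real"
  assumes cost: "cost_distribution \<C>" and cbar: "mean \<C> = cbar" "0 < cbar"
    and B_top: "filterlim B at_top (at_right 0)"
begin

sublocale cost: real_distribution \<C> using cost by (simp add: cost_distribution_def)
sublocale Q: prob_space "iid \<C>" by (rule prob_space_iid) (rule cost.prob_space_axioms)

lemma tau_meas[measurable]: "tau b \<in> iid \<C> \<rightarrow>\<^sub>M count_space UNIV"
  by (rule tau_measurable) simp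

lemma cost_int: "integrable \<C> (\<lambda>c. c)" "(\<integral>c. c \<partial>\<C>) = cbar"
  using cost cbar by (auto simp: cost_distribution_def mean_def)

lemma rare_avg_cost:
  assumes "cbar < r" shows "rare sequentially (iid \<C>) (\<lambda>n. {c. r \<le> avg (\<lambda>z. z) n c})"
proof (rule rare_avg[OF cost.real_distribution_axioms])
  show "(\<integral>c. c \<partial>\<C>) < r" unfolding cost_int(2) by (rule assms)
  show "integrable \<C> (\<lambda>c. c)" by (rule cost_int(1))
qed measurable

lemma rare_avg_cost_neg:
  assumes "- cbar < r" shows "rare sequentially (iid \<C>) (\<lambda>n. {c. r \<le> avg (\<lambda>z. - z) n c})"
proof (rule rare_avg[OF cost.real_distribution_axioms])
  show "(\<integral>c. - c \<partial>\<C>) < r" unfolding Bochner_Integration.integral_minus cost_int(2) by (rule assms)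
  show "integrable \<C> (\<lambda>c. - c)" by (intro Bochner_Integration.integrable_minus cost_int(1))
qed measurable

lemma rare_nonpos: "rare F (iid \<C>) (\<lambda>_. {c. \<not> (\<forall>i. 0 < c i)})"
proof (rule rare_null)
  have "AE c in iid \<C>. 0 < c i" for i
    using cost by (intro AE_PiM_component) (auto simp: cost_distribution_def cost.prob_space_axioms)
  then show "AE c in iid \<C>. \<forall>i. 0 < c i" by (subst AE_all_countable) auto
qed

lemma tau_late_rare:
  assumes m: "filterlim m sequentially F" and r: "r < cbar" and b: "\<forall>\<^sub>F i in F. b i \<le> r * real (m i)"
  shows "rare F (iid \<C>) (\<lambda>i. {c. m i \<le> tau (b i) c})"
proof -
  have "rare sequentially (iid \<C>) (\<lambda>n. {c. - r \<le> avg (\<lambda>z. - z) n c})"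
    by (rule rare_avg_cost_neg) (use r in simp)
  then have "rare F (iid \<C>) (\<lambda>i. {c. - r \<le> avg (\<lambda>z. - z) (m i) c})" using m by (rule rare_compose)
  then show ?thesis
  proof (rule rare_mono[OF rare_Un[OF rare_nonpos]])
    have "\<forall>\<^sub>F i in F. 1 \<le> m i" using m by (auto simp: filterlim_at_top)
    then show "\<forall>\<^sub>F i in F. {c. m i \<le> tau (b i) c} \<inter> space (iid \<C>) \<subseteq> {c. \<not> (\<forall>i. 0 < c i)} \<union> {c. - r \<le> avg (\<lambda>z. - z) (m i) c}"
      using b
    proof eventually_elim
      case (elim i)
      have "tau (b i) c < m i" if p: "\<And>i. 0 < c i" and a: "avg (\<lambda>z. - z) (m i) c < - r" for c
      proof (rule tau_less[OF p elim(1)])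
        have "r < (\<Sum>j<m i. c j) / real (m i)" using a by (simp add: avg_def sum_negf)
        then have "r * real (m i) < (\<Sum>j<m i. c j)" using elim(1) by (simp add: field_simps)
        then show "b i < (\<Sum>j<m i. c j)" using elim(2) by linarith
      qed
      then show ?case by (force simp: not_le)
    qed
  qed
qed

text \<open>
Besides the event that the first $m$ samples are too expensive, the budget must not last forever; the index
$m' \approx 2 b / \overline c$, where it is exhausted with high probability, takes care of this.
\<close>
lemma tau_early_rare:
  assumes m: "filterlim m sequentially F" and r: "cbar < r" and b: "\<forall>\<^sub>F i in F. r * real (m i) \<le> b i"
  shows "rare F (iid \<C>) (\<lambda>i. {c. tau (b i) c < m i})"
proof -
  have btop: "filterlim b at_top F"
  proof (rule filterlim_at_top_mono[OF _ b])
    show "filterlim (\<lambda>i. r * real (m i)) at_top F"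
      using r cbar m by (intro filterlim_tendsto_pos_mult_at_top[OF tendsto_const] filterlim_compose[OF filterlim_real_sequentially]) auto
  qed
  \<comment> \<open>Twice the expected number of affordable samples.\<close>
  define m' where "m' i = nat \<lceil>2 * b i / cbar\<rceil>" for i
  have m'ge: "2 * b i / cbar \<le> real (m' i)" for i unfolding m'_def by linarith
  have m': "filterlim m' sequentially F"
  proof -
    have "filterlim (\<lambda>i. 2 / cbar * b i) at_top F"
      using cbar by (intro filterlim_tendsto_pos_mult_at_top[OF tendsto_const _ btop]) auto
    then have "filterlim (\<lambda>i. real (m' i)) at_top F"
      by (rule filterlim_at_top_mono) (use m'ge in \<open>auto intro!: always_eventually simp: mult_ac\<close>)
    then show ?thesis by (simp add: filterlim_sequentially_iff_filterlim_real)
  qed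
  have e1: "rare F (iid \<C>) (\<lambda>i. {c. r \<le> avg (\<lambda>z. z) (m i) c})"
    by (rule rare_compose[OF rare_avg_cost m]) (rule r)
  have e2: "rare F (iid \<C>) (\<lambda>i. {c. - (3/4 * cbar) \<le> avg (\<lambda>z. - z) (m' i) c})"
    by (rule rare_compose[OF rare_avg_cost_neg m']) (use cbar in simp)
  show ?thesis
  proof (rule rare_mono[OF rare_Un[OF rare_nonpos rare_Un[OF e1 e2]]])
    have "\<forall>\<^sub>F i in F. 1 \<le> m i" "\<forall>\<^sub>F i in F. 1 \<le> m' i" using m m' by (auto simp: filterlim_at_top)
    then show "\<forall>\<^sub>F i in F. {c. tau (b i) c < m i} \<inter> space (iid \<C>) \<subseteq> {c. \<not> (\<forall>i. 0 < c i)} \<union>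
        ({c. r \<le> avg (\<lambda>z. z) (m i) c} \<union> {c. - (3/4 * cbar) \<le> avg (\<lambda>z. - z) (m' i) c})"
      using b
    proof eventually_elim
      case (elim i)
      have "m i \<le> tau (b i) c" if p: "\<And>i. 0 < c i" and a: "avg (\<lambda>z. z) (m i) c < r"
        and a': "avg (\<lambda>z. - z) (m' i) c < - (3/4 * cbar)" for c
      proof (rule tau_ge[OF p elim(1)])
        have "(\<Sum>j<m i. c j) < r * real (m i)" using a elim(1) by (simp add: avg_def field_simps)
        then show "(\<Sum>j<m i. c j) \<le> b i" using elim(3) by linarith
        have "3/4 * cbar < (\<Sum>j<m' i. c j) / real (m' i)" using a' by (simp add: avg_def sum_negf)
        then have "3/4 * cbar * real (m' i) < (\<Sum>j<m' i. c j)" using elim(2) by (simp add: field_simps)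
        moreover have "b i \<le> cbar / 2 * real (m' i)" using m'ge[of i] cbar by (simp add: field_simps)
        moreover have "cbar / 2 * real (m' i) \<le> 3/4 * cbar * real (m' i)" using cbar by (intro mult_right_mono) auto
        ultimately show "b i < (\<Sum>j<m' i. c j)" by linarith
      qed
      then show ?case by (force simp: not_le)
    qed
  qed
qed

lemma tau_large: "rare (at_right 0) (iid \<C>) (\<lambda>\<delta>. {c. tau (B \<delta>) c < N})"
proof -
  \<comment> \<open>Half the expected number of affordable samples, which is affordable with high probability.\<close>
  define m where "m \<delta> = nat \<lfloor>B \<delta> / (2 * cbar)\<rfloor>" for \<delta>
  have top: "filterlim (\<lambda>\<delta>. 1 / (2 * cbar) * B \<delta>) at_top (at_right 0)"
    using cbar by (intro filterlim_tendsto_pos_mult_at_top[OF tendsto_const _ B_top]) auto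
  have m: "filterlim m sequentially (at_right 0)"
    unfolding filterlim_at_top
  proof
    fix K :: nat
    have "\<forall>\<^sub>F \<delta> in at_right 0. real K \<le> 1 / (2 * cbar) * B \<delta>" using top by (simp add: filterlim_at_top)
    then show "\<forall>\<^sub>F \<delta> in at_right 0. K \<le> m \<delta>"
      by eventually_elim (simp add: m_def le_nat_floor)
  qed
  have "\<forall>\<^sub>F \<delta> in at_right 0. 0 \<le> B \<delta>" using B_top by (simp add: filterlim_at_top)
  then have "\<forall>\<^sub>F \<delta> in at_right 0. 2 * cbar * real (m \<delta>) \<le> B \<delta>"
  proof eventually_elim
    case (elim \<delta>)
    have "real (m \<delta>) \<le> B \<delta> / (2 * cbar)" unfolding m_def using elim cbar by (intro of_nat_floor) auto
    then show ?case using cbar by (simp add: field_simps)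
  qed
  then have "rare (at_right 0) (iid \<C>) (\<lambda>\<delta>. {c. tau (B \<delta>) c < m \<delta>})"
    using m cbar by (intro tau_early_rare[where r="2 * cbar"]) auto
  then show ?thesis
  proof (rule rare_mono)
    have "\<forall>\<^sub>F \<delta> in at_right 0. N \<le> m \<delta>" using m by (simp add: filterlim_at_top)
    then show "\<forall>\<^sub>F \<delta> in at_right 0. {c. tau (B \<delta>) c < N} \<inter> space (iid \<C>) \<subseteq> {c. tau (B \<delta>) c < m \<delta>}"
      by eventually_elim auto
  qed
qed

lemma ln_inverse_top: "filterlim (\<lambda>\<delta>::real. ln (1 / \<delta>)) at_top (at_right 0)"
  by real_asymp

lemma ceil_index:
  assumes c: "0 < c"
  shows "filterlim (\<lambda>\<delta>. nat \<lceil>ln (1 / \<delta>) / c\<rceil>) sequentially (at_right 0)"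
    "ln (1 / \<delta>) / c \<le> real (nat \<lceil>ln (1 / \<delta>) / c\<rceil>)"
proof -
  show ge: "ln (1 / \<delta>) / c \<le> real (nat \<lceil>ln (1 / \<delta>) / c\<rceil>)" for \<delta> by linarith
  have "filterlim (\<lambda>\<delta>. 1 / c * ln (1 / \<delta>)) at_top (at_right (0::real))"
    using c by (intro filterlim_tendsto_pos_mult_at_top[OF tendsto_const _ ln_inverse_top]) auto
  then have "filterlim (\<lambda>\<delta>. real (nat \<lceil>ln (1 / \<delta>) / c\<rceil>)) at_top (at_right 0)"
    by (rule filterlim_at_top_mono) (use ge in \<open>auto intro!: always_eventually\<close>)
  then show "filterlim (\<lambda>\<delta>. nat \<lceil>ln (1 / \<delta>) / c\<rceil>) sequentially (at_right 0)"
    by (simp add: filterlim_sequentially_iff_filterlim_real)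
qed

text \<open>
With $m = \lceil \ln (1/\delta) / c \rceil$ samples the average budget per sample tends to $c L$, which is
below the mean cost.
\<close>
lemma tau_not_above:
  assumes L: "((\<lambda>\<delta>. ereal (B \<delta> / ln (1 / \<delta>))) \<longlongrightarrow> L) (at_right 0)"
    and c: "0 < c" and cL: "ereal c * L < ereal cbar"
  shows "rare (at_right 0) (iid \<C>) (\<lambda>\<delta>. {k. ln (1 / \<delta>) < c * real (tau (B \<delta>) k)})"
proof -
  have "L < ereal (cbar / c)"
    using cL c by (cases L) (auto simp: field_simps)
  then obtain r where r: "L < ereal r" "ereal r < ereal (cbar / c)" using ereal_dense2 by blast
  have rc: "c * r < cbar" using r(2) c by (simp add: field_simps)
  have ev: "\<forall>\<^sub>F \<delta> in at_right 0. ereal (B \<delta> / ln (1 / \<delta>)) < ereal r" using L r(1) by (rule order_tendstoD)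
  have pos: "\<forall>\<^sub>F \<delta> in at_right (0::real). 0 < ln (1 / \<delta>)" using ln_inverse_top by (simp add: filterlim_at_top_dense)
  have Bpos: "\<forall>\<^sub>F \<delta> in at_right 0. 0 < B \<delta>" using B_top by (simp add: filterlim_at_top_dense)
  define m where "m \<delta> = nat \<lceil>ln (1 / \<delta>) / c\<rceil>" for \<delta>
  have "\<forall>\<^sub>F \<delta> in at_right 0. B \<delta> \<le> (c * r) * real (m \<delta>)"
    using ev pos Bpos
  proof eventually_elim
    case (elim \<delta>)
    have *: "B \<delta> < r * ln (1 / \<delta>)" using elim by (simp add: field_simps)
    then have "0 < r * ln (1 / \<delta>)" using elim by linarith
    then have r0: "0 < r" using elim by (simp add: zero_less_mult_iff)
    have "r * ln (1 / \<delta>) = (c * r) * (ln (1 / \<delta>) / c)" using c by simp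
    also have "\<dots> \<le> (c * r) * real (m \<delta>)"
      unfolding m_def using c r0 by (intro mult_left_mono ceil_index) auto
    finally show ?case using * by linarith
  qed
  then have "rare (at_right 0) (iid \<C>) (\<lambda>\<delta>. {k. m \<delta> \<le> tau (B \<delta>) k})"
    using rc ceil_index(1)[OF c] by (intro tau_late_rare[where r="c * r"]) (auto simp: m_def)
  then show ?thesis
  proof (rule rare_mono)
    show "\<forall>\<^sub>F \<delta> in at_right 0. {k. ln (1 / \<delta>) < c * real (tau (B \<delta>) k)} \<inter> space (iid \<C>) \<subseteq> {k. m \<delta> \<le> tau (B \<delta>) k}"
    proof (intro always_eventually allI subsetI)
      fix \<delta> k assume "k \<in> {k. ln (1 / \<delta>) < c * real (tau (B \<delta>) k)} \<inter> space (iid \<C>)"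
      then have "ln (1 / \<delta>) / c < real (tau (B \<delta>) k)" using c by (simp add: field_simps)
      then show "k \<in> {k. m \<delta> \<le> tau (B \<delta>) k}" unfolding m_def by simp
    qed
  qed
qed

text \<open>
With $m = \lceil \ln (1/\delta) / c \rceil$ samples the average budget per sample tends to $c L$, which
exceeds the mean cost.
\<close>
lemma tau_not_below:
  assumes L: "((\<lambda>\<delta>. ereal (B \<delta> / ln (1 / \<delta>))) \<longlongrightarrow> L) (at_right 0)"
    and c: "0 < c" and cL: "ereal cbar < ereal c * L"
  shows "rare (at_right 0) (iid \<C>) (\<lambda>\<delta>. {k. c * real (tau (B \<delta>) k) < ln (1 / \<delta>)})"
proof -
  have "ereal (cbar / c) < L"
    using cL c by (cases L) (auto simp: field_simps)
  then obtain r where r: "ereal (cbar / c) < ereal r" "ereal r < L" using ereal_dense2 by blast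
  obtain q where q: "cbar / c < q" "q < r" using dense[of "cbar / c" r] r(1) by auto
  have qc: "cbar < c * q" using q(1) c by (simp add: field_simps)
  then have q0: "0 < q" using cbar c by (smt (verit) mult_nonneg_nonpos)
  have ev: "\<forall>\<^sub>F \<delta> in at_right 0. ereal r < ereal (B \<delta> / ln (1 / \<delta>))" using L r(2) by (rule order_tendstoD)
  have pos: "\<forall>\<^sub>F \<delta> in at_right (0::real). max 1 (c * q / (r - q)) < ln (1 / \<delta>)"
    using ln_inverse_top by (simp add: filterlim_at_top_dense del: max_less_iff_conj)
  define m where "m \<delta> = nat \<lceil>ln (1 / \<delta>) / c\<rceil>" for \<delta>
  have "\<forall>\<^sub>F \<delta> in at_right 0. (c * q) * real (m \<delta>) \<le> B \<delta>"
    using ev pos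
  proof eventually_elim
    case (elim \<delta>)
    have l: "0 < ln (1 / \<delta>)" "c * q / (r - q) < ln (1 / \<delta>)" using elim(2) by auto
    have "r * ln (1 / \<delta>) < B \<delta>" using elim(1) l(1) by (simp add: field_simps)
    moreover have "c * q < (r - q) * ln (1 / \<delta>)" using l(2) q by (simp add: field_simps)
    moreover have "real (m \<delta>) \<le> ln (1 / \<delta>) / c + 1"
    proof -
      have "0 \<le> ln (1 / \<delta>) / c" using l c by simp
      then show ?thesis unfolding m_def by linarith
    qed
    then have "(c * q) * real (m \<delta>) \<le> (c * q) * (ln (1 / \<delta>) / c + 1)"
      using c q0 by (intro mult_left_mono) auto
    moreover have "(c * q) * (ln (1 / \<delta>) / c + 1) = q * ln (1 / \<delta>) + c * q" using c by (simp add: field_simps)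
    ultimately show ?case by (simp add: left_diff_distrib)
  qed
  then have "rare (at_right 0) (iid \<C>) (\<lambda>\<delta>. {k. tau (B \<delta>) k < m \<delta>})"
    using qc ceil_index(1)[OF c] by (intro tau_early_rare[where r="c * q"]) (auto simp: m_def)
  then show ?thesis
  proof (rule rare_mono)
    show "\<forall>\<^sub>F \<delta> in at_right 0. {k. c * real (tau (B \<delta>) k) < ln (1 / \<delta>)} \<inter> space (iid \<C>) \<subseteq> {k. tau (B \<delta>) k < m \<delta>}"
    proof (intro always_eventually allI subsetI)
      fix \<delta> k assume "k \<in> {k. c * real (tau (B \<delta>) k) < ln (1 / \<delta>)} \<inter> space (iid \<C>)"
      then have "real (tau (B \<delta>) k) < ln (1 / \<delta>) / c" using c by (simp add: field_simps)
      also have "\<dots> \<le> real (m \<delta>)" unfolding m_def by (rule ceil_index(2)[OF c])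
      finally show "k \<in> {k. tau (B \<delta>) k < m \<delta>}" by simp
    qed
  qed
qed

end

section \<open>Limits of one endpoint\<close>

lemma tendsto_in_prob_of_rare:
  assumes P: "finite_measure P"
    and lower: "\<And>t. t < r \<Longrightarrow> rare (at_right 0) P (\<lambda>\<delta>. {\<omega>. Y \<delta> \<omega> < ereal t})"
    and upper: "\<And>t. r < t \<Longrightarrow> rare (at_right 0) P (\<lambda>\<delta>. {\<omega>. ereal t < Y \<delta> \<omega>})"
  shows "tendsto_in_prob P Y (ereal r)"
  unfolding tendsto_in_prob_def
proof (intro allI impI, elim conjE)
  fix U :: "ereal set" assume U: "open U" "ereal r \<in> U"
  obtain e where e: "e > 0" "{ereal r - e<..<ereal r + e} \<subseteq> U"
    using ereal_open_cont_interval[OF U] by auto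
  obtain d where d: "0 < d" "ereal d < e" using ereal_dense2[OF e(1)] by (auto simp: zero_ereal_def)
  have sub: "y \<in> U" if "\<not> y < ereal (r - d)" "\<not> ereal (r + d) < y" for y
  proof -
    have "ereal r - e < y" using that d by (cases e; cases y) auto
    moreover have "y < ereal r + e" using that d by (cases e; cases y) auto
    ultimately show ?thesis using e(2) by auto
  qed
  have "rare (at_right 0) P (\<lambda>\<delta>. {\<omega>. Y \<delta> \<omega> \<notin> U})"
  proof (rule rare_mono[OF rare_Un[OF lower upper]])
    show "r - d < r" "r < r + d" using d by auto
    show "\<forall>\<^sub>F \<delta> in at_right 0. {\<omega>. Y \<delta> \<omega> \<notin> U} \<inter> space P \<subseteq> {\<omega>. Y \<delta> \<omega> < ereal (r - d)} \<union> {\<omega>. ereal (r + d) < Y \<delta> \<omega>}"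
      using sub by (intro always_eventually) blast
  qed
  then show "((\<lambda>\<delta>. measure P {\<omega> \<in> space P. Y \<delta> \<omega> \<notin> U}) \<longlongrightarrow> 0) (at_right 0)"
    using rare_imp_tendsto[OF P] by fastforce
qed

lemma tendsto_in_prob_uminus:
  assumes "tendsto_in_prob P (\<lambda>\<delta> \<omega>. - Y \<delta> \<omega>) l" shows "tendsto_in_prob P Y (- l)"
  unfolding tendsto_in_prob_def
proof (intro allI impI, elim conjE)
  fix U :: "ereal set" assume U: "open U" "- l \<in> U"
  have "open (uminus -` U)" using U(1) by (intro open_vimage) (auto simp: continuous_on_def intro!: tendsto_uminus_ereal)
  moreover have "l \<in> uminus -` U" using U by simp
  ultimately have "((\<lambda>\<delta>. measure P {\<omega> \<in> space P. - Y \<delta> \<omega> \<notin> uminus -` U}) \<longlongrightarrow> 0) (at_right 0)"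
    using assms unfolding tendsto_in_prob_def by blast
  then show "((\<lambda>\<delta>. measure P {\<omega> \<in> space P. Y \<delta> \<omega> \<notin> U}) \<longlongrightarrow> 0) (at_right 0)" by simp
qed

lemma beta_lower: "0 < \<delta> \<Longrightarrow> ln (1 / \<delta>) \<le> beta n \<delta>"
proof -
  assume d: "0 < \<delta>"
  have "1 \<le> 2 * (1 + real n)^2" using one_le_power[of "1 + real n" 2] by linarith
  then have "1 / \<delta> \<le> 2 * (1 + real n)^2 / \<delta>" using d by (intro divide_right_mono) auto
  then have "ln (1 / \<delta>) \<le> ln (2 * (1 + real n)^2 / \<delta>)" using d by simp
  then show ?thesis by (simp add: beta_def)
qed

lemma beta_eq: "0 < \<delta> \<Longrightarrow> beta n \<delta> = 1 + ln 2 + 2 * ln (1 + real n) + ln (1 / \<delta>)"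
  by (simp add: beta_def ln_div ln_mult ln_realpow)

text \<open>
$Y$ stands for the endpoint that is actually reported. It departs from endpt only when no sample is taken, an
event of vanishing probability.
\<close>
locale budgeted = interior_class \<epsilon> \<Gamma> \<sigma> \<nu> + cost_budget \<C> cbar B
  for \<epsilon> \<Gamma> \<sigma> :: real and \<nu> \<C> :: "real measure" and cbar :: real and B :: "real \<Rightarrow> real" +
  fixes L :: ereal and Y :: "real \<Rightarrow> (nat \<Rightarrow> real) \<times> (nat \<Rightarrow> real) \<Rightarrow> ereal"
  assumes lim: "((\<lambda>\<delta>. ereal (B \<delta> / ln (1 / \<delta>))) \<longlongrightarrow> L) (at_right 0)"
    and Y: "\<And>\<delta> \<omega>. 1 \<le> tau (B \<delta>) (snd \<omega>) \<Longrightarrow> Y \<delta> \<omega> = endpt \<delta> (tau (B \<delta>) (snd \<omega>)) (fst \<omega>)"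
begin

sublocale X: prob_space "iid \<nu>" by (rule prob_space_iid) (rule nu.prob_space_axioms)
sublocale XQ: pair_prob_space "iid \<nu>" "iid \<C>" ..

abbreviation "J \<equiv> iid \<nu> \<Otimes>\<^sub>M iid \<C>"

lemma rare_at_tau:
  "rare sequentially (iid \<nu>) D \<Longrightarrow> rare (at_right 0) J (\<lambda>\<delta>. {\<omega>. fst \<omega> \<in> D (tau (B \<delta>) (snd \<omega>))})"
  by (rule rare_random_index[OF X.prob_space_axioms Q.prob_space_axioms _ tau_meas tau_large])

lemma rare_cost: "rare (at_right 0) (iid \<C>) D \<Longrightarrow> rare (at_right 0) J (\<lambda>\<delta>. {\<omega>. snd \<omega> \<in> D \<delta>})"
  by (rule rare_snd[OF X.prob_space_axioms Q.prob_space_axioms])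

lemma pos_delta: "\<forall>\<^sub>F \<delta> in at_right (0::real). 0 < \<delta>"
  by (simp add: eventually_at_right_less)

text \<open>
The condition $c L < \overline c$ says that $c$ lies below the limit $\overline c / L$ of $\beta(\tau,\delta)/\tau$, in a form
that makes sense for $L = 0$ and $L = \infty$.
\<close>
lemma Y_lower:
  assumes t: "mid < t" "t < M" and c: "rate t < c" and cL: "ereal c * L < ereal cbar"
  shows "rare (at_right 0) J (\<lambda>\<delta>. {\<omega>. Y \<delta> \<omega> < ereal t})"
proof -
  have c0: "0 < c" using rate_nonneg[OF t(2)] c by linarith
  note r1 = rare_at_tau[OF KLs_empirical_upper[OF t(2) c]]
  note r2 = rare_at_tau[OF mean_empirical_rare(1)[OF t(1)]]
  note r3 = rare_cost[OF tau_not_above[OF lim c0 cL]]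
  note r4 = rare_cost[OF tau_large[of 1]]
  show ?thesis
  proof (rule rare_mono[OF rare_Un[OF rare_Un[OF r1 r2] rare_Un[OF r3 r4]]])
    show "\<forall>\<^sub>F \<delta> in at_right 0. {\<omega>. Y \<delta> \<omega> < ereal t} \<inter> space J \<subseteq>
      ({\<omega>. fst \<omega> \<in> {x. \<not> KLs (empirical (tau (B \<delta>) (snd \<omega>)) x) t \<le> ereal c}} \<union>
       {\<omega>. fst \<omega> \<in> {x. t \<le> \<sigma> * mean (empirical (tau (B \<delta>) (snd \<omega>)) x)}}) \<union>
      ({\<omega>. snd \<omega> \<in> {k. ln (1 / \<delta>) < c * real (tau (B \<delta>) k)}} \<union> {\<omega>. snd \<omega> \<in> {c. tau (B \<delta>) c < 1}})" (is "\<forall>\<^sub>F \<delta> in _. _ \<subseteq> ?bad \<delta>")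
      using pos_delta
    proof eventually_elim
      case d: (elim \<delta>)
      show ?case
      proof (rule subsetI, rule ccontr)
        fix \<omega> :: "(nat \<Rightarrow> real) \<times> (nat \<Rightarrow> real)"
        define n where "n = tau (B \<delta>) (snd \<omega>)"
        assume lt: "\<omega> \<in> {\<omega>. Y \<delta> \<omega> < ereal t} \<inter> space J" and "\<omega> \<notin> ?bad \<delta>"
        then have g: "KLs (empirical n (fst \<omega>)) t \<le> ereal c" and m: "\<sigma> * mean (empirical n (fst \<omega>)) < t"
          and n: "c * real n \<le> ln (1 / \<delta>)" "1 \<le> n" by (auto simp: n_def not_less not_le)
        have "ereal n * KLs (empirical n (fst \<omega>)) t \<le> ereal n * ereal c"
          using g by (intro ereal_mult_left_mono) auto
        also have "\<dots> \<le> ereal (beta n \<delta>)" using n beta_lower[OF d, of n] by (simp add: mult.commute)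
        finally have "ereal t \<le> endpt \<delta> n (fst \<omega>)" by (rule endpt_ge[OF m])
        then show False using lt n(2) Y[of \<delta> \<omega>] by (auto simp: n_def)
      qed
    qed
  qed
qed

text \<open>
A slightly smaller constant $c'$ with the same property absorbs the lower-order terms of $\beta$, which are
logarithmic in the number of samples.
\<close>
lemma Y_upper:
  assumes t: "mid < t" "t < M" and c: "0 < c" "c < rate t" and cL: "ereal cbar < ereal c * L"
  shows "rare (at_right 0) J (\<lambda>\<delta>. {\<omega>. ereal t < Y \<delta> \<omega>})"
proof -
  obtain c' where c': "0 < c'" "c' < c" "ereal cbar < ereal c' * L"
  proof (cases L)
    case (real k)
    then have k: "cbar < c * k" using cL by simp
    then have k0: "0 < k" using cbar c by (smt (verit) mult_nonneg_nonpos)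
    then obtain c' where "cbar / k < c'" "c' < c" using k dense[of "cbar / k" c] by (auto simp: field_simps)
    moreover then have "0 < c'" using cbar k0 by (smt (verit) divide_pos_pos)
    ultimately show ?thesis using real k0 by (intro that[of c']) (auto simp: field_simps)
  next
    case PInf
    then show ?thesis using c by (intro that[of "c / 2"]) auto
  next
    case MInf
    then show ?thesis using c cL by auto
  qed
  have "\<forall>\<^sub>F n in sequentially. 1 + ln 2 + 2 * ln (1 + real n) \<le> (c - c') * real n"
    using c' by real_asymp
  then obtain N where N: "\<And>n. N \<le> n \<Longrightarrow> 1 + ln 2 + 2 * ln (1 + real n) \<le> (c - c') * real n"
    by (auto simp: eventually_sequentially)
  note r1 = rare_at_tau[OF KLs_empirical_lower[OF t(2) c(2)]]
  note r2 = rare_at_tau[OF mean_empirical_rare(1)[OF t(1)]]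
  note r3 = rare_cost[OF tau_not_below[OF lim c'(1,3)]]
  note r4 = rare_cost[OF tau_large[of "max 1 N"]]
  show ?thesis
  proof (rule rare_mono[OF rare_Un[OF rare_Un[OF r1 r2] rare_Un[OF r3 r4]]])
    show "\<forall>\<^sub>F \<delta> in at_right 0. {\<omega>. ereal t < Y \<delta> \<omega>} \<inter> space J \<subseteq>
      ({\<omega>. fst \<omega> \<in> {x. KLs (empirical (tau (B \<delta>) (snd \<omega>)) x) t \<le> ereal c}} \<union>
       {\<omega>. fst \<omega> \<in> {x. t \<le> \<sigma> * mean (empirical (tau (B \<delta>) (snd \<omega>)) x)}}) \<union>
      ({\<omega>. snd \<omega> \<in> {k. c' * real (tau (B \<delta>) k) < ln (1 / \<delta>)}} \<union> {\<omega>. snd \<omega> \<in> {c. tau (B \<delta>) c < max 1 N}})" (is "\<forall>\<^sub>F \<delta> in _. _ \<subseteq> ?bad \<delta>")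
      using pos_delta
    proof eventually_elim
      case d: (elim \<delta>)
      show ?case
      proof (rule subsetI, rule ccontr)
        fix \<omega> :: "(nat \<Rightarrow> real) \<times> (nat \<Rightarrow> real)"
        define n where "n = tau (B \<delta>) (snd \<omega>)"
        assume lt: "\<omega> \<in> {\<omega>. ereal t < Y \<delta> \<omega>} \<inter> space J" and "\<omega> \<notin> ?bad \<delta>"
        then have g: "ereal c < KLs (empirical n (fst \<omega>)) t" and m: "\<sigma> * mean (empirical n (fst \<omega>)) < t"
          and n: "ln (1 / \<delta>) \<le> c' * real n" "1 \<le> n" "N \<le> n" by (auto simp: n_def not_less not_le)
        have "beta n \<delta> \<le> c * real n"
          using N[OF n(3)] n(1) by (simp add: beta_eq[OF d] algebra_simps)
        then have "ereal (beta n \<delta>) \<le> ereal n * ereal c" by (simp add: mult.commute)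
        also have "\<dots> < ereal n * KLs (empirical n (fst \<omega>)) t"
          using g n(2) by (cases "KLs (empirical n (fst \<omega>)) t") auto
        finally have "endpt \<delta> n (fst \<omega>) \<le> ereal t" using m by (intro endpt_le) auto
        then show False using lt n(2) Y[of \<delta> \<omega>] by (auto simp: n_def)
      qed
    qed
  qed
qed

lemma Y_ge_mean:
  assumes t: "t < mid"
  shows "rare (at_right 0) J (\<lambda>\<delta>. {\<omega>. Y \<delta> \<omega> < ereal t})"
proof (rule rare_mono[OF rare_Un[OF rare_at_tau[OF mean_empirical_rare(2)[OF t]] rare_cost[OF tau_large[of 1]]]])
  show "\<forall>\<^sub>F \<delta> in at_right 0. {\<omega>. Y \<delta> \<omega> < ereal t} \<inter> space J \<subseteq>
     {\<omega>. fst \<omega> \<in> {x. \<sigma> * mean (empirical (tau (B \<delta>) (snd \<omega>)) x) \<le> t}} \<union> {\<omega>. snd \<omega> \<in> {c. tau (B \<delta>) c < 1}}"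
    (is "\<forall>\<^sub>F \<delta> in _. _ \<subseteq> ?bad \<delta>")
  proof (intro always_eventually allI subsetI, rule ccontr)
    fix \<delta> \<omega>
    assume lt: "\<omega> \<in> {\<omega>. Y \<delta> \<omega> < ereal t} \<inter> space J" and "\<omega> \<notin> ?bad \<delta>"
    then have n: "1 \<le> tau (B \<delta>) (snd \<omega>)" and m: "t < \<sigma> * mean (empirical (tau (B \<delta>) (snd \<omega>)) (fst \<omega>))" by auto
    have "ereal t < endpt \<delta> (tau (B \<delta>) (snd \<omega>)) (fst \<omega>)"
      by (rule less_le_trans[OF _ endpt_ge_mean]) (use m in simp)
    then show False using lt Y[OF n] by auto
  qed
qed

lemma Y_le_M:
  assumes t: "M < t"
  shows "rare (at_right 0) J (\<lambda>\<delta>. {\<omega>. ereal t < Y \<delta> \<omega>})"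
proof (rule rare_mono[OF rare_Un[OF rare_at_tau[OF mean_empirical_rare(1)[OF mid_less]] rare_cost[OF tau_large[of 1]]]])
  show "\<forall>\<^sub>F \<delta> in at_right 0. {\<omega>. ereal t < Y \<delta> \<omega>} \<inter> space J \<subseteq>
     {\<omega>. fst \<omega> \<in> {x. M \<le> \<sigma> * mean (empirical (tau (B \<delta>) (snd \<omega>)) x)}} \<union> {\<omega>. snd \<omega> \<in> {c. tau (B \<delta>) c < 1}}"
    (is "\<forall>\<^sub>F \<delta> in _. _ \<subseteq> ?bad \<delta>")
  proof (intro always_eventually allI subsetI, rule ccontr)
    fix \<delta> \<omega>
    assume lt: "\<omega> \<in> {\<omega>. ereal t < Y \<delta> \<omega>} \<inter> space J" and "\<omega> \<notin> ?bad \<delta>"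
    then have n: "1 \<le> tau (B \<delta>) (snd \<omega>)" and m: "\<sigma> * mean (empirical (tau (B \<delta>) (snd \<omega>)) (fst \<omega>)) < M" by auto
    have "endpt \<delta> (tau (B \<delta>) (snd \<omega>)) (fst \<omega>) \<le> ereal M" using n m by (intro endpt_le_M) auto
    also have "\<dots> < ereal t" using t by simp
    finally show False using lt Y[OF n] by auto
  qed
qed

lemma Y_lower_mono: "rare (at_right 0) J (\<lambda>\<delta>. {\<omega>. Y \<delta> \<omega> < ereal t'}) \<Longrightarrow> t \<le> t' \<Longrightarrow>
   rare (at_right 0) J (\<lambda>\<delta>. {\<omega>. Y \<delta> \<omega> < ereal t})"
  by (erule rare_mono) (auto intro!: always_eventually elim: less_le_trans)

lemma Y_upper_mono: "rare (at_right 0) J (\<lambda>\<delta>. {\<omega>. ereal t' < Y \<delta> \<omega>}) \<Longrightarrow> t' \<le> t \<Longrightarrow>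
   rare (at_right 0) J (\<lambda>\<delta>. {\<omega>. ereal t < Y \<delta> \<omega>})"
  by (erule rare_mono) (auto intro!: always_eventually elim: le_less_trans[rotated])

text \<open>
A budget that is negligible against $\ln (1/\delta)$ excludes no mean of the class in the limit.
\<close>
lemma Y_tendsto_0:
  assumes L: "L = 0" shows "tendsto_in_prob J Y (ereal M)"
proof (rule tendsto_in_prob_of_rare[OF XQ.finite_measure_axioms])
  fix t assume "t < M"
  then obtain t' where t': "max mid t < t'" "t' < M" using dense[of "max mid t" M] mid_less by auto
  have "rare (at_right 0) J (\<lambda>\<delta>. {\<omega>. Y \<delta> \<omega> < ereal t'})"
    using t' cbar L by (intro Y_lower[of t' "rate t' + 1"]) auto
  then show "rare (at_right 0) J (\<lambda>\<delta>. {\<omega>. Y \<delta> \<omega> < ereal t})" by (rule Y_lower_mono) (use t' in auto)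
qed (rule Y_le_M)

lemma Y_tendsto_top:
  assumes L: "L = \<infinity>" shows "tendsto_in_prob J Y (ereal mid)"
proof (rule tendsto_in_prob_of_rare[OF XQ.finite_measure_axioms Y_ge_mean])
  fix t assume "mid < t"
  then obtain t' where t': "mid < t'" "t' < min t M" using dense[of mid "min t M"] mid_less by auto
  have "rare (at_right 0) J (\<lambda>\<delta>. {\<omega>. ereal t' < Y \<delta> \<omega>})"
    using t' cbar L rate_pos[of t'] by (intro Y_upper[of t' "rate t' / 2"]) auto
  then show "rare (at_right 0) J (\<lambda>\<delta>. {\<omega>. ereal t < Y \<delta> \<omega>})" by (rule Y_upper_mono) (use t' in auto)
qed

lemma Y_tendsto_root:
  assumes L: "L = ereal k" and k: "0 < k" and r: "mid < r" "r < M" "rate r = cbar / k"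
  shows "tendsto_in_prob J Y (ereal r)"
proof (rule tendsto_in_prob_of_rare[OF XQ.finite_measure_axioms])
  fix t assume "t < r"
  then obtain t' where t': "max mid t < t'" "t' < r" using dense[of "max mid t" r] r by auto
  have "rate t' < cbar / k" using rate_strict[of t' r] t' r by auto
  then obtain c where c: "rate t' < c" "c < cbar / k" using dense by blast
  have "rare (at_right 0) J (\<lambda>\<delta>. {\<omega>. Y \<delta> \<omega> < ereal t'})"
    using t' r c k L by (intro Y_lower[of t' c]) (auto simp: field_simps)
  then show "rare (at_right 0) J (\<lambda>\<delta>. {\<omega>. Y \<delta> \<omega> < ereal t})" by (rule Y_lower_mono) (use t' in auto)
next
  fix t assume "r < t"
  then obtain t' where t': "r < t'" "t' < min t M" using dense[of r "min t M"] r by auto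
  have "cbar / k < rate t'" using rate_strict[of r t'] t' r by auto
  then obtain c where c: "cbar / k < c" "c < rate t'" using dense by blast
  then have "0 < c" using cbar k by (smt (verit) divide_pos_pos)
  have "rare (at_right 0) J (\<lambda>\<delta>. {\<omega>. ereal t' < Y \<delta> \<omega>})"
    using t' r c k L \<open>0 < c\<close> by (intro Y_upper[of t' c]) (auto simp: field_simps)
  then show "rare (at_right 0) J (\<lambda>\<delta>. {\<omega>. ereal t < Y \<delta> \<omega>})" by (rule Y_upper_mono) (use t' in auto)
qed

end

section \<open>The two-sided policy\<close>

lemma (in moment_class) KL_inf_eq_KLs_right:
  "\<sigma> = 1 \<Longrightarrow> mean \<eta> \<le> q \<Longrightarrow> KL_inf \<eta> H q = KLs \<eta> q"
  unfolding KL_inf_def KLs_def by simp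

lemma (in moment_class) KL_inf_eq_KLs_left:
  "\<sigma> = -1 \<Longrightarrow> q < mean \<eta> \<Longrightarrow> KL_inf \<eta> H q = KLs \<eta> (- q)"
  unfolding KL_inf_def KLs_def by simp

locale two_sided =
  fixes \<epsilon> \<Gamma> :: real
  assumes eps: "0 < \<epsilon>" and Gam: "0 < \<Gamma>"
begin

sublocale R: moment_class \<epsilon> \<Gamma> 1 by unfold_locales (use eps Gam in auto)
sublocale L: moment_class \<epsilon> \<Gamma> "-1" by unfold_locales (use eps Gam in auto)

lemma M_eq: "L.M = R.M" by (simp add: L.M_def R.M_def)

lemma pi1h_right:
  assumes n: "0 < n" shows "snd (pi1h \<epsilon> \<Gamma> \<delta> n x) = R.endpt \<delta> n x"
proof -
  define S where "S = {t. 1 * mean (empirical n x) < t \<and> ereal n * R.KLs (empirical n x) t \<le> ereal (beta n \<delta>)}"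
  have eq: "{q. mean (empirical n x) < q \<and> ereal n * KL_inf (empirical n x) (heavy_tailed \<epsilon> \<Gamma>) q \<le> ereal (beta n \<delta>)} = S"
    unfolding S_def by (auto simp: R.KL_inf_eq_KLs_right)
  have "snd (pi1h \<epsilon> \<Gamma> \<delta> n x) = (if S = {} then ereal (mean (empirical n x)) else Sup (ereal ` S))"
    unfolding pi1h_def Let_def eq using n by (simp only: if_False snd_conv neq0_conv[symmetric])
  moreover have "R.endpt \<delta> n x = (if S = {} then ereal (1 * mean (empirical n x)) else Sup (ereal ` S))"
    unfolding R.endpt_def Let_def S_def ..
  ultimately show ?thesis by simp
qed

lemma pi1h_left:
  assumes n: "0 < n" shows "fst (pi1h \<epsilon> \<Gamma> \<delta> n x) = - L.endpt \<delta> n x"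
proof -
  define S where "S = {t. -1 * mean (empirical n x) < t \<and> ereal n * L.KLs (empirical n x) t \<le> ereal (beta n \<delta>)}"
  have eq: "{q. q < mean (empirical n x) \<and> ereal n * KL_inf (empirical n x) (heavy_tailed \<epsilon> \<Gamma>) q \<le> ereal (beta n \<delta>)}
     = uminus ` S"
  proof (intro set_eqI iffI)
    fix q assume "q \<in> {q. q < mean (empirical n x) \<and> ereal n * KL_inf (empirical n x) (heavy_tailed \<epsilon> \<Gamma>) q \<le> ereal (beta n \<delta>)}"
    then have "- q \<in> S" unfolding S_def by (auto simp: L.KL_inf_eq_KLs_left)
    then show "q \<in> uminus ` S" by (intro image_eqI[of _ _ "- q"]) auto
  next
    fix q assume "q \<in> uminus ` S"
    then show "q \<in> {q. q < mean (empirical n x) \<and> ereal n * KL_inf (empirical n x) (heavy_tailed \<epsilon> \<Gamma>) q \<le> ereal (beta n \<delta>)}"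
      unfolding S_def by (auto simp: L.KL_inf_eq_KLs_left)
  qed
  have inf: "Inf (ereal ` uminus ` S) = - Sup (ereal ` S)"
  proof -
    have "ereal ` uminus ` S = uminus ` (ereal ` S)" by (auto simp: image_image)
    then show ?thesis by (simp only: ereal_Inf_uminus_image_eq)
  qed
  have "fst (pi1h \<epsilon> \<Gamma> \<delta> n x) = (if uminus ` S = {} then ereal (mean (empirical n x)) else Inf (ereal ` uminus ` S))"
    unfolding pi1h_def Let_def eq using n by (simp only: if_False fst_conv neq0_conv[symmetric])
  moreover have "L.endpt \<delta> n x = (if S = {} then ereal (-1 * mean (empirical n x)) else Sup (ereal ` S))"
    unfolding L.endpt_def Let_def S_def ..
  ultimately show ?thesis unfolding inf by simp
qed

lemma pi1h_zero: "pi1h \<epsilon> \<Gamma> \<delta> 0 x = (ereal (- R.M), ereal R.M)"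
  by (simp add: pi1h_def R.M_def)

lemma pi1h_is_policy: "is_policy (pi1h \<epsilon> \<Gamma>)"
  unfolding is_policy_def
proof (intro ballI allI)
  fix \<delta> :: real and n :: nat assume "\<delta> \<in> {0<..<1}"
  show "(\<lambda>x. fst (pi1h \<epsilon> \<Gamma> \<delta> n x)) \<in> borel_measurable (\<Pi>\<^sub>M i\<in>{..<n}. (borel :: real measure)) \<and>
     (\<lambda>x. snd (pi1h \<epsilon> \<Gamma> \<delta> n x)) \<in> borel_measurable (\<Pi>\<^sub>M i\<in>{..<n}. (borel :: real measure)) \<and>
     (\<forall>x\<in>space (\<Pi>\<^sub>M i\<in>{..<n}. (borel :: real measure)). fst (pi1h \<epsilon> \<Gamma> \<delta> n x) \<le> snd (pi1h \<epsilon> \<Gamma> \<delta> n x))"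
  proof (cases "n = 0")
    case True
    then show ?thesis using R.M_pos by (simp add: pi1h_zero)
  next
    case False
    then have n: "0 < n" by simp
    have "fst (pi1h \<epsilon> \<Gamma> \<delta> n x) \<le> snd (pi1h \<epsilon> \<Gamma> \<delta> n x)" for x
    proof -
      have "ereal (- mean (empirical n x)) \<le> L.endpt \<delta> n x" using L.endpt_ge_mean[of n x \<delta>] by simp
      then have "- L.endpt \<delta> n x \<le> ereal (mean (empirical n x))" by (simp add: ereal_uminus_le_reorder)
      also have "\<dots> \<le> R.endpt \<delta> n x" using R.endpt_ge_mean[of n x \<delta>] by simp
      finally show ?thesis by (simp add: pi1h_left[OF n] pi1h_right[OF n])
    qed
    moreover have "(\<lambda>x. - L.endpt \<delta> n x) \<in> borel_measurable (\<Pi>\<^sub>M i\<in>{..<n}. (borel :: real measure))"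
      using L.endpt_measurable[OF n] by (intro borel_measurable_uminus_ereal) simp
    ultimately show ?thesis
      using R.endpt_measurable[OF n] by (auto simp: pi1h_left[OF n] pi1h_right[OF n])
  qed
qed

lemma reported_right: "1 \<le> tau (B \<delta>) (snd \<omega>) \<Longrightarrow>
    snd (reported (pi1h \<epsilon> \<Gamma>) B \<delta> \<omega>) = R.endpt \<delta> (tau (B \<delta>) (snd \<omega>)) (fst \<omega>)"
  by (simp add: reported_def Let_def pi1h_right R.endpt_restrict)

lemma reported_left: "1 \<le> tau (B \<delta>) (snd \<omega>) \<Longrightarrow>
    - fst (reported (pi1h \<epsilon> \<Gamma>) B \<delta> \<omega>) = L.endpt \<delta> (tau (B \<delta>) (snd \<omega>)) (fst \<omega>)"
  by (simp add: reported_def Let_def pi1h_left L.endpt_restrict)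

lemma reported_zero: "tau (B \<delta>) (snd \<omega>) = 0 \<Longrightarrow>
    reported (pi1h \<epsilon> \<Gamma>) B \<delta> \<omega> = (ereal (- R.M), ereal R.M)"
  by (simp add: reported_def Let_def pi1h_zero)

text \<open>
The exceptional sets of the two sides are united for each $n$ and then evaluated at the independent
sample size. Without samples the interval contains every mean that occurs in the class.
\<close>
lemma coverage:
  assumes k: "\<kappa> \<in> heavy_tailed \<epsilon> \<Gamma>" and cost: "cost_distribution \<C>" and d: "\<delta> \<in> {0<..<1}"
  shows "1 - \<delta> \<le> measure (joint_law \<kappa> \<C>)
     {\<omega>\<in>space (joint_law \<kappa> \<C>).
        ereal (mean \<kappa>) \<in> {fst (reported (pi1h \<epsilon> \<Gamma>) B \<delta> \<omega>)..snd (reported (pi1h \<epsilon> \<Gamma>) B \<delta> \<omega>)}}"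
proof -
  interpret K: real_distribution \<kappa> using k by (simp add: heavy_tailed_def)
  interpret C: real_distribution \<C> using cost by (simp add: cost_distribution_def)
  interpret P: prob_space "iid \<kappa>" by (rule prob_space_iid) (rule K.prob_space_axioms)
  interpret Q: prob_space "iid \<C>" by (rule prob_space_iid) (rule C.prob_space_axioms)
  interpret J: pair_prob_space "iid \<kappa>" "iid \<C>" ..
  let ?J = "iid \<kappa> \<Otimes>\<^sub>M iid \<C>"
  have [measurable]: "tau (B \<delta>) \<in> iid \<C> \<rightarrow>\<^sub>M count_space UNIV" by (rule tau_measurable) simp
  have d0: "0 < \<delta>" using d by simp
  have "\<exists>D. D \<in> sets (iid \<kappa>) \<and> measure (iid \<kappa>) D \<le> \<delta> \<and> (\<forall>x\<in>space (iid \<kappa>). x \<notin> D \<longrightarrow>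
      - L.endpt \<delta> n x \<le> ereal (mean \<kappa>) \<and> ereal (mean \<kappa>) \<le> R.endpt \<delta> n x)" if n: "0 < n" for n
  proof -
    obtain D1 where D1: "D1 \<in> sets (iid \<kappa>)" "measure (iid \<kappa>) D1 \<le> \<delta> / 2"
      "\<And>x. x \<in> space (iid \<kappa>) \<Longrightarrow> x \<notin> D1 \<Longrightarrow> 1 * mean (empirical n x) < 1 * mean \<kappa> \<Longrightarrow>
         ereal n * R.KLs (empirical n x) (1 * mean \<kappa>) \<le> ereal (beta n \<delta>)"
      using R.deviation_bound[OF k n d0] by blast
    obtain D2 where D2: "D2 \<in> sets (iid \<kappa>)" "measure (iid \<kappa>) D2 \<le> \<delta> / 2"
      "\<And>x. x \<in> space (iid \<kappa>) \<Longrightarrow> x \<notin> D2 \<Longrightarrow> -1 * mean (empirical n x) < -1 * mean \<kappa> \<Longrightarrow>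
         ereal n * L.KLs (empirical n x) (-1 * mean \<kappa>) \<le> ereal (beta n \<delta>)"
      using L.deviation_bound[OF k n d0] by blast
    show ?thesis
    proof (intro exI[of _ "D1 \<union> D2"] conjI ballI impI)
      show "D1 \<union> D2 \<in> sets (iid \<kappa>)" using D1 D2 by auto
      show "measure (iid \<kappa>) (D1 \<union> D2) \<le> \<delta>" using measure_Un_le[OF D1(1) D2(1)] D1(2) D2(2) by linarith
      fix x assume x: "x \<in> space (iid \<kappa>)" "x \<notin> D1 \<union> D2"
      show "ereal (mean \<kappa>) \<le> R.endpt \<delta> n x"
      proof (cases "mean (empirical n x) < mean \<kappa>")
        case True
        then show ?thesis using D1(3)[of x] x by (intro R.endpt_ge) auto
      next
        case False
        then have "ereal (mean \<kappa>) \<le> ereal (1 * mean (empirical n x))" by simp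
        then show ?thesis using R.endpt_ge_mean by (rule order_trans)
      qed
      have "ereal (- mean \<kappa>) \<le> L.endpt \<delta> n x"
      proof (cases "mean \<kappa> < mean (empirical n x)")
        case True
        then show ?thesis using D2(3)[of x] x by (intro L.endpt_ge) auto
      next
        case False
        then have "ereal (- mean \<kappa>) \<le> ereal (-1 * mean (empirical n x))" by simp
        then show ?thesis using L.endpt_ge_mean by (rule order_trans)
      qed
      then show "- L.endpt \<delta> n x \<le> ereal (mean \<kappa>)" by (simp add: ereal_uminus_le_reorder)
    qed
  qed
  then obtain D where D: "\<And>n. 0 < n \<Longrightarrow> D n \<in> sets (iid \<kappa>)" "\<And>n. 0 < n \<Longrightarrow> measure (iid \<kappa>) (D n) \<le> \<delta>"
    "\<And>n x. 0 < n \<Longrightarrow> x \<in> space (iid \<kappa>) \<Longrightarrow> x \<notin> D n \<Longrightarrow>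
      - L.endpt \<delta> n x \<le> ereal (mean \<kappa>) \<and> ereal (mean \<kappa>) \<le> R.endpt \<delta> n x" by metis
  define D' where "D' n = (if 0 < n then D n else {})" for n
  define E where "E = {\<omega>\<in>space ?J. tau (B \<delta>) (snd \<omega>) \<in> {1..} \<and> fst \<omega> \<in> D' (tau (B \<delta>) (snd \<omega>))}"
  have E: "E \<in> sets ?J" "measure ?J E \<le> \<delta>"
    unfolding E_def
    by (rule random_index_bound[where P="iid \<kappa>" and Q="iid \<C>" and d=\<delta>, OF P.prob_space_axioms Q.prob_space_axioms];
        use D d0 in \<open>simp add: D'_def\<close>)+
  let ?G = "{\<omega>\<in>space ?J. ereal (mean \<kappa>) \<in> {fst (reported (pi1h \<epsilon> \<Gamma>) B \<delta> \<omega>)..snd (reported (pi1h \<epsilon> \<Gamma>) B \<delta> \<omega>)}}"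
  have restr: "(\<lambda>\<omega>. restrict (fst \<omega>) {..<n}) \<in> ?J \<rightarrow>\<^sub>M (\<Pi>\<^sub>M i\<in>{..<n}. (borel :: real measure))" for n :: nat
  proof -
    have "(\<lambda>x. restrict x {..<n}) \<in> iid \<kappa> \<rightarrow>\<^sub>M (\<Pi>\<^sub>M i\<in>{..<n}. (borel :: real measure))"
      by (rule measurable_restrict) measurable
    then show ?thesis by (rule measurable_compose[OF measurable_fst])
  qed
  have comp: "(\<lambda>\<omega>. F (tau (B \<delta>) (snd \<omega>)) (restrict (fst \<omega>) {..<tau (B \<delta>) (snd \<omega>)})) \<in> borel_measurable ?J"
    if "\<And>n. F n \<in> borel_measurable (\<Pi>\<^sub>M i\<in>{..<n}. (borel :: real measure))" for F :: "nat \<Rightarrow> (nat \<Rightarrow> real) \<Rightarrow> ereal"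
    by (rule measurable_compose_countable[where f="\<lambda>n \<omega>. F n (restrict (fst \<omega>) {..<n})"])
      (use measurable_compose[OF restr that] in \<open>auto intro: measurable_compose[OF measurable_snd]\<close>)
  have pol: "(\<lambda>x. fst (pi1h \<epsilon> \<Gamma> \<delta> n x)) \<in> borel_measurable (\<Pi>\<^sub>M i\<in>{..<n}. (borel :: real measure))"
    "(\<lambda>x. snd (pi1h \<epsilon> \<Gamma> \<delta> n x)) \<in> borel_measurable (\<Pi>\<^sub>M i\<in>{..<n}. (borel :: real measure))" for n
    using pi1h_is_policy d unfolding is_policy_def by blast+
  have [measurable]: "(\<lambda>\<omega>. fst (reported (pi1h \<epsilon> \<Gamma>) B \<delta> \<omega>)) \<in> borel_measurable ?J"
    "(\<lambda>\<omega>. snd (reported (pi1h \<epsilon> \<Gamma>) B \<delta> \<omega>)) \<in> borel_measurable ?J"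
    using comp[OF pol(1)] comp[OF pol(2)] by (simp_all add: reported_def Let_def)
  have Gm: "?G \<in> sets ?J" unfolding atLeastAtMost_iff by measurable
  have "space ?J - E \<subseteq> ?G"
  proof
    fix \<omega> assume \<omega>: "\<omega> \<in> space ?J - E"
    let ?n = "tau (B \<delta>) (snd \<omega>)"
    show "\<omega> \<in> ?G"
    proof (cases "?n = 0")
      case True
      then show ?thesis using \<omega> R.heavy_mean_le[OF k] L.heavy_mean_le[OF k] M_eq by (simp add: reported_zero)
    next
      case False
      then have n: "0 < ?n" "1 \<le> ?n" by auto
      have x: "fst \<omega> \<in> space (iid \<kappa>)" "fst \<omega> \<notin> D ?n"
        using \<omega> n by (auto simp: E_def D'_def space_pair_measure)
      have "fst (reported (pi1h \<epsilon> \<Gamma>) B \<delta> \<omega>) = - L.endpt \<delta> ?n (fst \<omega>)"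
        using reported_left[of B \<delta> \<omega>, OF n(2)] by (metis ereal_uminus_uminus)
      then show ?thesis using D(3)[OF n(1) x] \<omega> reported_right[of B \<delta> \<omega>, OF n(2)] by auto
    qed
  qed
  then have "measure ?J (space ?J - E) \<le> measure ?J ?G" using Gm by (intro J.finite_measure_mono)
  moreover have "measure ?J (space ?J - E) = 1 - measure ?J E" using E by (intro J.prob_compl)
  ultimately show ?thesis using E unfolding joint_law_def by linarith
qed

end

theorem theorem9:
  fixes \<epsilon> \<Gamma> \<mu> cbar :: real
    and \<nu> \<C> :: "real measure"
    and B :: "real \<Rightarrow> real"
    and L :: ereal
  assumes "\<epsilon> > 0" and "\<Gamma> > 0"
    and "\<nu> \<in> heavy_tailed \<epsilon> \<Gamma>"
    and "(\<integral>\<^sup>+ x. ennreal (\<bar>x\<bar> powr (1 + \<epsilon>)) \<partial>\<nu>) < ennreal \<Gamma>"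
    and "mean \<nu> = \<mu>"
    and "cost_distribution \<C>" and "mean \<C> = cbar" and "0 < cbar"
    and "\<And>\<delta>. \<delta> \<in> {0<..<1} \<Longrightarrow> B \<delta> > 0"
    and "filterlim B at_top (at_right 0)"
    and "0 \<le> L"
    and "((\<lambda>\<delta>. ereal (B \<delta> / ln (1 / \<delta>))) \<longlongrightarrow> L) (at_right 0)"
  shows "pi1h \<epsilon> \<Gamma> \<in> stable_CI_policies (heavy_tailed \<epsilon> \<Gamma>) \<nu> \<C> B \<and>
    (\<forall>k::real. 0 < k \<and> L = ereal k \<longrightarrow>
       (\<exists>!x. \<mu> < x \<and> KL_inf \<nu> (heavy_tailed \<epsilon> \<Gamma>) x = ereal (cbar / k)) \<and>
       (\<exists>!x. x < \<mu> \<and> KL_inf \<nu> (heavy_tailed \<epsilon> \<Gamma>) x = ereal (cbar / k)) \<and>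
       limiting_endpoints (pi1h \<epsilon> \<Gamma>) \<nu> \<C> B
         (ereal (mu_L_star (heavy_tailed \<epsilon> \<Gamma>) \<nu> k cbar))
         (ereal (mu_R_star (heavy_tailed \<epsilon> \<Gamma>) \<nu> k cbar))) \<and>
    (L = \<infinity> \<longrightarrow>
       (\<exists>l r. limiting_endpoints (pi1h \<epsilon> \<Gamma>) \<nu> \<C> B l r \<and> r - l = 0))"
proof -
  interpret S: two_sided \<epsilon> \<Gamma> using assms by unfold_locales auto
  let ?H = "heavy_tailed \<epsilon> \<Gamma>"
  have nu: "S.R.fin_mom \<nu>" "S.L.fin_mom \<nu>" using S.R.heavy_fin_mom S.L.heavy_fin_mom assms(3) by auto
  have mom: "(\<integral>x. \<bar>x\<bar> powr (1 + \<epsilon>) \<partial>\<nu>) < \<Gamma>"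
  proof -
    have "ennreal (\<integral>x. \<bar>x\<bar> powr (1 + \<epsilon>) \<partial>\<nu>) < ennreal \<Gamma>"
      using assms(4) nn_integral_eq_integral[OF S.R.fin_momD(3)[OF nu(1)]] by simp
    then show ?thesis by (subst (asm) ennreal_less_iff) (auto intro: integral_nonneg_AE)
  qed
  define rep where "rep \<delta> \<omega> = reported (pi1h \<epsilon> \<Gamma>) B \<delta> \<omega>" for \<delta> \<omega>
  interpret R: budgeted \<epsilon> \<Gamma> 1 \<nu> \<C> cbar B L "\<lambda>\<delta> \<omega>. snd (rep \<delta> \<omega>)"
    by unfold_locales (use assms nu mom in \<open>auto simp: rep_def S.reported_right\<close>)
  interpret L: budgeted \<epsilon> \<Gamma> "-1" \<nu> \<C> cbar B L "\<lambda>\<delta> \<omega>. - fst (rep \<delta> \<omega>)"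
    by unfold_locales (use assms nu mom in \<open>auto simp: rep_def S.reported_left\<close>)
  have mid: "R.mid = \<mu>" "L.mid = - \<mu>" using assms by (auto simp: R.mid_def L.mid_def)
  have endpoints: "limiting_endpoints (pi1h \<epsilon> \<Gamma>) \<nu> \<C> B (ereal (- l)) (ereal r)"
    if "tendsto_in_prob R.J (\<lambda>\<delta> \<omega>. - fst (rep \<delta> \<omega>)) (ereal l)" "- \<mu> \<le> l"
      "tendsto_in_prob R.J (\<lambda>\<delta> \<omega>. snd (rep \<delta> \<omega>)) (ereal r)" "\<mu> \<le> r" for l r
    using tendsto_in_prob_uminus[OF that(1)] that assms(5)
    by (simp add: limiting_endpoints_def joint_law_def rep_def)
  have ci: "pi1h \<epsilon> \<Gamma> \<in> CI_policies ?H \<C> B"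
    unfolding CI_policies_def using S.pi1h_is_policy S.coverage[OF _ assms(6)] by blast
  have right: "\<mu> < x \<and> KL_inf \<nu> ?H x = c \<longleftrightarrow> R.mid < x \<and> S.R.KLs \<nu> x = c" for x c
    using assms(5) by (auto simp: mid S.R.KL_inf_eq_KLs_right)
  have left: "x < \<mu> \<and> KL_inf \<nu> ?H x = c \<longleftrightarrow> L.mid < - x \<and> S.L.KLs \<nu> (- x) = c" for x c
    using assms(5) by (auto simp: mid S.L.KL_inf_eq_KLs_left)
  have root: "(\<exists>!x. \<mu> < x \<and> KL_inf \<nu> ?H x = ereal (cbar / k)) \<and>
       (\<exists>!x. x < \<mu> \<and> KL_inf \<nu> ?H x = ereal (cbar / k)) \<and>
       limiting_endpoints (pi1h \<epsilon> \<Gamma>) \<nu> \<C> B (ereal (mu_L_star ?H \<nu> k cbar)) (ereal (mu_R_star ?H \<nu> k cbar))"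
    if k: "0 < k" "L = ereal k" for k
  proof -
    have ck: "0 < cbar / k" using k assms by simp
    obtain r where r: "R.mid < r" "r < S.R.M" "R.rate r = cbar / k" using R.root_exists[OF ck] by blast
    obtain l where l: "L.mid < l" "l < S.L.M" "L.rate l = cbar / k" using L.root_exists[OF ck] by blast
    have exr: "\<exists>!x. \<mu> < x \<and> KL_inf \<nu> ?H x = ereal (cbar / k)"
      unfolding right by (rule R.root_unique[OF ck])
    have exl: "\<exists>!x. x < \<mu> \<and> KL_inf \<nu> ?H x = ereal (cbar / k)"
      unfolding left using L.root_unique[OF ck] by (metis minus_minus)
    have "\<mu> < r \<and> KL_inf \<nu> ?H r = ereal (cbar / k)" unfolding right using r R.KLs_rate by simp
    then have r': "mu_R_star ?H \<nu> k cbar = r"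
      unfolding mu_R_star_def using exr assms(5) by (intro the1_equality) auto
    have "- l < \<mu> \<and> KL_inf \<nu> ?H (- l) = ereal (cbar / k)" unfolding left using l L.KLs_rate by simp
    then have l': "mu_L_star ?H \<nu> k cbar = - l"
      unfolding mu_L_star_def using exl assms(5) by (intro the1_equality) auto
    have "limiting_endpoints (pi1h \<epsilon> \<Gamma>) \<nu> \<C> B (ereal (- l)) (ereal r)"
      using L.Y_tendsto_root[OF k(2,1) l] R.Y_tendsto_root[OF k(2,1) r] l(1) r(1)
      by (intro endpoints) (auto simp: mid)
    then show ?thesis using exr exl r' l' by simp
  qed
  have top: "limiting_endpoints (pi1h \<epsilon> \<Gamma>) \<nu> \<C> B (ereal \<mu>) (ereal \<mu>)" if "L = \<infinity>"
    using endpoints[of "- \<mu>" \<mu>] L.Y_tendsto_top[OF that] R.Y_tendsto_top[OF that] by (simp add: mid)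
  have zero: "limiting_endpoints (pi1h \<epsilon> \<Gamma>) \<nu> \<C> B (ereal (- S.L.M)) (ereal S.R.M)" if "L = 0"
    using endpoints[of S.L.M S.R.M] L.Y_tendsto_0[OF that] R.Y_tendsto_0[OF that] L.mid_less R.mid_less by (simp add: mid)
  have "\<exists>l r. limiting_endpoints (pi1h \<epsilon> \<Gamma>) \<nu> \<C> B l r"
  proof (cases L)
    case (real k)
    then show ?thesis using root[of k] zero assms(11) by (cases "k = 0") (auto simp: zero_ereal_def)
  next
    case PInf
    then show ?thesis using top by blast
  next
    case MInf
    then show ?thesis using assms(11) by simp
  qed
  then have "pi1h \<epsilon> \<Gamma> \<in> stable_CI_policies ?H \<nu> \<C> B" using ci by (simp add: stable_CI_policies_def)
  moreover have "\<exists>l r. limiting_endpoints (pi1h \<epsilon> \<Gamma>) \<nu> \<C> B l r \<and> r - l = 0" if "L = \<infinity>"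
    using top[OF that] by (intro exI[of _ "ereal \<mu>"]) (simp add: zero_ereal_def)
  ultimately show ?thesis using root by blast
qed

end
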